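(* Let $k$ be a field of characteristic zero, $q\in k$ nonzero and not a root of unity, $c,d\in k$ arbitrary with $c+d\neq 0$, and let $\mathcal{A}=\mathcal{A}(c,d)$ be the coordinate algebra of the Podleś quantum sphere. Then: 1. If $\sigma=\sigma_\lambda$ with $\lambda=q^{-(2b+2)}$ for some integer $b\ge 0$, then $HH_2^\sigma(\mathcal{A})\cong k$. These automorphisms are precisely the positive powers of the modular automorphism $\sigma_{\mathrm{mod}}$. 2. For all other automorphisms $\sigma_\lambda$ ($\lambda\in k\setminus\{0\}$), and, when $c=d$, for all $\tau_\lambda$ ($\lambda\in k\setminus\{0\}$), one has $HH_2^\sigma(\mathcal{A})=0$.
   Context: $\mathcal{A}(c,d)$ is the unital $k$-algebra with generators $A,B,B^*$ and relations $BA=q^2AB$, $AB^*=q^2B^*A$, $B^*B=cd+(c-d)A-A^2$, $BB^*=cd+q^2(c-d)A-q^4A^2$. Automorphisms: for $\lambda\in k$, $\lambda\neq0$, $\sigma_\lambda$ is given by $\sigma_\lambda(B)=\lambda B$, $\sigma_\lambda(A)=A$, $\sigma_\lambda(B^* )=\lambda^{-1}B^*$. If $c=d$, there is also $\tau_\lambda$ given by $\tau_\lambda(B)=\lambda B$, $\tau_\lambda(A)=-A$, $\tau_\lambda(B^* )=\lambda^{-1}B^*$. (These are all the automorphisms of $\mathcal{A}(c,d)$; $\tau_\lambda$ occurs only when $c=d$.) The modular automorphism is $\sigma_{\mathrm{mod}}:A\mapsto A,\ B\mapsto q^{-2}B,\ B^*\mapsto q^2B^*$. (Over $\mathbb{C}$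 it is the automorphism with $h(xy)=h(y\,\sigma_{\mathrm{mod}}(x))$ for the quantum $SU(2)$-invariant linear functional $h$ with $h(1)=1$; on the standard Podleś sphere it is the restriction of the modular automorphism of the Haar state on quantum $SU(2)$.) Twisted Hochschild homology: for a unital $k$-algebra $\mathcal{A}$ and an automorphism $\sigma$, let $C_n^\sigma(\mathcal{A})=\mathcal{A}^{\otimes(n+1)}/\mathrm{im}(\mathrm{id}-\sigma^{\otimes(n+1)})$, with differential $b_\sigma:C_{n+1}^\sigma(\mathcal{A})\to C_n^\sigma(\mathcal{A})$ induced by $$b_\sigma(a_0,\dots,a_{n+1})=\sum_{j=0}^{n}(-1)^j(a_0,\dots,a_ja_{j+1},\dots,a_{n+1})+(-1)^{n+1}(\sigma(a_{n+1})a_0,a_1,\dots,a_n),$$ where $(a_0,\dots,a_n)$ denotes $a_0\otimes\cdots\otimes a_n$. $HH_*^\sigma(\mathcal{A})$ is the homology of $(C_n^\sigma(\mathcal{A}),b_\sigma)_{n\ge0}$. *)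

theory Defs
  imports
    "HOL-Algebra.Algebra"
    "HOL-Algebra.Algebraic_Closure_Type"
    "HOL-Library.Poly_Mapping"
begin

text \<open>
  The ground field is a type \<open>'k::field\<close>; the record \<open>ring_of_type_algebra\<close> turns it into
  a \<open>HOL-Algebra\<close> ring. Vector spaces and (noncommutative) algebras over it are records of
  type \<open>('k, 'a) module\<close>; for a mere vector space the fields \<open>mult\<close> and \<open>one\<close> are irrelevant.
\<close>

section \<open>Linear algebra\<close>

text \<open>
  The quotient of \<open>M\<close> by a subspace or, if \<open>M\<close> is an algebra, by a two-sided ideal.
  The ring structure is that of \<open>Quot\<close>; the scalar action is \<open>r (N + x) = N + r x\<close>.
\<close>
definition quot :: "('k, 'a) module \<Rightarrow> 'a set \<Rightarrow> ('k, 'a set) module" where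
  "quot M N = ring.extend (M Quot N)
     (module.fields (\<lambda>r C. \<Union>x\<in>C. N +>\<^bsub>M\<^esub> (r \<odot>\<^bsub>M\<^esub> x)))"

text \<open>
  The map \<open>M/N \<rightarrow> M'/N'\<close>, \<open>N + x \<mapsto> N' + f x\<close>, induced by a linear map \<open>f : M \<rightarrow> M'\<close>
  with \<open>f N \<subseteq> N'\<close>; only the target is needed to write it down. On a coset all the
  sets in the union coincide.
\<close>
definition quot_map :: "('k, 'b) module \<Rightarrow> 'b set \<Rightarrow> ('a \<Rightarrow> 'b) \<Rightarrow> 'a set \<Rightarrow> 'b set" where
  "quot_map M' N' f C = (\<Union>x\<in>C. N' +>\<^bsub>M'\<^esub> f x)"

definition span_in :: "('k::field, 'a) module \<Rightarrow> 'a set \<Rightarrow> 'a set" where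
  "span_in M S = \<Inter>{H. submodule H ring_of_type_algebra M \<and> S \<subseteq> H}"

definition linear_iso :: "('k, 'a) module \<Rightarrow> ('k, 'b) module \<Rightarrow> bool" where
  "linear_iso M N \<longleftrightarrow> (\<exists>f. bij_betw f (carrier M) (carrier N) \<and>
     (\<forall>x\<in>carrier M. \<forall>y\<in>carrier M. f (x \<oplus>\<^bsub>M\<^esub> y) = f x \<oplus>\<^bsub>N\<^esub> f y) \<and>
     (\<forall>r. \<forall>x\<in>carrier M. f (r \<odot>\<^bsub>M\<^esub> x) = r \<odot>\<^bsub>N\<^esub> f x))"

definition ground_space :: "('k::field, 'k) module" where
  "ground_space = ring.extend ring_of_type_algebra (module.fields (*))"

definition fscale :: "'k::field \<Rightarrow> ('s \<Rightarrow>\<^sub>0 'k) \<Rightarrow> 's \<Rightarrow>\<^sub>0 'k" where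
  "fscale r p = Poly_Mapping.map ((*) r) p"

definition free_space :: "'s set \<Rightarrow> ('k::field, 's \<Rightarrow>\<^sub>0 'k) module" where
  "free_space S = \<lparr>carrier = {p. Poly_Mapping.keys p \<subseteq> S}, monoid.mult = undefined, one = undefined,
     ring.zero = 0, add = (+), module.smult = fscale\<rparr>"

definition lin_ext :: "('s \<Rightarrow> 't \<Rightarrow>\<^sub>0 'k) \<Rightarrow> ('s \<Rightarrow>\<^sub>0 'k::field) \<Rightarrow> 't \<Rightarrow>\<^sub>0 'k" where
  "lin_ext g p = (\<Sum>s\<in>Poly_Mapping.keys p. fscale (Poly_Mapping.lookup p s) (g s))"

section \<open>Tensor powers\<close>

definition tuples :: "('k, 'a) module \<Rightarrow> nat \<Rightarrow> 'a list set" where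
  "tuples M m = {xs. length xs = m \<and> set xs \<subseteq> carrier M}"

abbreviation tup :: "'a list \<Rightarrow> 'a list \<Rightarrow>\<^sub>0 'k::field" where
  "tup xs \<equiv> Poly_Mapping.single xs 1"

definition multilinear_rels :: "('k::field, 'a) module \<Rightarrow> nat \<Rightarrow> ('a list \<Rightarrow>\<^sub>0 'k) set" where
  "multilinear_rels M m =
     {tup (xs @ [x \<oplus>\<^bsub>M\<^esub> y] @ ys) - tup (xs @ [x] @ ys) - tup (xs @ [y] @ ys) | xs x y ys.
        xs @ [x] @ ys \<in> tuples M m \<and> y \<in> carrier M} \<union>
     {tup (xs @ [r \<odot>\<^bsub>M\<^esub> x] @ ys) - fscale r (tup (xs @ [x] @ ys)) | xs r x ys.
        xs @ [x] @ ys \<in> tuples M m}"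

definition tensor_null :: "('k::field, 'a) module \<Rightarrow> nat \<Rightarrow> ('a list \<Rightarrow>\<^sub>0 'k) set" where
  "tensor_null M m = span_in (free_space (tuples M m)) (multilinear_rels M m)"

text \<open>
  The \<open>m\<close>-fold tensor power of \<open>M\<close> over the ground field; \<open>x\<^sub>1 \<otimes> \<dots> \<otimes> x\<^sub>m\<close> is the class
  of \<open>tup [x\<^sub>1, \<dots>, x\<^sub>m]\<close>.
\<close>
definition tensor_power :: "('k::field, 'a) module \<Rightarrow> nat \<Rightarrow> ('k, ('a list \<Rightarrow>\<^sub>0 'k) set) module" where
  "tensor_power M m = quot (free_space (tuples M m)) (tensor_null M m)"

text \<open>
  The linear map from some tensor power of \<open>M\<close> to the \<open>n\<close>-fold one sending the class of
  \<open>tup xs\<close> to the class of \<open>g xs\<close>, for \<open>g\<close> multilinear modulo \<open>tensor_null M n\<close>.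
\<close>
definition tensor_lift ::
  "('k::field, 'a) module \<Rightarrow> nat \<Rightarrow> ('a list \<Rightarrow> 'a list \<Rightarrow>\<^sub>0 'k) \<Rightarrow>
    ('a list \<Rightarrow>\<^sub>0 'k) set \<Rightarrow> ('a list \<Rightarrow>\<^sub>0 'k) set" where
  "tensor_lift M n g = quot_map (free_space (tuples M n)) (tensor_null M n) (lin_ext g)"

section \<open>Twisted Hochschild homology\<close>

context
  fixes M :: "('k::field, 'a) module" and \<sigma> :: "'a \<Rightarrow> 'a"
begin

text \<open>\<open>id - \<sigma>\<^sup>\<otimes>\<^sup>m\<close> on the \<open>m\<close>-fold tensor power, and its image\<close>
definition twist_null :: "nat \<Rightarrow> ('a list \<Rightarrow>\<^sub>0 'k) set set" where
  "twist_null m =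
     (\<lambda>x. x \<ominus>\<^bsub>tensor_power M m\<^esub> tensor_lift M m (\<lambda>xs. tup (map \<sigma> xs)) x) ` carrier (tensor_power M m)"

definition hoch_chains :: "nat \<Rightarrow> ('k, ('a list \<Rightarrow>\<^sub>0 'k) set set) module" where
  "hoch_chains n = quot (tensor_power M (n + 1)) (twist_null (n + 1))"

text \<open>The formula for \<open>b\<^sub>\<sigma> (a\<^sub>0, \<dots>, a\<^sub>n\<^sub>+\<^sub>1)\<close>, with \<open>as = [a\<^sub>0, \<dots>, a\<^sub>n\<^sub>+\<^sub>1]\<close>.\<close>
definition hoch_formula :: "nat \<Rightarrow> 'a list \<Rightarrow> 'a list \<Rightarrow>\<^sub>0 'k" where
  "hoch_formula n as =
     (\<Sum>j\<le>n. fscale ((-1) ^ j) (tup (take j as @ [as ! j \<otimes>\<^bsub>M\<^esub> as ! (j + 1)] @ drop (j + 2) as)))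
     + fscale ((-1) ^ (n + 1)) (tup ((\<sigma> (as ! (n + 1)) \<otimes>\<^bsub>M\<^esub> as ! 0) # map ((!) as) [1..<n+1]))"

text \<open>The differential from degree \<open>n + 1\<close> to degree \<open>n\<close>\<close>
definition hoch_diff :: "nat \<Rightarrow> ('a list \<Rightarrow>\<^sub>0 'k) set set \<Rightarrow> ('a list \<Rightarrow>\<^sub>0 'k) set set" where
  "hoch_diff n = quot_map (tensor_power M (n + 1)) (twist_null (n + 1))
     (tensor_lift M (n + 1) (hoch_formula n))"

definition hoch_cycles :: "nat \<Rightarrow> ('a list \<Rightarrow>\<^sub>0 'k) set set set" where
  "hoch_cycles n = {x \<in> carrier (hoch_chains n).
     \<forall>m. n = Suc m \<longrightarrow> hoch_diff m x = \<zero>\<^bsub>hoch_chains m\<^esub>}"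

definition hoch_boundaries :: "nat \<Rightarrow> ('a list \<Rightarrow>\<^sub>0 'k) set set set" where
  "hoch_boundaries n = hoch_diff n ` carrier (hoch_chains (n + 1))"

definition twisted_HH :: "nat \<Rightarrow> ('k, ('a list \<Rightarrow>\<^sub>0 'k) set set set) module" where
  "twisted_HH n = quot ((hoch_chains n)\<lparr>carrier := hoch_cycles n\<rparr>) (hoch_boundaries n)"

end

section \<open>The free algebra on three generators\<close>

datatype podles_gen = GenA | GenB | GenBs

text \<open>
  The free monoid, written additively so that \<open>podles_word \<Rightarrow>\<^sub>0 'k\<close> with the convolution product
  of \<open>Poly_Mapping\<close> is the free unital algebra.
\<close>
datatype podles_word = Word (letters: "podles_gen list")

instantiation podles_word :: monoid_add
begin

definition zero_podles_word :: podles_word where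
  "0 = Word []"

definition plus_podles_word :: "podles_word \<Rightarrow> podles_word \<Rightarrow> podles_word" where
  "v + w = Word (letters v @ letters w)"

instance
  by standard (simp_all add: zero_podles_word_def plus_podles_word_def)

end

type_synonym 'k podles_free = "podles_word \<Rightarrow>\<^sub>0 'k"

definition gen :: "podles_gen \<Rightarrow> 'k::field podles_free" where
  "gen x = Poly_Mapping.single (Word [x]) 1"

definition const :: "'k::field \<Rightarrow> 'k podles_free" where
  "const r = Poly_Mapping.single 0 r"

definition free_alg :: "('k::field, 'k podles_free) module" where
  "free_alg = ring.extend ring_of_type_algebra (module.fields fscale)"

text \<open>The algebra endomorphism of the free algebra with \<open>x \<mapsto> g x\<close> on generators\<close>
definition subst :: "(podles_gen \<Rightarrow> 'k podles_free) \<Rightarrow> 'k::field podles_free \<Rightarrow> 'k podles_free" where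
  "subst g = lin_ext (\<lambda>w. prod_list (map g (letters w)))"

section \<open>The Podles sphere and its automorphisms\<close>

definition podles_rels :: "'k::field \<Rightarrow> 'k \<Rightarrow> 'k \<Rightarrow> 'k podles_free set" where
  "podles_rels q c d = (let A = gen GenA; B = gen GenB; Bs = gen GenBs in
     {B * A - const (q^2) * A * B,
      A * Bs - const (q^2) * Bs * A,
      Bs * B - (const (c * d) + const (c - d) * A - A^2),
      B * Bs - (const (c * d) + const (q^2 * (c - d)) * A - const (q^4) * A^2)})"

definition podles_ideal :: "'k::field \<Rightarrow> 'k \<Rightarrow> 'k \<Rightarrow> 'k podles_free set" where
  "podles_ideal q c d = genideal free_alg (podles_rels q c d)"

definition podles :: "'k::field \<Rightarrow> 'k \<Rightarrow> 'k \<Rightarrow> ('k, 'k podles_free set) module" where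
  "podles q c d = quot free_alg (podles_ideal q c d)"

text \<open>
  The endomorphism of \<open>podles q c d\<close> with \<open>x \<mapsto> g x\<close> on generators,
  meaningful when substitution of \<open>g\<close> preserves the ideal of relations.
\<close>
definition podles_end :: "'k::field \<Rightarrow> 'k \<Rightarrow> 'k \<Rightarrow> (podles_gen \<Rightarrow> 'k podles_free) \<Rightarrow>
    'k podles_free set \<Rightarrow> 'k podles_free set" where
  "podles_end q c d g = quot_map free_alg (podles_ideal q c d) (subst g)"

definition sigma_aut :: "'k::field \<Rightarrow> 'k \<Rightarrow> 'k \<Rightarrow> 'k \<Rightarrow> 'k podles_free set \<Rightarrow> 'k podles_free set" where
  "sigma_aut q c d l = podles_end q c d
     (\<lambda>x. case x of GenA \<Rightarrow> gen GenA
                  | GenB \<Rightarrow> const l * gen GenB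
                  | GenBs \<Rightarrow> const (inverse l) * gen GenBs)"

text \<open>This preserves the ideal of relations, and is then an automorphism, only for \<open>c = d\<close>.\<close>
definition tau_aut :: "'k::field \<Rightarrow> 'k \<Rightarrow> 'k \<Rightarrow> 'k \<Rightarrow> 'k podles_free set \<Rightarrow> 'k podles_free set" where
  "tau_aut q c d l = podles_end q c d
     (\<lambda>x. case x of GenA \<Rightarrow> - gen GenA
                  | GenB \<Rightarrow> const l * gen GenB
                  | GenBs \<Rightarrow> const (inverse l) * gen GenBs)"

definition sigma_mod :: "'k::field \<Rightarrow> 'k \<Rightarrow> 'k \<Rightarrow> 'k podles_free set \<Rightarrow> 'k podles_free set" where
  "sigma_mod q c d = podles_end q c d
     (\<lambda>x. case x of GenA \<Rightarrow> gen GenA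
                  | GenB \<Rightarrow> const (q powi (-2)) * gen GenB
                  | GenBs \<Rightarrow> const (q^2) * gen GenBs)"

end

theory Submission
  imports Defs "HOL-Computational_Algebra.Polynomial"
begin

text \<open>
  The second homology is that of a small complex. Rewriting words to the normal forms \<open>A\<^sup>i B\<^sup>j\<close>,
  \<open>A\<^sup>i (B\<^sup>*)\<^sup>j\<close> reduces every 2-chain modulo boundaries to one class \<open>Phi1 n1\<close>, \<dots>, \<open>Phi4 n4\<close> per
  defining relation together with chains that a cycle cannot contain; the overlaps of the relations
  give syzygies among these classes. The cycle condition is a system of \<open>q\<close>-difference
  equations, whose solutions are concentrated in degree zero modulo syzygies. For \<open>\<tau>\<close> nothing remains, and for
  \<open>\<sigma>\<close> a cycle is determined by polynomials \<open>f1\<close>, \<open>f\<close> such that \<open>G = f1 p - p' f\<close>, with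
  \<open>p = (c - A) (d + A)\<close>, satisfies \<open>G(A) = q\<^sup>2 l G(q\<^sup>2 A)\<close>. It bounds if \<open>G = 0\<close>, because \<open>p\<close> and \<open>p'\<close>
  are coprime exactly when \<open>c + d \<noteq> 0\<close>, and \<open>G\<close> can only be a multiple of \<open>A\<^sup>b\<close>, for
  \<open>l = q\<^sup>-\<^sup>(\<^sup>2\<^sup>b\<^sup>+\<^sup>2\<^sup>)\<close>. That \<open>G = A\<^sup>b\<close> does not bound is seen by mapping the sphere into a quantum
  half-plane, where the cup product of the two degree derivations with a twisted trace is a cocycle
  reading off the coefficient of \<open>G\<close>.
\<close>

section \<open>Linear maps on free spaces\<close>

text \<open>Two obstacles shape the formal argument. Homology here consists of cosets of cosets of
  cosets, and a cycle of coinvariants need not come from a cycle of tensors. For the first, one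
  space of formal chains is carried through all quotients and only the chains that vanish are
  recorded. The second disappears because \<open>\<sigma>\<close> scales every normal word: it is
  diagonal on tensors, and the projection onto eigenvalue 1 commutes with the differentials and
  identifies coinvariants with invariants. What remains concerns plain tensors of coordinate
  vectors.

  No resolution is built: explicit 3-chains over the overlaps give the boundaries, and a functional
  detects the surviving class. The bookkeeping uses the grading with \<open>A\<close>,
  \<open>B\<close>, \<open>B\<^sup>*\<close> in degrees 0, 1, -1. Syzygies shift coefficients until
  the equations multiply what is left by a scalar such as
  \<open>q powi (2 * j) - q\<^sup>2 * \<epsilon>\<close>, zero in at most one degree
  \<open>j\<close> because \<open>q\<close> is no root of unity. The Bezout identity of
  \<open>pA\<close> and its derivative has the discriminant \<open>(c + d)\<^sup>2\<close> as
  constant and yields the surviving cycle.\<close>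

abbreviation lookup :: "('s \<Rightarrow>\<^sub>0 'k::zero) \<Rightarrow> 's \<Rightarrow> 'k" where
  "lookup \<equiv> Poly_Mapping.lookup"

abbreviation single :: "'s \<Rightarrow> 'k::zero \<Rightarrow> 's \<Rightarrow>\<^sub>0 'k" where
  "single \<equiv> Poly_Mapping.single"

abbreviation keys :: "('s \<Rightarrow>\<^sub>0 'k::zero) \<Rightarrow> 's set" where
  "keys \<equiv> Poly_Mapping.keys"

lemma lookup_fscale [simp]: "lookup (fscale r p) k = r * lookup p k"
  by (simp add: fscale_def Poly_Mapping.map.rep_eq when_def)

interpretation fs: vector_space fscale
  by unfold_locales (auto intro!: poly_mapping_eqI simp: lookup_add algebra_simps)

lemma fscale_single [simp]: "fscale r (single k c) = single k (r * c)"
  by (auto intro!: poly_mapping_eqI simp: lookup_single when_def)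

lemma keys_fscale: "keys (fscale r p) \<subseteq> keys p"
  by (auto simp: in_keys_iff)

text \<open>A predicate, so that linearity in one slot of a multilinear expression can be stated for
  a lambda abstraction and composed.\<close>

definition lin :: "(('s \<Rightarrow>\<^sub>0 'k::field) \<Rightarrow> 't \<Rightarrow>\<^sub>0 'k) \<Rightarrow> bool" where
  "lin f \<longleftrightarrow> (\<forall>x y. f (x + y) = f x + f y) \<and> (\<forall>r x. f (fscale r x) = fscale r (f x))"

lemma linI:
  "(\<And>x y. f (x + y) = f x + f y) \<Longrightarrow> (\<And>r x. f (fscale r x) = fscale r (f x)) \<Longrightarrow> lin f"
  by (simp add: lin_def)

lemma
  assumes "lin f"
  shows lin_add: "f (x + y) = f x + f y" and lin_scale: "f (fscale r x) = fscale r (f x)"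
    and lin_zero: "f 0 = 0" and lin_minus: "f (- x) = - f x" and lin_diff: "f (x - y) = f x - f y"
    and lin_sum: "f (sum h S) = (\<Sum>s\<in>S. f (h s))"
proof -
  show add: "f (x + y) = f x + f y" and sc: "f (fscale r x) = fscale r (f x)" for x y r
    using assms by (auto simp: lin_def)
  show z: "f 0 = 0"
    using sc[of 0 0] by simp
  show m: "f (- x) = - f x" for x
    using sc[of "-1" x] by (simp add: fs.scale_minus_left)
  show "f (x - y) = f x - f y"
    using add[of x "- y"] m by simp
  show "f (sum h S) = (\<Sum>s\<in>S. f (h s))"
    by (induction S rule: infinite_finite_induct) (auto simp: z add)
qed

lemmas lin_simps = lin_add lin_scale lin_zero lin_minus lin_diff lin_sum

lemma lin_id: "lin (\<lambda>x. x)"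
  and lin_plus: "lin f \<Longrightarrow> lin g \<Longrightarrow> lin (\<lambda>x. f x + g x)"
  and lin_sub: "lin f \<Longrightarrow> lin g \<Longrightarrow> lin (\<lambda>x. f x - g x)"
  and lin_scaled: "lin f \<Longrightarrow> lin (\<lambda>x. fscale r (f x))"
  and lin_const_zero: "lin (\<lambda>x. 0)"
  and lin_fsum: "(\<And>s. s \<in> S \<Longrightarrow> lin (F s)) \<Longrightarrow> lin (\<lambda>x. \<Sum>s\<in>S. F s x)"
  by (auto simp: lin_def algebra_simps fs.scale_right_distrib fs.scale_right_diff_distrib
      fs.scale_sum_right sum.distrib fs.scale_minus_right)

lemma lin_compose: "lin f \<Longrightarrow> lin g \<Longrightarrow> lin (\<lambda>x. f (g x))"
  by (simp add: lin_def)

lemma lin_lin_ext_param: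
  assumes "\<And>b. lin (\<lambda>v. f v b)" shows "lin (\<lambda>v. lin_ext (f v) x)"
  unfolding lin_ext_def by (intro lin_fsum lin_scaled assms)

lemma lin_ext_superset:
  assumes "finite S" "keys p \<subseteq> S"
  shows "lin_ext g p = (\<Sum>s\<in>S. fscale (lookup p s) (g s))"
  unfolding lin_ext_def using assms
  by (intro sum.mono_neutral_left) (auto simp: in_keys_iff)

lemma lin_lin_ext [intro!]: "lin (lin_ext g)"
proof (rule linI)
  fix x y :: "'a \<Rightarrow>\<^sub>0 'b" and r
  let ?S = "keys x \<union> keys y"
  show "lin_ext g (x + y) = lin_ext g x + lin_ext g y"
    using Poly_Mapping.keys_add[of x y]
    by (simp add: lin_ext_superset[of ?S] lookup_add fs.scale_left_distrib sum.distrib)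
  show "lin_ext g (fscale r x) = fscale r (lin_ext g x)"
    using keys_fscale[of r x]
    by (simp add: lin_ext_superset[of "keys x"] fs.scale_sum_right)
qed

lemmas lin_ext_simps = lin_simps[OF lin_lin_ext]

lemma lin_ext_single [simp]: "lin_ext g (single s c) = fscale c (g s)"
  by (cases "c = 0") (auto simp: lin_ext_def)

lemma poly_mapping_expand:
  "p = (\<Sum>s\<in>keys p. fscale (lookup p s) (single s 1))"
  by (rule poly_mapping_eqI) (simp add: lookup_sum lookup_single when_def if_distrib in_keys_iff
      cong: if_cong)

lemma lin_eq_on_keys:
  assumes "lin f" "lin g" "\<And>s. s \<in> keys p \<Longrightarrow>
    f (single s 1) = g (single s 1)"
  shows "f p = g p"
proof -
  have "f p = (\<Sum>s\<in>keys p. fscale (lookup p s) (f (single s 1)))"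
    by (subst poly_mapping_expand[of p], unfold lin_sum[OF assms(1)] lin_scale[OF assms(1)], rule refl)
  also have "\<dots> = (\<Sum>s\<in>keys p. fscale (lookup p s) (g (single s 1)))"
    by (simp add: assms(3))
  also have "\<dots> = g p"
    by (subst (3) poly_mapping_expand[of p], unfold lin_sum[OF assms(2)] lin_scale[OF assms(2)], rule refl)
  finally show ?thesis .
qed

lemma lin_eqI:
  assumes "lin f" "lin g" "\<And>s. f (single s 1) = g (single s 1)"
  shows "f p = g p"
  using lin_eq_on_keys assms by blast

text \<open>With \<open>f\<close> a difference of two maps this reduces congruences modulo a
  subspace to basis vectors, the standard way to prove membership claims below.\<close>

lemma lin_in_subspace:
  assumes "lin f" "fs.subspace H" "\<And>s. s \<in> keys p \<Longrightarrow> f (single s 1) \<in> H"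
  shows "f p \<in> H"
proof -
  have "f p = (\<Sum>s\<in>keys p. fscale (lookup p s) (f (single s 1)))"
    by (subst poly_mapping_expand[of p], unfold lin_sum[OF assms(1)] lin_scale[OF assms(1)], rule refl)
  also have "\<dots> \<in> H"
    by (intro fs.subspace_sum[OF assms(2)] fs.subspace_scale[OF assms(2)] assms(3))
  finally show ?thesis .
qed

lemma subspace_preimage:
  assumes "lin f" "fs.subspace H" shows "fs.subspace {x. f x \<in> H}"
  using assms by (auto intro!: fs.subspaceI simp: lin_simps[OF assms(1)] fs.subspace_0 fs.subspace_add fs.subspace_scale)

lemma subspace_image:
  assumes "lin f" "fs.subspace H" shows "fs.subspace (f ` H)"
proof (rule fs.subspaceI)
  show "0 \<in> f ` H"
    using fs.subspace_0[OF assms(2)] lin_zero[OF assms(1)] by (metis imageI)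
  show "x + y \<in> f ` H" if "x \<in> f ` H" "y \<in> f ` H" for x y
    using that assms(2) by (auto simp: lin_add[OF assms(1), symmetric] fs.subspace_add)
  show "fscale r x \<in> f ` H" if "x \<in> f ` H" for r x
    using that assms(2) by (auto simp: lin_scale[OF assms(1), symmetric] fs.subspace_scale)
qed

lemma subspace_keys: "fs.subspace {p. keys p \<subseteq> S}"
proof (rule fs.subspaceI)
  show "x + y \<in> {p. keys p \<subseteq> S}"
    if "x \<in> {p. keys p \<subseteq> S}" "y \<in> {p. keys p \<subseteq> S}" for x y
    using that Poly_Mapping.keys_add[of x y] by auto
qed (use keys_fscale in fastforce)+

lemma keys_lin_ext:
  assumes "\<And>s. s \<in> keys p \<Longrightarrow> keys (g s) \<subseteq> S"
  shows "keys (lin_ext g p) \<subseteq> S"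
  using lin_in_subspace[OF lin_lin_ext subspace_keys, of p g S] assms by simp

section \<open>Iterated quotients of subspaces\<close>

text \<open>\<open>rep G \<kappa> U K\<close> says that \<open>\<kappa>\<close> identifies the quotient \<open>U/K\<close> of subspaces of a free space
  with the vector space \<open>G\<close>. It lets quotients of quotients be computed on representatives.\<close>
definition rep :: "('k::field, 'g) module \<Rightarrow> (('s \<Rightarrow>\<^sub>0 'k) \<Rightarrow> 'g) \<Rightarrow> ('s \<Rightarrow>\<^sub>0 'k) set \<Rightarrow> ('s \<Rightarrow>\<^sub>0 'k) set \<Rightarrow> bool" where
  "rep G \<kappa> U K \<longleftrightarrow> fs.subspace U \<and> fs.subspace K \<and> K \<subseteq> U \<and> carrier G = \<kappa> ` U \<and>
     (\<forall>x\<in>U. \<forall>y\<in>U. \<kappa> x \<oplus>\<^bsub>G\<^esub> \<kappa> y = \<kappa> (x + y)) \<and> (\<forall>r. \<forall>x\<in>U. r \<odot>\<^bsub>G\<^esub> \<kappa> x = \<kappa> (fscale r x)) \<and>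
     \<zero>\<^bsub>G\<^esub> = \<kappa> 0 \<and> (\<forall>x\<in>U. \<forall>y\<in>U. \<kappa> x = \<kappa> y \<longleftrightarrow> x - y \<in> K)"

lemma repD:
  assumes "rep G \<kappa> U K"
  shows "fs.subspace U" "fs.subspace K" "K \<subseteq> U" "carrier G = \<kappa> ` U"
    "x \<in> U \<Longrightarrow> y \<in> U \<Longrightarrow> \<kappa> x \<oplus>\<^bsub>G\<^esub> \<kappa> y = \<kappa> (x + y)"
    "x \<in> U \<Longrightarrow> r \<odot>\<^bsub>G\<^esub> \<kappa> x = \<kappa> (fscale r x)"
    "\<zero>\<^bsub>G\<^esub> = \<kappa> 0" "x \<in> U \<Longrightarrow> y \<in> U \<Longrightarrow> \<kappa> x = \<kappa> y \<longleftrightarrow> x - y \<in> K"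
  using assms by (auto simp: rep_def)

lemma rep_free_space: "rep (free_space S) (\<lambda>x. x) {p. keys p \<subseteq> S} {0}"
  by (simp add: rep_def subspace_keys free_space_def fs.subspace_single_0)

lemma rep_abelian_group:
  assumes "rep G \<kappa> U K" shows "abelian_group G"
proof -
  note r = repD[OF assms]
  show ?thesis
  proof (rule abelian_groupI)
    fix x assume "x \<in> carrier G"
    then obtain u where u: "u \<in> U" "x = \<kappa> u"
      using r(4) by auto
    then have "\<kappa> (- u) \<oplus>\<^bsub>G\<^esub> x = \<zero>\<^bsub>G\<^esub>"
      using r(1,5,7) by (simp add: fs.subspace_neg)
    then show "\<exists>y\<in>carrier G. y \<oplus>\<^bsub>G\<^esub> x = \<zero>\<^bsub>G\<^esub>"
      using u r(1,4) fs.subspace_neg by blast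
  qed (auto simp: r(1,4,5,7) fs.subspace_add fs.subspace_0 add_ac)
qed

lemma rep_minus:
  assumes "rep G \<kappa> U K" "x \<in> U" "y \<in> U" shows "\<kappa> x \<ominus>\<^bsub>G\<^esub> \<kappa> y = \<kappa> (x - y)"
proof -
  note r = repD[OF assms(1)]
  interpret abelian_group G
    by (rule rep_abelian_group[OF assms(1)])
  have "\<kappa> (- y) \<oplus>\<^bsub>G\<^esub> \<kappa> y = \<zero>\<^bsub>G\<^esub>"
    using assms r by (simp add: fs.subspace_neg)
  then have "\<ominus>\<^bsub>G\<^esub> \<kappa> y = \<kappa> (- y)"
    using assms r(1,4) by (intro minus_equality) (auto simp: fs.subspace_neg)
  then show ?thesis
    using assms r by (simp add: a_minus_def fs.subspace_neg)
qed

lemma rep_coset: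
  assumes "rep G \<kappa> U K" "K' \<subseteq> U" "x \<in> U"
  shows "\<kappa> ` K' +>\<^bsub>G\<^esub> \<kappa> x = \<kappa> ` ((\<lambda>k. k + x) ` K')"
  using repD(5)[OF assms(1)] assms(2,3) by (force simp: a_r_coset_def' image_iff)

text \<open>A coset is the image of a translate of \<open>K'\<close>. Taking images under
  \<open>\<kappa>\<close> blurs elements by \<open>K\<close>, which is harmless because
  \<open>K\<close> lies in \<open>K'\<close>.\<close>

lemma rep_coset_eq:
  assumes "rep G \<kappa> U K" "K \<subseteq> K'" "K' \<subseteq> U" "fs.subspace K'" "x \<in> U" "y \<in> U"
  shows "\<kappa> ` K' +>\<^bsub>G\<^esub> \<kappa> x = \<kappa> ` K' +>\<^bsub>G\<^esub> \<kappa> y \<longleftrightarrow> x - y \<in> K'"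
proof
  note r = repD[OF assms(1)]
  have mem: "\<kappa> z \<in> \<kappa> ` K' +>\<^bsub>G\<^esub> \<kappa> y \<longleftrightarrow> z - y \<in> K'" if "y \<in> U" "z \<in> U" for y z
  proof -
    have "\<kappa> z = \<kappa> (k + y) \<longleftrightarrow> z - (k + y) \<in> K" if "k \<in> K'" for k
      using that \<open>y \<in> U\<close> \<open>z \<in> U\<close> assms r(1,8) by (auto simp: fs.subspace_add)
    moreover have "z - y \<in> K'" if "z - (k + y) \<in> K" "k \<in> K'" for k
      using fs.subspace_add[OF assms(4), of "z - (k + y)" k] that assms(2) by auto
    moreover have "\<exists>k\<in>K'. z - (k + y) \<in> K" if "z - y \<in> K'"
      using that r(2) by (intro bexI[of _ "z - y"]) (auto simp: fs.subspace_0)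
    ultimately show ?thesis
      unfolding rep_coset[OF assms(1,3) \<open>y \<in> U\<close>] image_image image_iff by blast
  qed
  show "x - y \<in> K'" if "\<kappa> ` K' +>\<^bsub>G\<^esub> \<kappa> x = \<kappa> ` K' +>\<^bsub>G\<^esub> \<kappa> y"
    using mem[of x x] mem[of y x] that assms by (auto simp: fs.subspace_0)
  show "\<kappa> ` K' +>\<^bsub>G\<^esub> \<kappa> x = \<kappa> ` K' +>\<^bsub>G\<^esub> \<kappa> y" if d: "x - y \<in> K'"
  proof -
    have "(\<lambda>k. k + x) ` K' = (\<lambda>k. k + y) ` K'"
    proof (intro equalityI subsetI)
      fix z assume "z \<in> (\<lambda>k. k + x) ` K'"
      then obtain k where "k \<in> K'" "z = k + x" by blast
      then show "z \<in> (\<lambda>k. k + y) ` K'"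
        using fs.subspace_add[OF assms(4) _ d, of k] by (intro image_eqI[of _ _ "k + (x - y)"]) auto
    next
      fix z assume "z \<in> (\<lambda>k. k + y) ` K'"
      then obtain k where "k \<in> K'" "z = k + y" by blast
      then show "z \<in> (\<lambda>k. k + x) ` K'"
        using fs.subspace_diff[OF assms(4) _ d, of k] by (intro image_eqI[of _ _ "k - (x - y)"]) auto
    qed
    then show ?thesis
      by (simp add: rep_coset[OF assms(1,3)] assms)
  qed
qed

text \<open>The representing space stays and only the null space grows; applied three times, this
  covers the tensor power, the coinvariants and the homology.\<close>

lemma rep_quot:
  assumes "rep G \<kappa> U K" "K \<subseteq> K'" "K' \<subseteq> U" "fs.subspace K'"
  shows "rep (quot G (\<kappa> ` K')) (\<lambda>x. \<kappa> ` K' +>\<^bsub>G\<^esub> \<kappa> x) U K'"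
proof -
  note r = repD[OF assms(1)]
  note c = rep_coset[OF assms(1,3)]
  have carr: "carrier (quot G (\<kappa> ` K')) = (\<lambda>x. \<kappa> ` K' +>\<^bsub>G\<^esub> \<kappa> x) ` U"
    by (auto simp: quot_def FactRing_def ring.defs module.defs A_RCOSETS_def' r(4))
  have add: "(\<kappa> ` K' +>\<^bsub>G\<^esub> \<kappa> x) \<oplus>\<^bsub>quot G (\<kappa> ` K')\<^esub> (\<kappa> ` K' +>\<^bsub>G\<^esub> \<kappa> y) = \<kappa> ` K' +>\<^bsub>G\<^esub> \<kappa> (x + y)"
    if "x \<in> U" "y \<in> U" for x y
  proof -
    have "(\<kappa> ` K' +>\<^bsub>G\<^esub> \<kappa> x) \<oplus>\<^bsub>quot G (\<kappa> ` K')\<^esub> (\<kappa> ` K' +>\<^bsub>G\<^esub> \<kappa> y) =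
        (\<Union>k\<in>K'. \<Union>k'\<in>K'. {\<kappa> (k + x) \<oplus>\<^bsub>G\<^esub> \<kappa> (k' + y)})"
      using that by (simp add: quot_def FactRing_def ring.defs module.defs set_add_def' c)
    also have "\<dots> = (\<Union>k\<in>K'. \<Union>k'\<in>K'. {\<kappa> (k + k' + (x + y))})"
    proof (intro SUP_cong refl)
      fix k k' assume "k \<in> K'" "k' \<in> K'"
      then have "k + x \<in> U" "k' + y \<in> U"
        using that assms(3) r(1) by (auto simp: fs.subspace_add)
      then show "{\<kappa> (k + x) \<oplus>\<^bsub>G\<^esub> \<kappa> (k' + y)} = {\<kappa> (k + k' + (x + y))}"
        by (simp add: r(5) ac_simps)
    qed
    also have "\<dots> = \<kappa> ` ((\<lambda>k. k + (x + y)) ` K')"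
    proof (intro equalityI subsetI)
      fix z assume "z \<in> \<kappa> ` ((\<lambda>k. k + (x + y)) ` K')"
      then obtain k where k: "k \<in> K'" "z = \<kappa> (k + (x + y))" by blast
      then show "z \<in> (\<Union>k\<in>K'. \<Union>k'\<in>K'. {\<kappa> (k + k' + (x + y))})"
        using fs.subspace_0[OF assms(4)] by (intro UN_I[of k] UN_I[of 0]) auto
    qed (auto simp: fs.subspace_add[OF assms(4)])
    finally show ?thesis
      using that by (simp add: c fs.subspace_add[OF r(1)])
  qed
  have smult: "a \<odot>\<^bsub>quot G (\<kappa> ` K')\<^esub> (\<kappa> ` K' +>\<^bsub>G\<^esub> \<kappa> x) = \<kappa> ` K' +>\<^bsub>G\<^esub> \<kappa> (fscale a x)" if "x \<in> U" for a x
  proof -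
    have "a \<odot>\<^bsub>quot G (\<kappa> ` K')\<^esub> (\<kappa> ` K' +>\<^bsub>G\<^esub> \<kappa> x) =
        (\<Union>k\<in>K'. \<kappa> ` K' +>\<^bsub>G\<^esub> (a \<odot>\<^bsub>G\<^esub> \<kappa> (k + x)))"
      using that by (simp add: quot_def FactRing_def ring.defs module.defs c)
    also have "\<dots> = (\<Union>k\<in>K'. \<kappa> ` K' +>\<^bsub>G\<^esub> \<kappa> (fscale a x))"
    proof (intro SUP_cong refl)
      fix k assume k: "k \<in> K'"
      then have kX: "k + x \<in> U"
        using that assms(3) by (auto simp: fs.subspace_add r(1))
      then show "\<kappa> ` K' +>\<^bsub>G\<^esub> (a \<odot>\<^bsub>G\<^esub> \<kappa> (k + x)) = \<kappa> ` K' +>\<^bsub>G\<^esub> \<kappa> (fscale a x)"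
        using that k rep_coset_eq[OF assms, of "fscale a (k + x)" "fscale a x"]
        by (simp add: r(6) fs.subspace_scale[OF r(1)]
            fs.scale_right_diff_distrib[symmetric] fs.subspace_scale[OF assms(4)])
    qed
    also have "\<dots> = \<kappa> ` K' +>\<^bsub>G\<^esub> \<kappa> (fscale a x)"
      using fs.subspace_0[OF assms(4)] by blast
    finally show ?thesis .
  qed
  have zero: "\<zero>\<^bsub>quot G (\<kappa> ` K')\<^esub> = \<kappa> ` K' +>\<^bsub>G\<^esub> \<kappa> 0"
    by (simp add: c fs.subspace_0[OF r(1)] quot_def FactRing_def ring.defs module.defs)
  show ?thesis
    unfolding rep_def using assms r(1) by (auto simp: carr add smult zero rep_coset_eq)
qed

text \<open>\<open>quot_map\<close> is a union over a coset. Since \<open>h\<close> sends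
  \<open>K1\<close> into \<open>K2\<close>, all members of the union agree and it is a single
  coset.\<close>

lemma quot_map_rep:
  assumes "rep G \<kappa> U K" "fs.subspace K1" "K1 \<subseteq> U"
    and "rep G' \<kappa>' U' K'" "fs.subspace K2" "K' \<subseteq> K2" "K2 \<subseteq> U'"
    and f: "\<And>z. z \<in> U \<Longrightarrow> f (\<kappa> z) = \<kappa>' (h z)"
    and h: "lin h" "\<And>z. z \<in> U \<Longrightarrow> h z \<in> U'" "\<And>z. z \<in> K1 \<Longrightarrow> h z \<in> K2"
    and x: "x \<in> U"
  shows "quot_map G' (\<kappa>' ` K2) f (\<kappa> ` K1 +>\<^bsub>G\<^esub> \<kappa> x) = \<kappa>' ` K2 +>\<^bsub>G'\<^esub> \<kappa>' (h x)"
proof -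
  note r = repD[OF assms(1)]
  have "quot_map G' (\<kappa>' ` K2) f (\<kappa> ` K1 +>\<^bsub>G\<^esub> \<kappa> x) =
      (\<Union>k\<in>K1. \<kappa>' ` K2 +>\<^bsub>G'\<^esub> f (\<kappa> (k + x)))"
    using x by (simp add: quot_map_def rep_coset[OF assms(1,3)])
  also have "\<dots> = (\<Union>k\<in>K1. \<kappa>' ` K2 +>\<^bsub>G'\<^esub> \<kappa>' (h x))"
  proof (intro SUP_cong refl)
    fix k assume k: "k \<in> K1"
    then have kX: "k + x \<in> U"
      using x assms(3) by (auto simp: fs.subspace_add r(1))
    then have "h (k + x) \<in> U'" "h (k + x) - h x \<in> K2"
      using h(2)[of "k + x"] h(3)[OF k] by (auto simp: lin_add[OF h(1)])
    then show "\<kappa>' ` K2 +>\<^bsub>G'\<^esub> f (\<kappa> (k + x)) = \<kappa>' ` K2 +>\<^bsub>G'\<^esub> \<kappa>' (h x)"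
      using kX x h by (simp add: f rep_coset_eq[OF assms(4,6,7,5)])
  qed
  also have "\<dots> = \<kappa>' ` K2 +>\<^bsub>G'\<^esub> \<kappa>' (h x)"
    using fs.subspace_0[OF assms(2)] by blast
  finally show ?thesis .
qed

lemma rep_trivial:
  assumes "rep G \<kappa> U U" shows "carrier G = {\<zero>\<^bsub>G\<^esub>}"
proof -
  note r = repD[OF assms]
  have "\<kappa> x = \<kappa> 0" if "x \<in> U" for x
    using that r(8)[of x 0] fs.subspace_0[OF r(1)] by simp
  then have "\<kappa> ` U = {\<kappa> 0}"
    using fs.subspace_0[OF r(1)] by blast
  then show ?thesis
    by (simp only: r(4,7))
qed

text \<open>A functional with kernel \<open>K\<close> on \<open>U\<close> is injective on the
  quotient, and the multiples of \<open>w\<close> make it surjective.\<close>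

lemma rep_linear_iso_ground:
  assumes "rep G \<kappa> U K"
    and t: "\<And>x y. t (x + y) = t x + t y" "\<And>r x. t (fscale r x) = r * t x"
    and K: "\<And>x. x \<in> U \<Longrightarrow> t x = 0 \<longleftrightarrow> x \<in> K" and w: "w \<in> U" "t w = 1"
  shows "linear_iso G (ground_space :: ('k::field, 'k) module)"
proof -
  note r = repD[OF assms(1)]
  have diff: "t (x - y) = t x - t y" for x y
    using t(1)[of "x - y" y] by simp
  \<comment> \<open>An arbitrary representative is chosen; two of them differ by an element of
    \<open>K\<close>, where \<open>t\<close> vanishes.\<close>
  define f where "f c = t (SOME x. x \<in> U \<and> \<kappa> x = c)" for c
  have f: "f (\<kappa> x) = t x" if "x \<in> U" for x
  proof -
    have *: "\<exists>y. y \<in> U \<and> \<kappa> y = \<kappa> x"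
      using that by blast
    define y where "y = (SOME y. y \<in> U \<and> \<kappa> y = \<kappa> x)"
    have y: "y \<in> U" "\<kappa> y = \<kappa> x"
      using someI_ex[OF *] by (auto simp: y_def)
    then have "t (y - x) = 0"
      using K that r(8) by (simp add: fs.subspace_diff[OF r(1)])
    then show ?thesis
      by (simp add: f_def diff flip: y_def)
  qed
  have inj: "inj_on f (carrier G)"
  proof (rule inj_onI)
    fix c c' assume "c \<in> carrier G" "c' \<in> carrier G" "f c = f c'"
    then obtain x y where "x \<in> U" "y \<in> U" "c = \<kappa> x" "c' = \<kappa> y" "t x = t y"
      using f r(4) by auto
    then show "c = c'"
      using K[of "x - y"] by (simp add: r(8) diff fs.subspace_diff[OF r(1)])
  qed
  have "c \<in> f ` carrier G" for c
    using f[of "fscale c w"] w t(2) r(4) by (auto simp: fs.subspace_scale[OF r(1)] image_iff intro!: bexI[of _ "fscale c w"])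
  then have "bij_betw f (carrier G) (carrier (ground_space :: ('k, 'k) module))"
    using inj by (auto simp: bij_betw_def ground_space_def ring_of_type_algebra_def ring.defs module.defs)
  then show ?thesis
    unfolding linear_iso_def
    by (intro exI[of _ f]) (auto simp: r f t fs.subspace_add fs.subspace_scale
        ground_space_def ring_of_type_algebra_def ring.defs module.defs)
qed

section \<open>Second twisted Hochschild homology in coordinates\<close>

fun tens :: "('b \<Rightarrow>\<^sub>0 'k::field) list \<Rightarrow> 'b list \<Rightarrow>\<^sub>0 'k" where
  "tens [] = tup []"
| "tens (v # vs) = lin_ext (\<lambda>b. lin_ext (\<lambda>bs. tup (b # bs)) (tens vs)) v"

lemma lin_tens: "lin (\<lambda>v. tens (xs @ v # ys))"
proof (induction xs)
  case (Cons x xs)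
  show ?case
    unfolding append_Cons tens.simps by (intro lin_lin_ext_param lin_compose[OF lin_lin_ext Cons.IH])
qed auto

lemma lookup_tens_Cons:
  fixes v :: "'b \<Rightarrow>\<^sub>0 'k::field"
  shows "lookup (tens (v # vs)) (b # bs) = lookup v b * lookup (tens vs) bs"
proof -
  have 1: "lookup (lin_ext (\<lambda>bs. tup (a # bs)) w) (b # bs) = (if a = b then lookup w bs else 0)"
    for a and w :: "'b list \<Rightarrow>\<^sub>0 'k"
    by (auto simp: lin_ext_def lookup_sum lookup_single when_def in_keys_iff if_distrib cong: if_cong)
  show ?thesis
    by (simp add: lin_ext_def[of _ v] lookup_sum 1 if_distrib in_keys_iff cong: if_cong)
qed

lemma lookup_tens_Nil: "lookup (tens (v # vs)) [] = 0"
  by (auto simp: lin_ext_def lookup_sum lookup_single when_def intro!: sum.neutral)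

lemma tens_single: "tens (map (\<lambda>b. single b 1) bs) = tup bs"
  by (induction bs) auto

lemma keys_tens: "keys (tens vs) \<subseteq> {bs. length bs = length vs}"
proof
  fix bs assume "bs \<in> keys (tens vs)"
  then show "bs \<in> {bs. length bs = length vs}"
  proof (induction vs arbitrary: bs)
    case (Cons v vs)
    then show ?case
      by (cases bs) (auto simp: in_keys_iff lookup_tens_Cons lookup_tens_Nil simp del: tens.simps(2))
  qed (auto simp: in_keys_iff lookup_single when_def split: if_splits)
qed

lemma tens_lin_slots:
  "lin (\<lambda>u. tens [u, v])" "lin (\<lambda>v. tens [u, v])"
  "lin (\<lambda>u. tens [u, v, w])" "lin (\<lambda>v. tens [u, v, w])" "lin (\<lambda>w. tens [u, v, w])"
  "lin (\<lambda>u. tens [u, v, w, y])" "lin (\<lambda>v. tens [u, v, w, y])" "lin (\<lambda>w. tens [u, v, w, y])" "lin (\<lambda>y. tens [u, v, w, y])"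
  using lin_tens[of "[]" "[v]"] lin_tens[of "[u]" "[]"]
    lin_tens[of "[]" "[v, w]"] lin_tens[of "[u]" "[w]"] lin_tens[of "[u, v]" "[]"]
    lin_tens[of "[]" "[v, w, y]"] lin_tens[of "[u]" "[w, y]"] lin_tens[of "[u, v]" "[y]"] lin_tens[of "[u, v, w]" "[]"]
  by (simp_all del: tens.simps)

lemma lin_eqI3:
  assumes "\<And>v w. lin (\<lambda>u. F [u, v, w])" "\<And>u w. lin (\<lambda>v. F [u, v, w])" "\<And>u v. lin (\<lambda>w. F [u, v, w])"
    and "\<And>v w. lin (\<lambda>u. G [u, v, w])" "\<And>u w. lin (\<lambda>v. G [u, v, w])" "\<And>u v. lin (\<lambda>w. G [u, v, w])"
    and "\<And>a b c. F (map (\<lambda>b. single b 1) [a, b, c]) = G (map (\<lambda>b. single b 1) [a, b, c])"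
  shows "F [u, v, w] = G [u, v, w]"
proof -
  have "F [single a 1, single b 1, w] = G [single a 1, single b 1, w]" for a b w
    by (rule lin_eqI[OF assms(3,6)]) (use assms(7) in simp)
  then have "F [single a 1, v, w] = G [single a 1, v, w]" for a v w
    by (rule lin_eqI[OF assms(2,5)])
  then show ?thesis
    by (rule lin_eqI[OF assms(1,4)])
qed

lemma lin_eqI4:
  assumes "\<And>v w y. lin (\<lambda>u. F [u, v, w, y])" "\<And>u w y. lin (\<lambda>v. F [u, v, w, y])"
      "\<And>u v y. lin (\<lambda>w. F [u, v, w, y])" "\<And>u v w. lin (\<lambda>y. F [u, v, w, y])"
    and "\<And>v w y. lin (\<lambda>u. G [u, v, w, y])" "\<And>u w y. lin (\<lambda>v. G [u, v, w, y])"
      "\<And>u v y. lin (\<lambda>w. G [u, v, w, y])" "\<And>u v w. lin (\<lambda>y. G [u, v, w, y])"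
    and "\<And>a b c d. F (map (\<lambda>b. single b 1) [a, b, c, d]) = G (map (\<lambda>b. single b 1) [a, b, c, d])"
  shows "F [u, v, w, y] = G [u, v, w, y]"
proof -
  have "F [single a 1, v, w, y] = G [single a 1, v, w, y]" for a v w y
    using assms by (intro lin_eqI3[of "\<lambda>xs. F (single a 1 # xs)" "\<lambda>xs. G (single a 1 # xs)"]) auto
  then show ?thesis
    by (rule lin_eqI[OF assms(1,5)])
qed

section \<open>Submodules of free spaces as subspaces\<close>

lemma free_space_submodule:
  fixes H :: "('s \<Rightarrow>\<^sub>0 'k::field) set"
  assumes "fs.subspace H" "H \<subseteq> {p. keys p \<subseteq> S}"
  shows "submodule H ring_of_type_algebra (free_space S)"
proof -
  interpret abelian_group "free_space S :: ('k, 's \<Rightarrow>\<^sub>0 'k) module"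
    by (rule rep_abelian_group[OF rep_free_space])
  have minus: "\<ominus>\<^bsub>free_space S\<^esub> x = - x" if "x \<in> H" for x
    using that assms fs.subspace_neg[OF assms(1) that]
    by (intro minus_equality) (auto simp: free_space_def)
  then show ?thesis
    using assms
    by (intro submodule.intro submodule_axioms.intro subgroup.intro)
      (auto simp: free_space_def a_inv_def fs.subspace_0 fs.subspace_add fs.subspace_scale
        intro: fs.subspace_neg[OF assms(1)])
qed

lemma submodule_free_space_subspace:
  assumes "submodule H ring_of_type_algebra (free_space S)"
  shows "fs.subspace H" "H \<subseteq> {p. keys p \<subseteq> S}"
proof -
  interpret submodule H "ring_of_type_algebra" "free_space S"
    by (rule assms)
  show "fs.subspace H"
    using one_closed m_closed smult_closed
    by (intro fs.subspaceI) (auto simp: free_space_def ring_of_type_algebra_def)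
  show "H \<subseteq> {p. keys p \<subseteq> S}"
    using subset by (auto simp: free_space_def)
qed

lemma
  assumes "R \<subseteq> {p. keys p \<subseteq> S}"
  shows subspace_span_in: "fs.subspace (span_in (free_space S) R)"
    and span_in_subset: "span_in (free_space S) R \<subseteq> {p. keys p \<subseteq> S}"
    and span_in_superset: "R \<subseteq> span_in (free_space S) R"
    and span_in_least: "fs.subspace H \<Longrightarrow> R \<subseteq> H \<Longrightarrow> span_in (free_space S) R \<subseteq> H"
proof -
  have all: "submodule {p. keys p \<subseteq> S} ring_of_type_algebra (free_space S)"
    by (intro free_space_submodule subspace_keys order_refl)
  show "span_in (free_space S) R \<subseteq> {p. keys p \<subseteq> S}"
    using all assms by (auto simp: span_in_def)
  show "R \<subseteq> span_in (free_space S) R"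
    by (auto simp: span_in_def)
  show "fs.subspace (span_in (free_space S) R)"
    unfolding span_in_def using submodule_free_space_subspace(1)
    by (intro fs.subspace_Inter) blast
  assume H: "fs.subspace H" "R \<subseteq> H"
  \<comment> \<open>\<open>H\<close> may leave the carrier and then is no submodule of the free
    space, but its intersection with the carrier is one.\<close>
  have "submodule (H \<inter> {p. keys p \<subseteq> S}) ring_of_type_algebra (free_space S)"
    using H by (intro free_space_submodule fs.subspace_inter subspace_keys) auto
  then have "span_in (free_space S) R \<subseteq> H \<inter> {p. keys p \<subseteq> S}"
    unfolding span_in_def using H(2) assms by (intro Inter_lower) simp
  then show "span_in (free_space S) R \<subseteq> H"
    by blast
qed

text \<open>The algebra is given through a basis indexed by \<open>'b\<close> on which
  \<open>\<sigma>\<close> is diagonal with eigenvalues \<open>wt\<close>. Diagonality is what splits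
  the coinvariants off as a direct summand.\<close>

locale based_algebra =
  fixes M :: "('k::field, 'a) module" and \<sigma> :: "'a \<Rightarrow> 'a"
    and crd :: "'a \<Rightarrow> 'b \<Rightarrow>\<^sub>0 'k" and vmul :: "('b \<Rightarrow>\<^sub>0 'k) \<Rightarrow> ('b \<Rightarrow>\<^sub>0 'k) \<Rightarrow> 'b \<Rightarrow>\<^sub>0 'k" (infixl "\<star>" 70)
    and sg :: "('b \<Rightarrow>\<^sub>0 'k) \<Rightarrow> 'b \<Rightarrow>\<^sub>0 'k" and wt :: "'b \<Rightarrow> 'k"
  assumes bij: "bij_betw crd (carrier M) UNIV"
    and add_closed: "x \<in> carrier M \<Longrightarrow> y \<in> carrier M \<Longrightarrow> x \<oplus>\<^bsub>M\<^esub> y \<in> carrier M"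
    and smult_closed: "x \<in> carrier M \<Longrightarrow> r \<odot>\<^bsub>M\<^esub> x \<in> carrier M"
    and mult_closed: "x \<in> carrier M \<Longrightarrow> y \<in> carrier M \<Longrightarrow> x \<otimes>\<^bsub>M\<^esub> y \<in> carrier M"
    and aut_closed: "x \<in> carrier M \<Longrightarrow> \<sigma> x \<in> carrier M"
    and crd_add: "x \<in> carrier M \<Longrightarrow> y \<in> carrier M \<Longrightarrow> crd (x \<oplus>\<^bsub>M\<^esub> y) = crd x + crd y"
    and crd_smult: "x \<in> carrier M \<Longrightarrow> crd (r \<odot>\<^bsub>M\<^esub> x) = fscale r (crd x)"
    and crd_mult: "x \<in> carrier M \<Longrightarrow> y \<in> carrier M \<Longrightarrow> crd (x \<otimes>\<^bsub>M\<^esub> y) = crd x \<star> crd y"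
    and crd_aut: "x \<in> carrier M \<Longrightarrow> crd (\<sigma> x) = sg (crd x)"
    and lin_vmul_left: "lin (\<lambda>v. v \<star> w)" and lin_vmul_right: "lin (\<lambda>w. v \<star> w)"
    and vmul_assoc: "(u \<star> v) \<star> w = u \<star> (v \<star> w)"
    and lin_sg: "lin sg" and sg_vmul: "sg (v \<star> w) = sg v \<star> sg w"
    and sg_single: "sg (single b 1) = single b (wt b)"
begin

section \<open>Coordinates on tensor powers\<close>

abbreviation chn :: "nat \<Rightarrow> ('a list \<Rightarrow>\<^sub>0 'k) set" where
  "chn m \<equiv> {p. keys p \<subseteq> tuples M m}"

definition tcrd :: "('a list \<Rightarrow>\<^sub>0 'k) \<Rightarrow> 'b list \<Rightarrow>\<^sub>0 'k" where
  "tcrd = lin_ext (\<lambda>xs. tens (map crd xs))"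

definition bvec :: "'b \<Rightarrow> 'a" where
  "bvec b = inv_into (carrier M) crd (single b 1)"

definition lift :: "('b list \<Rightarrow>\<^sub>0 'k) \<Rightarrow> 'a list \<Rightarrow>\<^sub>0 'k" where
  "lift = lin_ext (\<lambda>bs. tup (map bvec bs))"

lemma lin_tcrd: "lin tcrd" and lin_lift: "lin lift"
  by (auto simp: tcrd_def lift_def)

lemmas tcrd_simps = lin_simps[OF lin_tcrd]

lemma tcrd_single: "tcrd (single xs r) = fscale r (tens (map crd xs))"
  by (simp add: tcrd_def)

definition icrd :: "('b \<Rightarrow>\<^sub>0 'k) \<Rightarrow> 'a" where
  "icrd = inv_into (carrier M) crd"

lemma icrd: "icrd v \<in> carrier M" "crd (icrd v) = v" "x \<in> carrier M \<Longrightarrow> icrd (crd x) = x"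
  using bij by (auto simp: icrd_def bij_betw_def inv_into_into f_inv_into_f)

lemma bvec: "bvec b \<in> carrier M" "crd (bvec b) = single b 1"
  using icrd(1,2)[of "single b 1"] by (auto simp: bvec_def icrd_def)

lemma crd_inj: "x \<in> carrier M \<Longrightarrow> y \<in> carrier M \<Longrightarrow> crd x = crd y \<Longrightarrow> x = y"
  using icrd(3) by metis

lemma icrd_add: "icrd (v + w) = icrd v \<oplus>\<^bsub>M\<^esub> icrd w"
  by (intro crd_inj) (auto simp: icrd add_closed crd_add)

lemma icrd_scale: "icrd (fscale r v) = r \<odot>\<^bsub>M\<^esub> icrd v"
  by (intro crd_inj) (auto simp: icrd smult_closed crd_smult)

lemma rels_chn: "multilinear_rels M m \<subseteq> chn m"
proof -
  note sub = fs.subspace_diff[OF subspace_keys] fs.subspace_scale[OF subspace_keys]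
  have t: "tup xs \<in> chn m" if "xs \<in> tuples M m" for xs
    using that by simp
  have "tup (xs @ [x \<oplus>\<^bsub>M\<^esub> y] @ ys) - tup (xs @ [x] @ ys) - tup (xs @ [y] @ ys) \<in> chn m"
    if "xs @ [x] @ ys \<in> tuples M m" "y \<in> carrier M" for xs x y ys
    using that by (intro sub t) (auto simp: tuples_def add_closed)
  moreover have "tup (xs @ [r \<odot>\<^bsub>M\<^esub> x] @ ys) - fscale r (tup (xs @ [x] @ ys)) \<in> chn m"
    if "xs @ [x] @ ys \<in> tuples M m" for xs x r ys
    using that by (intro sub t) (auto simp: tuples_def smult_closed)
  ultimately show ?thesis
    unfolding multilinear_rels_def by blast
qed

lemmas null_subspace = subspace_span_in[OF rels_chn, folded tensor_null_def]
lemmas null_chn = span_in_subset[OF rels_chn, folded tensor_null_def]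
lemmas null_rels = span_in_superset[OF rels_chn, folded tensor_null_def]
lemmas null_least = span_in_least[OF rels_chn, folded tensor_null_def]

lemma null_add:
  "xs @ x # ys \<in> tuples M m \<Longrightarrow> y \<in> carrier M \<Longrightarrow>
    tup (xs @ (x \<oplus>\<^bsub>M\<^esub> y) # ys) - tup (xs @ x # ys) - tup (xs @ y # ys) \<in> tensor_null M m"
  by (rule subsetD[OF null_rels], unfold multilinear_rels_def,
      intro UnI1 CollectI exI[of _ xs] exI[of _ x] exI[of _ y] exI[of _ ys]) simp

lemma null_smult:
  "xs @ x # ys \<in> tuples M m \<Longrightarrow>
    tup (xs @ (r \<odot>\<^bsub>M\<^esub> x) # ys) - fscale r (tup (xs @ x # ys)) \<in> tensor_null M m"
  by (rule subsetD[OF null_rels], unfold multilinear_rels_def,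
      intro UnI2 CollectI exI[of _ xs] exI[of _ x] exI[of _ r] exI[of _ ys]) simp

lemma tcrd_null: "p \<in> tensor_null M m \<Longrightarrow> tcrd p = 0"
proof -
  have "fs.subspace {p. tcrd p = 0}"
    using subspace_preimage[OF lin_tcrd fs.subspace_single_0] by simp
  moreover have "multilinear_rels M m \<subseteq> {p. tcrd p = 0}"
    by (auto simp: multilinear_rels_def tuples_def tcrd_simps tcrd_single crd_add crd_smult
        lin_simps[OF lin_tens] simp del: fscale_single)
  ultimately show "p \<in> tensor_null M m \<Longrightarrow> tcrd p = 0"
    using null_least by blast
qed

text \<open>The vectors for which the claim holds form a subspace, by \<open>null_add\<close> and
  \<open>null_smult\<close>, and the basis vectors satisfy it trivially.\<close>

lemma null_slot:
  assumes "xs @ x # ys \<in> tuples M m"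
  shows "tup (xs @ x # ys) - lin_ext (\<lambda>b. tup (xs @ bvec b # ys)) (crd x) \<in> tensor_null M m"
proof -
  let ?g = "lin_ext (\<lambda>b. tup (xs @ bvec b # ys)) :: _ \<Rightarrow> _ \<Rightarrow>\<^sub>0 'k"
  let ?f = "\<lambda>v. tup (xs @ icrd v # ys) - ?g v"
  let ?H = "{v. ?f v \<in> tensor_null M m}"
  have tu: "xs @ icrd v # ys \<in> tuples M m" for v
    using assms icrd(1) by (auto simp: tuples_def)
  note S = null_subspace[of m]
  have add: "v + w \<in> ?H" if "v \<in> ?H" "w \<in> ?H" for v w
  proof -
    have "?f (v + w) = (tup (xs @ (icrd v \<oplus>\<^bsub>M\<^esub> icrd w) # ys) - tup (xs @ icrd v # ys) - tup (xs @ icrd w # ys))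
        + ?f v + ?f w"
      by (simp add: icrd_add lin_ext_simps)
    moreover have "\<dots> \<in> tensor_null M m"
      using that null_add[OF tu icrd(1), of v w] by (intro fs.subspace_add[OF S]) auto
    ultimately show ?thesis
      by (simp only: mem_Collect_eq)
  qed
  have sc: "fscale r v \<in> ?H" if "v \<in> ?H" for v r
  proof -
    have "?f (fscale r v) = (tup (xs @ (r \<odot>\<^bsub>M\<^esub> icrd v) # ys) - fscale r (tup (xs @ icrd v # ys))) + fscale r (?f v)"
      by (simp add: icrd_scale lin_ext_simps fs.scale_right_diff_distrib del: fscale_single)
    moreover have "fscale r (?f v) \<in> tensor_null M m"
      using that fs.subspace_scale[OF S] by blast
    ultimately show ?thesis
      using null_smult[OF tu, of r v] fs.subspace_add[OF S] by simp
  qed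
  have single: "single b 1 \<in> ?H" for b
    using fs.subspace_0[OF S] by (simp add: bvec_def icrd_def)
  have "0 \<in> ?H"
    using sc[OF single, of 0 undefined] by simp
  then have "fs.subspace ?H"
    by (intro fs.subspaceI) (use add sc in blast)+
  from lin_in_subspace[OF lin_id this] single have "crd x \<in> ?H"
    by blast
  then show ?thesis
    using assms icrd(3) by (simp add: tuples_def)
qed

text \<open>Slots are expanded in the basis from left to right; \<open>zs\<close> is the prefix that
  has already been treated.\<close>

lemma null_lift_aux:
  assumes "zs @ xs \<in> tuples M m"
  shows "tup (zs @ xs) - lin_ext (\<lambda>bs. tup (zs @ map bvec bs)) (tens (map crd xs)) \<in> tensor_null M m"
  using assms
proof (induction xs arbitrary: zs)
  case Nil
  then show ?case
    by (simp add: fs.subspace_0[OF null_subspace])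
next
  case (Cons x xs)
  note S = null_subspace[of m]
  let ?t = "tens (map crd xs)"
  let ?h = "\<lambda>b. lin_ext (\<lambda>bs. tup (zs @ bvec b # map bvec bs)) ?t"
  have "lin_ext (\<lambda>bs. tup (zs @ map bvec bs)) (tens (map crd (x # xs))) = lin_ext ?h (crd x)"
  proof -
    have "lin_ext (\<lambda>bs. tup (zs @ map bvec bs)) (lin_ext (\<lambda>bs. tup (b # bs)) ?t) = ?h b" for b
      by (rule lin_eqI[OF lin_compose[OF lin_lin_ext lin_lin_ext] lin_lin_ext]) simp
    then show ?thesis
      unfolding list.map tens.simps
      by (intro lin_eqI[OF lin_compose[OF lin_lin_ext lin_lin_ext] lin_lin_ext, of _ _ _ "crd x"]) (simp only: lin_ext_single fs.scale_one)
  qed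
  moreover have "lin_ext (\<lambda>b. tup (zs @ bvec b # xs)) v - lin_ext ?h v \<in> tensor_null M m" for v
  proof (rule lin_in_subspace[OF lin_sub[OF lin_lin_ext lin_lin_ext] S])
    fix b
    have "(zs @ [bvec b]) @ xs \<in> tuples M m"
      using Cons.prems bvec(1) by (simp add: tuples_def)
    from Cons.IH[OF this]
    show "lin_ext (\<lambda>b. tup (zs @ bvec b # xs)) (single b 1) - lin_ext ?h (single b 1) \<in> tensor_null M m"
      by simp
  qed
  ultimately show ?case
    using fs.subspace_add[OF S null_slot[OF Cons.prems], of "lin_ext (\<lambda>b. tup (zs @ bvec b # xs)) (crd x) - lin_ext ?h (crd x)"]
    by (simp del: tens.simps)
qed

lemma lin_ext_chn: "(\<And>s. s \<in> keys p \<Longrightarrow> g s \<in> chn m) \<Longrightarrow> lin_ext g p \<in> chn m"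
  using keys_lin_ext[of p g "tuples M m"] by simp

lemma chn_lift:
  assumes "p \<in> chn m" shows "p - lift (tcrd p) \<in> tensor_null M m"
proof (rule lin_in_subspace[OF lin_sub[OF lin_id lin_compose[OF lin_lift lin_tcrd]] null_subspace])
  fix xs assume "xs \<in> keys p"
  then have "[] @ xs \<in> tuples M m"
    using assms by auto
  from null_lift_aux[OF this] show "tup xs - lift (tcrd (tup xs)) \<in> tensor_null M m"
    by (simp add: tcrd_single lift_def)
qed

text \<open>Coordinates forget nothing but the multilinear relations, because a chain differs from
  \<open>lift\<close> of its coordinates only by such relations.\<close>

lemma null_iff: "p \<in> chn m \<Longrightarrow> p \<in> tensor_null M m \<longleftrightarrow> tcrd p = 0"
  using chn_lift[of p m] tcrd_null by (auto simp: lin_zero[OF lin_lift])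

lemma tcrd_chn:
  assumes "p \<in> chn m" shows "keys (tcrd p) \<subseteq> {bs. length bs = m}"
  unfolding tcrd_def
proof (rule keys_lin_ext)
  fix xs assume "xs \<in> keys p"
  then show "keys (tens (map crd xs)) \<subseteq> {bs. length bs = m}"
    using keys_tens[of "map crd xs"] assms by (auto simp: tuples_def)
qed

lemma lift_chn: "keys w \<subseteq> {bs. length bs = m} \<Longrightarrow> lift w \<in> chn m"
  unfolding lift_def using bvec(1) by (intro lin_ext_chn) (auto simp: tuples_def)

lemma tcrd_lift: "tcrd (lift w) = w"
proof (rule lin_eqI[OF lin_compose[OF lin_tcrd lin_lift] lin_id])
  fix bs
  have "map crd (map bvec bs) = map (\<lambda>b. single b 1) bs"
    by (simp add: bvec)
  then show "tcrd (lift (tup bs)) = tup bs"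
    by (simp add: lift_def tcrd_single tens_single del: map_map)
qed

section \<open>The diagonal action on tensors and the coinvariants\<close>

definition lwt :: "'b list \<Rightarrow> 'k" where
  "lwt bs = prod_list (map wt bs)"

definition tsg :: "('b list \<Rightarrow>\<^sub>0 'k) \<Rightarrow> 'b list \<Rightarrow>\<^sub>0 'k" where
  "tsg = lin_ext (\<lambda>bs. single bs (lwt bs))"

text \<open>The projection onto the eigenspace of \<open>tsg\<close> with eigenvalue 1; its kernel
  is the image of the identity minus \<open>tsg\<close>.\<close>

definition inv_part :: "('b list \<Rightarrow>\<^sub>0 'k) \<Rightarrow> 'b list \<Rightarrow>\<^sub>0 'k" where
  "inv_part = lin_ext (\<lambda>bs. if lwt bs = 1 then tup bs else 0)"

lemma lin_tsg: "lin tsg" and lin_inv_part: "lin inv_part"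
  by (auto simp: tsg_def inv_part_def)

lemma lookup_tsg: "lookup (tsg w) bs = lwt bs * lookup w bs"
  by (auto simp: tsg_def lin_ext_def lookup_sum lookup_single when_def in_keys_iff if_distrib cong: if_cong)

lemma lookup_inv_part: "lookup (inv_part w) bs = (if lwt bs = 1 then lookup w bs else 0)"
proof -
  have "inv_part w = (\<Sum>s\<in>keys w. single s (if lwt s = 1 then lookup w s else 0))"
    by (auto simp: inv_part_def lin_ext_def intro!: sum.cong)
  also have "lookup \<dots> bs = (if lwt bs = 1 then lookup w bs else 0)"
    by (auto simp: lookup_sum lookup_single when_def in_keys_iff if_distrib[of "\<lambda>x. x bs"] cong: if_cong)
  finally show ?thesis .
qed

lemma tsg_tens: "tsg (tens vs) = tens (map sg vs)"
proof (induction vs)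
  case Nil
  then show ?case by (simp add: tsg_def lwt_def)
next
  case (Cons v vs)
  have 1: "tsg (lin_ext (\<lambda>bs. tup (b # bs)) w) = fscale (wt b) (lin_ext (\<lambda>bs. tup (b # bs)) (tsg w))" for b w
    by (rule lin_eqI[OF lin_compose[OF lin_tsg lin_lin_ext] lin_scaled[OF lin_compose[OF lin_lin_ext lin_tsg]]])
      (simp add: tsg_def lwt_def)
  show ?case
    unfolding tens.simps list.map Cons.IH[symmetric]
    by (rule lin_eqI[OF lin_compose[OF lin_tsg lin_lin_ext] lin_compose[OF lin_lin_ext lin_sg]])
      (simp add: 1 sg_single)
qed

text \<open>The chains that vanish among the coinvariants.\<close>
definition nul :: "nat \<Rightarrow> ('a list \<Rightarrow>\<^sub>0 'k) set" where
  "nul m = {p \<in> chn m. inv_part (tcrd p) = 0}"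

lemma nul_subspace: "fs.subspace (nul m)"
proof -
  have "nul m = chn m \<inter> {p. inv_part (tcrd p) \<in> {0}}"
    unfolding nul_def by blast
  then show ?thesis
    using fs.subspace_inter[OF subspace_keys subspace_preimage[OF lin_compose[OF lin_inv_part lin_tcrd] fs.subspace_single_0]]
    by simp
qed

lemma null_nul: "tensor_null M m \<subseteq> nul m"
  using null_chn[of m] tcrd_null[of _ m] by (auto simp: nul_def lin_zero[OF lin_inv_part])

definition tk :: "nat \<Rightarrow> ('a list \<Rightarrow>\<^sub>0 'k) \<Rightarrow> ('a list \<Rightarrow>\<^sub>0 'k) set" where
  "tk m x = tensor_null M m +>\<^bsub>free_space (tuples M m)\<^esub> x"

lemma rep_tensor: "rep (tensor_power M m) (tk m) (chn m) (tensor_null M m)"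
  using rep_quot[OF rep_free_space, of "tensor_null M m" "tuples M m"] null_chn[of m] null_subspace[of m]
  by (simp add: tensor_power_def tk_def[abs_def] fs.subspace_0)

lemma tensor_lift_tk:
  assumes "\<And>xs. xs \<in> tuples M m \<Longrightarrow> g xs \<in> chn n"
    and "\<And>p. p \<in> chn m \<Longrightarrow> tcrd p = 0 \<Longrightarrow> tcrd (lin_ext g p) = 0" and "p \<in> chn m"
  shows "tensor_lift M n g (tk m p) = tk n (lin_ext g p)"
proof -
  have ch: "lin_ext g p \<in> chn n" if "p \<in> chn m" for p
    using that assms(1) by (intro lin_ext_chn) auto
  have "lin_ext g p \<in> tensor_null M n" if "p \<in> tensor_null M m" for p
    using that ch assms(2) null_chn[of m] tcrd_null by (subst null_iff) auto
  then show ?thesis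
    using quot_map_rep[OF rep_free_space null_subspace[of m] null_chn[of m] rep_free_space null_subspace[of n] _ null_chn[of n], of "lin_ext g" "lin_ext g" p]
      ch assms(3) fs.subspace_0[OF null_subspace]
    by (auto simp: tensor_lift_def tk_def)
qed

abbreviation tau :: "('a list \<Rightarrow>\<^sub>0 'k) \<Rightarrow> 'a list \<Rightarrow>\<^sub>0 'k" where
  "tau \<equiv> lin_ext (\<lambda>xs. tup (map \<sigma> xs))"

lemma tau_chn: "p \<in> chn m \<Longrightarrow> tau p \<in> chn m"
proof (rule lin_ext_chn)
  fix xs assume "p \<in> chn m" "xs \<in> keys p"
  then have "xs \<in> tuples M m"
    by blast
  then show "tup (map \<sigma> xs) \<in> chn m"
    using aut_closed by (auto simp: tuples_def)
qed

lemma tcrd_tau: "p \<in> chn m \<Longrightarrow> tcrd (tau p) = tsg (tcrd p)"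
proof -
  assume p: "p \<in> chn m"
  show ?thesis
  proof (rule lin_eq_on_keys[OF lin_compose[OF lin_tcrd lin_lin_ext] lin_compose[OF lin_tsg lin_tcrd]])
    fix s assume "s \<in> keys p"
    then have "set s \<subseteq> carrier M"
      using p by (auto simp: tuples_def)
    then have "map crd (map \<sigma> s) = map sg (map crd s)"
      by (auto simp: crd_aut)
    then show "tcrd (tau (tup s)) = tsg (tcrd (tup s))"
      by (simp add: tcrd_single tsg_tens del: map_map)
  qed
qed

text \<open>For a diagonal operator the image of the identity minus the operator is the sum of the
  eigenspaces with eigenvalue other than 1, that is, the kernel of \<open>inv_part\<close>.\<close>

lemma twist_null: "twist_null M \<sigma> m = tk m ` nul m"
proof -
  have t: "tensor_lift M m (\<lambda>xs. tup (map \<sigma> xs)) (tk m p) = tk m (tau p)" if "p \<in> chn m" for p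
    using that aut_closed
    by (intro tensor_lift_tk) (auto simp: tuples_def tcrd_tau[of _ m] lin_zero[OF lin_tsg])
  have eq: "twist_null M \<sigma> m = tk m ` (\<lambda>p. p - tau p) ` chn m"
    unfolding twist_null_def repD(4)[OF rep_tensor] image_image
    by (intro image_cong refl) (simp add: t rep_minus[OF rep_tensor _ tau_chn])
  have "p - tau p \<in> nul m" if "p \<in> chn m" for p
    using that fs.subspace_diff[OF subspace_keys that tau_chn[OF that]]
    by (auto simp: nul_def tcrd_simps tcrd_tau[of _ m] lookup_inv_part lookup_minus lookup_tsg intro!: poly_mapping_eqI)
  moreover have "tk m p \<in> tk m ` (\<lambda>p. p - tau p) ` chn m" if p: "p \<in> nul m" for p
  proof -
    \<comment> \<open>Solves \<open>w - tsg w = tcrd p\<close> by dividing each coefficient by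
      \<open>1 - lwt bs\<close>. Where \<open>lwt bs = 1\<close> the quotient is 0 by convention,
      which fits: \<open>inv_part (tcrd p) = 0\<close> makes the coefficient of
      \<open>tcrd p\<close> vanish there.\<close>
    let ?w = "lin_ext (\<lambda>bs. single bs (1 / (1 - lwt bs))) (tcrd p)"
    have pc: "p \<in> chn m" and ip: "inv_part (tcrd p) = 0"
      using p by (auto simp: nul_def)
    have "keys ?w \<subseteq> {bs. length bs = m}"
      using tcrd_chn[OF pc] by (intro keys_lin_ext) (auto split: if_splits)
    then have c: "lift ?w \<in> chn m"
      by (rule lift_chn)
    have lw: "lookup ?w bs = lookup (tcrd p) bs / (1 - lwt bs)" for bs
      by (auto simp: lin_ext_def lookup_sum lookup_single when_def in_keys_iff if_distrib cong: if_cong)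
    have "lookup (tcrd p) bs = 0" if "lwt bs = 1" for bs
      using arg_cong[OF ip, of "\<lambda>w. lookup w bs"] that by (simp add: lookup_inv_part)
    then have "tcrd (p - (lift ?w - tau (lift ?w))) = 0"
      by (auto simp: tcrd_simps tcrd_tau[OF c] tcrd_lift lookup_minus lookup_tsg lw intro!: poly_mapping_eqI)
        (metis (no_types, lifting) diff_divide_distrib left_diff_distrib mult_1 nonzero_mult_div_cancel_right
          right_minus_eq times_divide_eq_right mult.commute)
    moreover have z: "lift ?w - tau (lift ?w) \<in> chn m"
      by (rule fs.subspace_diff[OF subspace_keys c tau_chn[OF c]])
    ultimately have "p - (lift ?w - tau (lift ?w)) \<in> tensor_null M m"
      by (intro null_iff[OF fs.subspace_diff[OF subspace_keys pc z], THEN iffD2])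
    then have "tk m p = tk m (lift ?w - tau (lift ?w))"
      using repD(8)[OF rep_tensor pc z] by blast
    then show ?thesis
      using c by blast
  qed
  ultimately show ?thesis
    unfolding eq by blast
qed

definition hk :: "nat \<Rightarrow> ('a list \<Rightarrow>\<^sub>0 'k) \<Rightarrow> ('a list \<Rightarrow>\<^sub>0 'k) set set" where
  "hk n x = twist_null M \<sigma> (n + 1) +>\<^bsub>tensor_power M (n + 1)\<^esub> tk (n + 1) x"

lemma rep_hoch: "rep (hoch_chains M \<sigma> n) (hk n) (chn (n + 1)) (nul (n + 1))"
  using rep_quot[OF rep_tensor null_nul _ nul_subspace, of "n + 1"]
  by (auto simp: hoch_chains_def hk_def[abs_def] twist_null nul_def)

section \<open>The differentials in coordinates\<close>

lemmas vmul_simps = lin_simps[OF lin_vmul_left] lin_simps[OF lin_vmul_right]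
lemmas sg_simps = lin_simps[OF lin_sg]

lemmas tens2_simps = tens_lin_slots(1,2)[THEN lin_add] tens_lin_slots(1,2)[THEN lin_scale]
  tens_lin_slots(1,2)[THEN lin_zero] tens_lin_slots(1,2)[THEN lin_minus] tens_lin_slots(1,2)[THEN lin_diff]
lemmas tens3_simps = tens_lin_slots(3-5)[THEN lin_add] tens_lin_slots(3-5)[THEN lin_scale]
  tens_lin_slots(3-5)[THEN lin_zero] tens_lin_slots(3-5)[THEN lin_minus] tens_lin_slots(3-5)[THEN lin_diff]

text \<open>The twisted Hochschild differential from degree 2 to degree 1 on tensors of vectors;
  \<open>d2\<close> is the one from degree 3 to degree 2.\<close>

definition d1 :: "('b \<Rightarrow>\<^sub>0 'k) \<Rightarrow> ('b \<Rightarrow>\<^sub>0 'k) \<Rightarrow> ('b \<Rightarrow>\<^sub>0 'k) \<Rightarrow> 'b list \<Rightarrow>\<^sub>0 'k" where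
  "d1 u v w = tens [u \<star> v, w] - tens [u, v \<star> w] + tens [sg w \<star> u, v]"

definition d2 :: "('b \<Rightarrow>\<^sub>0 'k) \<Rightarrow> ('b \<Rightarrow>\<^sub>0 'k) \<Rightarrow> ('b \<Rightarrow>\<^sub>0 'k) \<Rightarrow> ('b \<Rightarrow>\<^sub>0 'k) \<Rightarrow> 'b list \<Rightarrow>\<^sub>0 'k" where
  "d2 u v w y = tens [u \<star> v, w, y] - tens [u, v \<star> w, y] + tens [u, v, w \<star> y] - tens [sg y \<star> u, v, w]"

lemma lin_d1: "lin (\<lambda>u. d1 u v w)" "lin (\<lambda>v. d1 u v w)" "lin (\<lambda>w. d1 u v w)"
  unfolding d1_def
  by (rule linI; simp only: tens2_simps vmul_simps sg_simps fs.scale_right_distrib fs.scale_right_diff_distrib; simp)+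

lemma lin_d2: "lin (\<lambda>u. d2 u v w y)" "lin (\<lambda>v. d2 u v w y)" "lin (\<lambda>w. d2 u v w y)" "lin (\<lambda>y. d2 u v w y)"
  unfolding d2_def
  by (rule linI; simp only: tens3_simps vmul_simps sg_simps fs.scale_right_distrib fs.scale_right_diff_distrib; simp)+

abbreviation e :: "'b \<Rightarrow> 'b \<Rightarrow>\<^sub>0 'k" where
  "e b \<equiv> single b 1"

definition D1 :: "('b list \<Rightarrow>\<^sub>0 'k) \<Rightarrow> 'b list \<Rightarrow>\<^sub>0 'k" where
  "D1 = lin_ext (\<lambda>bs. d1 (e (bs ! 0)) (e (bs ! 1)) (e (bs ! 2)))"

definition D2 :: "('b list \<Rightarrow>\<^sub>0 'k) \<Rightarrow> 'b list \<Rightarrow>\<^sub>0 'k" where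
  "D2 = lin_ext (\<lambda>bs. d2 (e (bs ! 0)) (e (bs ! 1)) (e (bs ! 2)) (e (bs ! 3)))"

lemma lin_D1: "lin D1" and lin_D2: "lin D2"
  by (auto simp: D1_def D2_def)

lemma D1_tens: "D1 (tens [u, v, w]) = d1 u v w"
proof -
  have *: "D1 (tens (map e [a, b, c])) = d1 (map e [a, b, c] ! 0) (map e [a, b, c] ! 1) (map e [a, b, c] ! 2)" for a b c
    unfolding tens_single by (simp add: D1_def)
  show ?thesis
    using lin_eqI3[of "\<lambda>xs. D1 (tens xs)" "\<lambda>xs. d1 (xs ! 0) (xs ! 1) (xs ! 2)" u v w, OF
        lin_compose[OF lin_D1 tens_lin_slots(3)] lin_compose[OF lin_D1 tens_lin_slots(4)] lin_compose[OF lin_D1 tens_lin_slots(5)] _ _ _ *]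
      lin_d1 by simp
qed

lemma D2_tens: "D2 (tens [u, v, w, y]) = d2 u v w y"
proof -
  have *: "D2 (tens (map e [a, b, c, d])) =
      d2 (map e [a, b, c, d] ! 0) (map e [a, b, c, d] ! 1) (map e [a, b, c, d] ! 2) (map e [a, b, c, d] ! 3)" for a b c d
    unfolding tens_single by (simp add: D2_def)
  show ?thesis
    using lin_eqI4[of "\<lambda>xs. D2 (tens xs)" "\<lambda>xs. d2 (xs ! 0) (xs ! 1) (xs ! 2) (xs ! 3)" u v w y, OF
        lin_compose[OF lin_D2 tens_lin_slots(6)] lin_compose[OF lin_D2 tens_lin_slots(7)]
        lin_compose[OF lin_D2 tens_lin_slots(8)] lin_compose[OF lin_D2 tens_lin_slots(9)] _ _ _ _ *]
      lin_d2 by simp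
qed

text \<open>The terms cancel in pairs: associativity handles the inner products, multiplicativity of
  \<open>sg\<close> the ones that wrap around.\<close>

lemma D1_d2: "D1 (d2 u v w y) = 0"
  unfolding d2_def by (simp only: lin_simps[OF lin_D1] D1_tens d1_def vmul_assoc sg_vmul) simp

lemma tsg_d1: "tsg (d1 u v w) = d1 (sg u) (sg v) (sg w)"
  unfolding d1_def by (simp only: lin_simps[OF lin_tsg] tsg_tens list.map sg_vmul)

lemma tsg_d2: "tsg (d2 u v w y) = d2 (sg u) (sg v) (sg w) (sg y)"
  unfolding d2_def by (simp only: lin_simps[OF lin_tsg] tsg_tens list.map sg_vmul)

text \<open>A map commuting with \<open>tsg\<close> sends an eigenvector into the eigenspace of the
  same eigenvalue, so the projection keeps or kills both sides alike.\<close>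

lemma inv_part_commute:
  assumes "lin D" "\<And>bs. length bs = m \<Longrightarrow> tsg (D (tup bs)) = D (tsg (tup bs))"
    and "keys w \<subseteq> {bs. length bs = m}"
  shows "inv_part (D w) = D (inv_part w)"
proof (rule lin_eq_on_keys[OF lin_compose[OF lin_inv_part assms(1)] lin_compose[OF assms(1) lin_inv_part]])
  fix bs assume "bs \<in> keys w"
  then have "tsg (D (tup bs)) = fscale (lwt bs) (D (tup bs))"
    using assms by (auto simp: tsg_def lin_simps[OF assms(1), symmetric])
  then have "lwt cs * lookup (D (tup bs)) cs = lwt bs * lookup (D (tup bs)) cs" for cs
    by (metis lookup_fscale lookup_tsg)
  then have *: "lwt cs = lwt bs \<or> lookup (D (tup bs)) cs = 0" for cs
    by auto
  show "inv_part (D (tup bs)) = D (inv_part (tup bs))"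
  proof (cases "lwt bs = 1")
    case True
    then have "inv_part (D (tup bs)) = D (tup bs)"
      using * by (intro poly_mapping_eqI) (metis lookup_inv_part)
    then show ?thesis
      using True by (simp add: inv_part_def)
  next
    case False
    then have "inv_part (D (tup bs)) = 0"
      using * by (intro poly_mapping_eqI) (metis lookup_inv_part lookup_zero)
    then show ?thesis
      using False by (simp add: inv_part_def lin_zero[OF assms(1)])
  qed
qed

lemma length3: "length bs = 3 \<Longrightarrow> \<exists>a b c. bs = [a, b, c]"
  and length4: "length bs = 4 \<Longrightarrow> \<exists>a b c d. bs = [a, b, c, d]"
  by (auto simp: numeral_eq_Suc length_Suc_conv)

lemma tup3: "length bs = 3 \<Longrightarrow> \<exists>a b c. tup bs = tens [e a, e b, e c]"
  and tup4: "length bs = 4 \<Longrightarrow> \<exists>a b c d. tup bs = tens [e a, e b, e c, e d]"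
  by (auto dest!: length3 length4 simp: tens_single[symmetric] simp del: tens.simps, blast+)

lemma inv_part_D1: "keys w \<subseteq> {bs. length bs = 3} \<Longrightarrow> inv_part (D1 w) = D1 (inv_part w)"
proof (rule inv_part_commute[OF lin_D1])
  fix bs :: "'b list" assume "length bs = 3"
  then obtain a b c where bs: "tup bs = tens [e a, e b, e c]"
    using tup3 by blast
  show "tsg (D1 (tup bs)) = D1 (tsg (tup bs))"
    unfolding bs by (simp only: D1_tens tsg_d1 tsg_tens list.map)
qed

lemma inv_part_D2: "keys w \<subseteq> {bs. length bs = 4} \<Longrightarrow> inv_part (D2 w) = D2 (inv_part w)"
proof (rule inv_part_commute[OF lin_D2])
  fix bs :: "'b list" assume "length bs = 4"
  then obtain a b c d where bs: "tup bs = tens [e a, e b, e c, e d]"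
    using tup4 by blast
  show "tsg (D2 (tup bs)) = D2 (tsg (tup bs))"
    unfolding bs by (simp only: D2_tens tsg_d2 tsg_tens list.map)
qed

abbreviation bb :: "nat \<Rightarrow> ('a list \<Rightarrow>\<^sub>0 'k) \<Rightarrow> 'a list \<Rightarrow>\<^sub>0 'k" where
  "bb n \<equiv> lin_ext (hoch_formula M \<sigma> n)"

lemma hoch_formula1: "hoch_formula M \<sigma> 1 [x, y, z] = tup [x \<otimes>\<^bsub>M\<^esub> y, z] - tup [x, y \<otimes>\<^bsub>M\<^esub> z] + tup [\<sigma> z \<otimes>\<^bsub>M\<^esub> x, y]"
  by (simp add: hoch_formula_def atMost_Suc numeral_eq_Suc single_uminus)

lemma hoch_formula2: "hoch_formula M \<sigma> 2 [x, y, z, w] =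
    tup [x \<otimes>\<^bsub>M\<^esub> y, z, w] - tup [x, y \<otimes>\<^bsub>M\<^esub> z, w] + tup [x, y, z \<otimes>\<^bsub>M\<^esub> w] - tup [\<sigma> w \<otimes>\<^bsub>M\<^esub> x, y, z]"
  by (simp add: hoch_formula_def atMost_Suc numeral_eq_Suc single_uminus)

lemma tcrd_tup: "tcrd (tup xs) = tens (map crd xs)"
  by (simp add: tcrd_def)

lemma
  assumes "xs \<in> tuples M 3"
  shows hoch_formula1_chn: "hoch_formula M \<sigma> 1 xs \<in> chn 2"
    and tcrd_hoch_formula1: "tcrd (hoch_formula M \<sigma> 1 xs) = D1 (tens (map crd xs))"
proof -
  obtain x y z where xs: "xs = [x, y, z]"
    using assms length3[of xs] by (auto simp: tuples_def)
  then have c: "x \<in> carrier M" "y \<in> carrier M" "z \<in> carrier M"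
    using assms by (auto simp: tuples_def)
  show "hoch_formula M \<sigma> 1 xs \<in> chn 2"
    unfolding xs hoch_formula1
    by (intro fs.subspace_add[OF subspace_keys] fs.subspace_diff[OF subspace_keys])
      (auto simp: tuples_def c mult_closed aut_closed)
  show "tcrd (hoch_formula M \<sigma> 1 xs) = D1 (tens (map crd xs))"
    unfolding xs hoch_formula1
    by (simp only: tcrd_simps tcrd_tup list.map D1_tens d1_def c crd_mult crd_aut aut_closed)
qed

lemma
  assumes "xs \<in> tuples M 4"
  shows hoch_formula2_chn: "hoch_formula M \<sigma> 2 xs \<in> chn 3"
    and tcrd_hoch_formula2: "tcrd (hoch_formula M \<sigma> 2 xs) = D2 (tens (map crd xs))"
proof -
  obtain x y z w where xs: "xs = [x, y, z, w]"
    using assms length4[of xs] by (auto simp: tuples_def)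
  then have c: "x \<in> carrier M" "y \<in> carrier M" "z \<in> carrier M" "w \<in> carrier M"
    using assms by (auto simp: tuples_def)
  show "hoch_formula M \<sigma> 2 xs \<in> chn 3"
    unfolding xs hoch_formula2
    by (intro fs.subspace_add[OF subspace_keys] fs.subspace_diff[OF subspace_keys])
      (auto simp: tuples_def c mult_closed aut_closed)
  show "tcrd (hoch_formula M \<sigma> 2 xs) = D2 (tens (map crd xs))"
    unfolding xs hoch_formula2
    by (simp only: tcrd_simps tcrd_tup list.map D2_tens d2_def c crd_mult crd_aut aut_closed)
qed

lemma
  assumes "p \<in> chn 3"
  shows bb1_chn: "bb 1 p \<in> chn 2" and tcrd_bb1: "tcrd (bb 1 p) = D1 (tcrd p)"
proof -
  show "bb 1 p \<in> chn 2"
    using assms by (intro lin_ext_chn hoch_formula1_chn) auto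
  show "tcrd (bb 1 p) = D1 (tcrd p)"
  proof (rule lin_eq_on_keys[OF lin_compose[OF lin_tcrd lin_lin_ext] lin_compose[OF lin_D1 lin_tcrd]])
    fix xs assume "xs \<in> keys p"
    then have "xs \<in> tuples M 3"
      using assms by blast
    then show "tcrd (bb 1 (tup xs)) = D1 (tcrd (tup xs))"
      by (simp only: tcrd_hoch_formula1 tcrd_tup lin_ext_single fs.scale_one)
  qed
qed

lemma
  assumes "p \<in> chn 4"
  shows bb2_chn: "bb 2 p \<in> chn 3" and tcrd_bb2: "tcrd (bb 2 p) = D2 (tcrd p)"
proof -
  show "bb 2 p \<in> chn 3"
    using assms by (intro lin_ext_chn hoch_formula2_chn) auto
  show "tcrd (bb 2 p) = D2 (tcrd p)"
  proof (rule lin_eq_on_keys[OF lin_compose[OF lin_tcrd lin_lin_ext] lin_compose[OF lin_D2 lin_tcrd]])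
    fix xs assume "xs \<in> keys p"
    then have "xs \<in> tuples M 4"
      using assms by blast
    then show "tcrd (bb 2 (tup xs)) = D2 (tcrd (tup xs))"
      by (simp only: tcrd_hoch_formula2 tcrd_tup lin_ext_single fs.scale_one)
  qed
qed

lemma hoch_diff_hk:
  assumes "\<And>xs. xs \<in> tuples M (n + 2) \<Longrightarrow> hoch_formula M \<sigma> n xs \<in> chn (n + 1)"
    and "lin D" "\<And>p. p \<in> chn (n + 2) \<Longrightarrow> tcrd (bb n p) = D (tcrd p)"
    and "\<And>w. keys w \<subseteq> {bs. length bs = n + 2} \<Longrightarrow> inv_part (D w) = D (inv_part w)"
    and p: "p \<in> chn (n + 2)"
  shows "hoch_diff M \<sigma> n (hk (n + 1) p) = hk n (bb n p)"
proof -
  have t: "tensor_lift M (n + 1) (hoch_formula M \<sigma> n) (tk (n + 2) z) = tk (n + 1) (bb n z)" if "z \<in> chn (n + 2)" for z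
    using assms(1,3) that by (intro tensor_lift_tk) (auto simp: lin_zero[OF assms(2)])
  have c: "bb n z \<in> chn (n + 1)" if "z \<in> chn (n + 2)" for z
    using assms(1) that by (intro lin_ext_chn) auto
  have "bb n z \<in> nul (n + 1)" if z: "z \<in> nul (n + 2)" for z
  proof -
    have "z \<in> chn (n + 2)" "inv_part (tcrd z) = 0"
      using z by (auto simp: nul_def)
    then show ?thesis
      using c tcrd_chn assms(3,4) unfolding nul_def by (auto simp: lin_zero[OF assms(2)])
  qed
  then have "quot_map (tensor_power M (n + 1)) (tk (n + 1) ` nul (n + 1)) (tensor_lift M (n + 1) (hoch_formula M \<sigma> n))
      (tk (n + 2) ` nul (n + 2) +>\<^bsub>tensor_power M (n + 2)\<^esub> tk (n + 2) p) =
      tk (n + 1) ` nul (n + 1) +>\<^bsub>tensor_power M (n + 1)\<^esub> tk (n + 1) (bb n p)"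
    using nul_subspace null_nul t c p
    by (intro quot_map_rep[OF rep_tensor _ _ rep_tensor]) (auto simp: nul_def)
  then show ?thesis
    by (simp add: hoch_diff_def hk_def twist_null)
qed

lemma hoch_diff1: "p \<in> chn 3 \<Longrightarrow> hoch_diff M \<sigma> 1 (hk 2 p) = hk 1 (bb 1 p)"
  using hoch_diff_hk[of 1 D1 p] hoch_formula1_chn lin_D1 tcrd_bb1 inv_part_D1 by (simp add: numeral_eq_Suc)

lemma hoch_diff2: "p \<in> chn 4 \<Longrightarrow> hoch_diff M \<sigma> 2 (hk 3 p) = hk 2 (bb 2 p)"
  using hoch_diff_hk[of 2 D2 p] hoch_formula2_chn lin_D2 tcrd_bb2 inv_part_D2 by (simp add: numeral_eq_Suc)

section \<open>Cycles and boundaries on the level of tensors\<close>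

definition Bd :: "('b list \<Rightarrow>\<^sub>0 'k) set" where
  "Bd = fs.span {d2 u v w y | u v w y. True}"

lemma subspace_Bd: "fs.subspace Bd"
  by (simp add: Bd_def)

lemma d2_Bd: "d2 u v w y \<in> Bd"
  by (auto simp: Bd_def intro!: fs.span_base)

lemma D1_Bd: "w \<in> Bd \<Longrightarrow> D1 w = 0"
proof -
  have "Bd \<subseteq> {w. D1 w \<in> {0}}"
    unfolding Bd_def
    by (rule fs.span_minimal[OF _ subspace_preimage[OF lin_D1 fs.subspace_single_0]]) (auto simp: D1_d2)
  then show "w \<in> Bd \<Longrightarrow> D1 w = 0"
    by blast
qed

lemma Bd_image: "w \<in> Bd \<Longrightarrow> \<exists>p\<in>chn 4. tcrd (bb 2 p) = w"
proof -
  have "Bd \<subseteq> (\<lambda>p. tcrd (bb 2 p)) ` chn 4"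
    unfolding Bd_def
  proof (rule fs.span_minimal[OF _ subspace_image[OF lin_compose[OF lin_tcrd lin_lin_ext] subspace_keys]])
    have "d2 u v w y \<in> (\<lambda>p. tcrd (bb 2 p)) ` chn 4" for u v w y
    proof
      show p: "tup [icrd u, icrd v, icrd w, icrd y] \<in> chn 4"
        using icrd(1) by (simp add: tuples_def)
      show "d2 u v w y = tcrd (bb 2 (tup [icrd u, icrd v, icrd w, icrd y]))"
        unfolding tcrd_bb2[OF p] by (simp only: tcrd_tup list.map icrd D2_tens)
    qed
    then show "{d2 u v w y | u v w y. True} \<subseteq> (\<lambda>p. tcrd (bb 2 p)) ` chn 4"
      by blast
  qed
  then show "w \<in> Bd \<Longrightarrow> \<exists>p\<in>chn 4. tcrd (bb 2 p) = w"
    by blast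
qed

text \<open>\<open>cyc\<close> and \<open>bdy\<close> collect the formal chains that represent
  cycles and boundaries of coinvariants, hence conditions only up to \<open>nul\<close>.\<close>

definition cyc :: "('a list \<Rightarrow>\<^sub>0 'k) set" where
  "cyc = {p \<in> chn 3. bb 1 p \<in> nul 2}"

definition bdy :: "('a list \<Rightarrow>\<^sub>0 'k) set" where
  "bdy = {bb 2 u + n | u n. u \<in> chn 4 \<and> n \<in> nul 3}"

text \<open>Since \<open>inv_part\<close> commutes with \<open>D1\<close>, a cycle of coinvariants
  becomes a genuine cycle of tensors after projection.\<close>

lemma cyc_iff: "p \<in> cyc \<longleftrightarrow> p \<in> chn 3 \<and> D1 (inv_part (tcrd p)) = 0"
  using bb1_chn[of p] tcrd_bb1[of p] inv_part_D1[OF tcrd_chn[of p 3]] by (auto simp: cyc_def nul_def)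

lemma inv_part_idem: "inv_part (inv_part w) = inv_part w"
  by (intro poly_mapping_eqI) (simp add: lookup_inv_part)

lemma D2_Bd: "keys w \<subseteq> {bs. length bs = 4} \<Longrightarrow> D2 w \<in> Bd"
proof (rule lin_in_subspace[OF lin_D2 subspace_Bd])
  fix bs assume "bs \<in> keys w" "keys w \<subseteq> {bs. length bs = 4}"
  then obtain a b c d where bs: "tup bs = tens [e a, e b, e c, e d]"
    using tup4 by blast
  show "D2 (tup bs) \<in> Bd"
    unfolding bs D2_tens by (rule d2_Bd)
qed

text \<open>Projecting a bounding chain gives one direction. Conversely, \<open>p\<close> differs
  from a boundary with coordinates \<open>inv_part (tcrd p)\<close> only by an element of
  \<open>nul 3\<close>, since \<open>inv_part\<close> is idempotent.\<close>

lemma bdy_iff: "p \<in> bdy \<longleftrightarrow> p \<in> chn 3 \<and> inv_part (tcrd p) \<in> Bd"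
proof
  assume "p \<in> bdy"
  then obtain u n where u: "p = bb 2 u + n" "u \<in> chn 4" "n \<in> nul 3"
    by (auto simp: bdy_def)
  then have n: "n \<in> chn 3" "inv_part (tcrd n) = 0"
    by (auto simp: nul_def)
  have "inv_part (tcrd p) = D2 (inv_part (tcrd u))"
    using u n by (simp add: tcrd_simps tcrd_bb2 lin_simps[OF lin_inv_part] inv_part_D2[OF tcrd_chn])
  moreover have "keys (inv_part (tcrd u)) \<subseteq> {bs. length bs = 4}"
    using tcrd_chn[OF u(2)] by (auto simp: in_keys_iff lookup_inv_part split: if_splits)
  ultimately show "p \<in> chn 3 \<and> inv_part (tcrd p) \<in> Bd"
    using D2_Bd fs.subspace_add[OF subspace_keys bb2_chn[OF u(2)] n(1)] u(1) by simp
next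
  assume p: "p \<in> chn 3 \<and> inv_part (tcrd p) \<in> Bd"
  then obtain u where u: "u \<in> chn 4" "tcrd (bb 2 u) = inv_part (tcrd p)"
    using Bd_image by blast
  have "p - bb 2 u \<in> nul 3"
    using p u fs.subspace_diff[OF subspace_keys conjunct1[OF p] bb2_chn[OF u(1)]]
    by (simp add: nul_def tcrd_simps lin_simps[OF lin_inv_part] inv_part_idem)
  then show "p \<in> bdy"
    using u(1) unfolding bdy_def by (intro CollectI exI[of _ u] exI[of _ "p - bb 2 u"]) simp
qed

lemma subspace_cyc: "fs.subspace cyc"
proof -
  have "cyc = chn 3 \<inter> {p. D1 (inv_part (tcrd p)) \<in> {0}}"
    using cyc_iff by blast
  then show ?thesis
    using fs.subspace_inter[OF subspace_keys subspace_preimage[OF lin_compose[OF lin_D1 lin_compose[OF lin_inv_part lin_tcrd]] fs.subspace_single_0]]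
    by simp
qed

lemma subspace_bdy: "fs.subspace bdy"
proof -
  have "bdy = chn 3 \<inter> {p. inv_part (tcrd p) \<in> Bd}"
    using bdy_iff by blast
  then show ?thesis
    using fs.subspace_inter[OF subspace_keys subspace_preimage[OF lin_compose[OF lin_inv_part lin_tcrd] subspace_Bd]]
    by simp
qed

lemma nul_bdy: "nul 3 \<subseteq> bdy" and bdy_cyc: "bdy \<subseteq> cyc"
  using fs.subspace_0[OF subspace_Bd] D1_Bd by (auto simp: bdy_iff cyc_iff nul_def)

lemma rep_HH2:
  "rep (twisted_HH M \<sigma> 2) (\<lambda>x. hk 2 ` bdy +>\<^bsub>(hoch_chains M \<sigma> 2)\<lparr>carrier := hk 2 ` cyc\<rparr>\<^esub> hk 2 x) cyc bdy"
proof -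
  have r: "rep (hoch_chains M \<sigma> 2) (hk 2) (chn 3) (nul 3)" "rep (hoch_chains M \<sigma> 1) (hk 1) (chn 2) (nul 2)"
      "rep (hoch_chains M \<sigma> 3) (hk 3) (chn 4) (nul 4)"
    using rep_hoch[of 2] rep_hoch[of 1] rep_hoch[of 3] by (simp_all add: numeral_eq_Suc)
  have z: "hoch_diff M \<sigma> 1 (hk 2 p) = \<zero>\<^bsub>hoch_chains M \<sigma> 1\<^esub> \<longleftrightarrow> bb 1 p \<in> nul 2" if "p \<in> chn 3" for p
    using repD(8)[OF r(2) bb1_chn[OF that] fs.subspace_0[OF subspace_keys]]
    unfolding hoch_diff1[OF that] repD(7)[OF r(2)] diff_zero .
  have cycles: "hoch_cycles M \<sigma> 2 = hk 2 ` cyc"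
  proof -
    have suc: "(\<forall>m. 2 = Suc m \<longrightarrow> P m) \<longleftrightarrow> P 1" for P :: "nat \<Rightarrow> bool"
      by (auto simp: numeral_2_eq_2)
    then show ?thesis
      unfolding hoch_cycles_def repD(4)[OF r(1)] cyc_def suc using z by blast
  qed
  have "hk 2 ` bb 2 ` chn 4 = hk 2 ` bdy"
  proof (intro equalityI subsetI)
    fix x assume "x \<in> hk 2 ` bdy"
    then obtain u n where u: "x = hk 2 (bb 2 u + n)" "u \<in> chn 4" "n \<in> nul 3"
      by (auto simp: bdy_def)
    then have "n \<in> chn 3"
      by (simp add: nul_def)
    then have "x = hk 2 (bb 2 u)"
      using u repD(8)[OF r(1) fs.subspace_add[OF subspace_keys bb2_chn[OF u(2)]] bb2_chn[OF u(2)]] by simp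
    then show "x \<in> hk 2 ` bb 2 ` chn 4"
      using u(2) by blast
  next
    fix x assume "x \<in> hk 2 ` bb 2 ` chn 4"
    then obtain u where u: "x = hk 2 (bb 2 u)" "u \<in> chn 4"
      by blast
    have "bb 2 u + 0 \<in> bdy"
      unfolding bdy_def using u(2) fs.subspace_0[OF nul_subspace] by blast
    then show "x \<in> hk 2 ` bdy"
      using u(1) by simp
  qed
  then have boundaries: "hoch_boundaries M \<sigma> 2 = hk 2 ` bdy"
    using repD(4)[OF r(3)] hoch_diff2 by (simp add: hoch_boundaries_def image_image)
  have "rep ((hoch_chains M \<sigma> 2)\<lparr>carrier := hk 2 ` cyc\<rparr>) (hk 2) cyc (nul 3)"
    using r(1) subspace_cyc nul_bdy bdy_cyc cyc_iff unfolding rep_def by auto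
  from rep_quot[OF this nul_bdy bdy_cyc subspace_bdy] show ?thesis
    by (simp add: twisted_HH_def cycles boundaries)
qed

text \<open>The invariant part of a representing chain is a genuine cycle, so it suffices to bound
  all genuine cycles, invariant or not.\<close>

lemma HH2_trivial:
  assumes "\<And>w. keys w \<subseteq> {bs. length bs = 3} \<Longrightarrow> D1 w = 0 \<Longrightarrow> w \<in> Bd"
  shows "carrier (twisted_HH M \<sigma> 2) = {\<zero>\<^bsub>twisted_HH M \<sigma> 2\<^esub>}"
proof -
  have "cyc \<subseteq> bdy"
  proof
    fix p assume p: "p \<in> cyc"
    have "keys (inv_part (tcrd p)) \<subseteq> {bs. length bs = 3}"
      using tcrd_chn[of p 3] p by (auto simp: cyc_iff in_keys_iff lookup_inv_part split: if_splits)
    then show "p \<in> bdy"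
      using p assms by (simp add: cyc_iff bdy_iff)
  qed
  then have "cyc = bdy"
    using bdy_cyc by blast
  then show ?thesis
    using rep_trivial rep_HH2 by metis
qed

text \<open>\<open>T\<close> is a cocycle that separates cycles modulo boundaries. Its invariance
  makes it blind to the other eigenspaces, so it descends to coinvariants.\<close>

lemma HH2_ground:
  assumes T: "\<And>x y. T (x + y) = T x + T y" "\<And>r x. T (fscale r x) = r * T x"
    and inv: "\<And>u v w. T (tens [sg u, sg v, sg w]) = T (tens [u, v, w])"
    and bd: "\<And>u v w y. T (d2 u v w y) = 0"
    and ker: "\<And>w. keys w \<subseteq> {bs. length bs = 3} \<Longrightarrow> D1 w = 0 \<Longrightarrow> T w = 0 \<Longrightarrow> w \<in> Bd"
    and w0: "keys w0 \<subseteq> {bs. length bs = 3}" "D1 w0 = 0" "T w0 = 1"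
  shows "linear_iso (twisted_HH M \<sigma> 2) (ground_space :: ('k, 'k) module)"
proof (rule rep_linear_iso_ground[OF rep_HH2, where t = "\<lambda>p. T (inv_part (tcrd p))" and w = "lift w0"])
  have Bd: "T w = 0" if "w \<in> Bd" for w
  proof -
    have T0: "T 0 = 0"
      using T(2)[of 0 0] by simp
    have "Bd \<subseteq> {w. T w = 0}"
      unfolding Bd_def by (rule fs.span_minimal) (auto simp: bd T T0 intro!: fs.subspaceI)
    then show ?thesis
      using that by blast
  qed
  have T_inv: "T (inv_part w) = T w" if "keys w \<subseteq> {bs. length bs = 3}" for w
  proof -
    have Tsum: "T (\<Sum>s\<in>S. h s) = (\<Sum>s\<in>S. T (h s))" for S and h :: "'b list \<Rightarrow> _"
      using T(2)[of 0 0] by (induction S rule: infinite_finite_induct) (auto simp: T)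
    have single: "T (inv_part (tup bs)) = T (tup bs)" if "length bs = 3" for bs
    proof -
      obtain a b c where bs: "tup bs = tens [e a, e b, e c]"
        using tup3[of bs] \<open>length bs = 3\<close> by blast
      have "T (tsg (tup bs)) = T (tup bs)"
        unfolding bs by (simp only: tsg_tens list.map inv)
      moreover have "tsg (tup bs) = fscale (lwt bs) (tup bs)"
        by (simp add: tsg_def)
      \<comment> \<open>An eigenvalue other than 1 is compatible with invariance only if
        \<open>T\<close> vanishes on the eigenvector.\<close>
      ultimately have "(lwt bs - 1) * T (tup bs) = 0"
        by (simp add: T(2) algebra_simps del: fscale_single)
      then show ?thesis
        using T(2)[of 0 0] by (auto simp: inv_part_def)
    qed
    have "inv_part w = (\<Sum>s\<in>keys w. fscale (lookup w s) (inv_part (tup s)))"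
      by (subst poly_mapping_expand[of w], simp only: lin_simps[OF lin_inv_part])
    then have "T (inv_part w) = (\<Sum>s\<in>keys w. T (fscale (lookup w s) (tup s)))"
      unfolding Tsum T(2) using single that by (auto simp: Tsum T(2) simp del: fscale_single intro!: sum.cong)
    also have "\<dots> = T w"
      by (subst (3) poly_mapping_expand[of w], simp only: Tsum)
    finally show ?thesis .
  qed
  show "T (inv_part (tcrd (x + y))) = T (inv_part (tcrd x)) + T (inv_part (tcrd y))" for x y
    by (simp add: tcrd_simps lin_simps[OF lin_inv_part] T)
  show "T (inv_part (tcrd (fscale r x))) = r * T (inv_part (tcrd x))" for r x
    by (simp add: tcrd_simps lin_simps[OF lin_inv_part] T)
  show "T (inv_part (tcrd p)) = 0 \<longleftrightarrow> p \<in> bdy" if "p \<in> cyc" for p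
  proof -
    have "keys (inv_part (tcrd p)) \<subseteq> {bs. length bs = 3}"
      using tcrd_chn[of p 3] that by (auto simp: cyc_iff in_keys_iff lookup_inv_part split: if_splits)
    then show ?thesis
      using that ker Bd by (auto simp: cyc_iff bdy_iff)
  qed
  show "lift w0 \<in> cyc"
    using w0 lift_chn[OF w0(1)] inv_part_D1[OF w0(1)] by (simp add: cyc_iff tcrd_lift lin_zero[OF lin_inv_part])
  show "T (inv_part (tcrd (lift w0))) = 1"
    using w0 T_inv by (simp add: tcrd_lift)
qed

end

section \<open>The normal form of the free algebra modulo the relations\<close>

lemma const_mult: "const r * x = fscale r x"
  by (simp add: const_def fscale_def mult_map_scale_conv_mult)

lemma const_fscale: "const r = fscale r 1"
  using const_mult[of r 1] by simp

lemma lin_mult_left: "lin (\<lambda>x :: 'k::field podles_free. x * y)"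
  and lin_mult_right: "lin (\<lambda>y :: 'k podles_free. x * y)"
proof -
  have *: "x * fscale r y = fscale r (x * y)" for x y :: "'k podles_free" and r
  proof -
    have "x * const r = const r * x"
      by (rule lin_eqI[where f = "\<lambda>x. x * const r" and g = "\<lambda>x. const r * x"])
        (auto intro!: linI simp: algebra_simps const_mult[symmetric] const_def mult_single
          simp flip: mult.assoc)
    then show ?thesis
      by (simp add: const_mult[symmetric] flip: mult.assoc)
  qed
  show "lin (\<lambda>x :: 'k podles_free. x * y)" "lin (\<lambda>y :: 'k podles_free. x * y)"
    by (auto intro!: linI simp: * algebra_simps) (simp add: const_mult[symmetric] mult.assoc)
qed

lemmas free_mult_simps = lin_simps[OF lin_mult_left] lin_simps[OF lin_mult_right]

lemma single_Word_Cons: "single (Word (x # xs)) (1 :: 'k::field) = gen x * single (Word xs) 1"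
  by (simp add: gen_def mult_single plus_podles_word_def)

lemma lin_subst: "lin (subst g)"
  by (auto simp: subst_def)

lemma subst_mult: "subst g (x * y) = subst g x * subst g y"
proof -
  have 1: "subst g (single v 1 * single w 1) =
      subst g (single v 1) * subst g (single w 1)" for v w
    by (simp add: subst_def mult_single plus_podles_word_def)
  have "subst g (single v 1 * y) = subst g (single v 1) * subst g y" for v
    by (rule lin_eqI[OF lin_compose[OF lin_subst lin_mult_right] lin_compose[OF lin_mult_right lin_subst]]) (rule 1)
  then show ?thesis
    by (rule lin_eqI[OF lin_compose[OF lin_subst lin_mult_left] lin_compose[OF lin_mult_left lin_subst]])
qed

lemma subst_gen: "subst g (gen x) = g x"
  by (simp add: subst_def gen_def)

lemma subst_one: "subst g 1 = 1"
  using lin_ext_single[of "\<lambda>w. prod_list (map g (letters w))" 0 1]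
  by (simp only: single_one fs.scale_one subst_def) (simp add: zero_podles_word_def)

lemma subst_const: "subst g (const r) = const r"
  using lin_scale[OF lin_subst, of g r 1] const_mult[of r 1] by (simp add: subst_one)

lemmas subst_simps = lin_simps[OF lin_subst] subst_mult subst_gen subst_one subst_const

lemma free_alg_simps:
  "carrier free_alg = UNIV" "x \<otimes>\<^bsub>free_alg\<^esub> y = x * y" "x \<oplus>\<^bsub>free_alg\<^esub> y = x + y"
  "\<zero>\<^bsub>free_alg\<^esub> = 0" "\<one>\<^bsub>free_alg\<^esub> = 1" "r \<odot>\<^bsub>free_alg\<^esub> x = fscale r x"
  by (simp_all add: free_alg_def ring_of_type_algebra_def ring.defs module.defs)

lemma rep_free_alg: "rep free_alg (\<lambda>x. x) UNIV {0}"
  by (simp add: rep_def free_alg_simps fs.subspace_single_0)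

lemma ring_free_alg: "ring (free_alg :: ('k::field, 'k podles_free) module)"
  using rep_abelian_group[OF rep_free_alg]
  by (intro ringI abelian_group.axioms monoidI) (auto simp: free_alg_simps algebra_simps)

lemma ideal_free_alg:
  assumes "fs.subspace J" "\<And>x y. x \<in> J \<Longrightarrow> y * x \<in> J" "\<And>x y. x \<in> J \<Longrightarrow> x * y \<in> J"
  shows "ideal J free_alg"
proof (rule idealI[OF ring_free_alg])
  interpret abelian_group free_alg
    by (rule rep_abelian_group[OF rep_free_alg])
  have minus: "\<ominus>\<^bsub>free_alg\<^esub> x = - x" for x :: "'a podles_free"
    by (intro minus_equality) (auto simp: free_alg_simps)
  show "subgroup J (add_monoid free_alg)"
    using fs.subspace_neg[OF assms(1)] assms(1) minus
    by (intro subgroup.intro) (auto simp: free_alg_simps fs.subspace_add fs.subspace_0 a_inv_def)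
qed (use assms in \<open>auto simp: free_alg_simps\<close>)

lemma ideal_free_algD:
  assumes "ideal J free_alg"
  shows "fs.subspace J" "x \<in> J \<Longrightarrow> y * x \<in> J" "x \<in> J \<Longrightarrow> x * y \<in> J"
proof -
  interpret ideal J free_alg
    by (rule assms)
  show l: "y * x \<in> J" if "x \<in> J" for x y
    using I_l_closed[OF that, of y] by (simp add: free_alg_simps)
  show "x * y \<in> J" if "x \<in> J" for x y
    using I_r_closed[OF that, of y] by (simp add: free_alg_simps)
  show "fs.subspace J"
    using additive_subgroup.a_closed[OF is_additive_subgroup] additive_subgroup.zero_closed[OF is_additive_subgroup] l
    by (intro fs.subspaceI) (auto simp: free_alg_simps const_mult[symmetric])
qed

section \<open>The quotient by the defining relations\<close>

locale podles_sphere =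
  fixes q c d :: "'k::field"
  assumes q_nonzero: "q \<noteq> 0"
begin

abbreviation I :: "'k podles_free set" where
  "I \<equiv> podles_ideal q c d"

lemma ideal_I: "ideal I free_alg" and rels_I: "podles_rels q c d \<subseteq> I"
proof -
  interpret ring "free_alg :: ('k, 'k podles_free) module"
    by (rule ring_free_alg)
  show "ideal I free_alg" "podles_rels q c d \<subseteq> I"
    unfolding podles_ideal_def by (auto intro!: genideal_ideal genideal_self simp: free_alg_simps)
qed

lemmas subspace_I = ideal_free_algD(1)[OF ideal_I]
lemmas I_left = ideal_free_algD(2)[OF ideal_I]
lemmas I_right = ideal_free_algD(3)[OF ideal_I]

lemma I_least:
  assumes "fs.subspace J" "\<And>x y. x \<in> J \<Longrightarrow> y * x \<in> J" "\<And>x y. x \<in> J \<Longrightarrow> x * y \<in> J" "podles_rels q c d \<subseteq> J"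
  shows "I \<subseteq> J"
  using ideal_free_alg[OF assms(1-3)] assms(4) by (auto simp: podles_ideal_def genideal_def)

definition cls :: "'k podles_free \<Rightarrow> 'k podles_free set" where
  "cls x = I +>\<^bsub>free_alg\<^esub> x"

lemma rep_podles: "rep (podles q c d) cls UNIV I"
  using rep_quot[OF rep_free_alg _ _ subspace_I] fs.subspace_0[OF subspace_I]
  by (simp add: podles_def cls_def[abs_def])

lemma cls_eq: "cls x = cls y \<longleftrightarrow> x - y \<in> I"
  using repD(8)[OF rep_podles] by simp

lemma carrier_podles: "carrier (podles q c d) = range cls"
  using repD(4)[OF rep_podles] by simp

lemma cls_set: "cls x = (\<lambda>k. k + x) ` I"
  using rep_coset[OF rep_free_alg, of I x] by (simp add: cls_def)

lemma cls_mult: "cls x \<otimes>\<^bsub>podles q c d\<^esub> cls y = cls (x * y)"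
proof -
  have "cls x \<otimes>\<^bsub>podles q c d\<^esub> cls y = (\<Union>a\<in>cls x. \<Union>b\<in>cls y. cls (a * b))"
    by (simp add: podles_def quot_def FactRing_def ring.defs module.defs rcoset_mult_def free_alg_simps cls_def)
  also have "\<dots> = (\<Union>a\<in>cls x. \<Union>b\<in>cls y. cls (x * y))"
  proof (intro SUP_cong refl)
    fix a b assume "a \<in> cls x" "b \<in> cls y"
    then obtain k l where kl: "k \<in> I" "l \<in> I" "a = k + x" "b = l + y"
      by (auto simp: cls_set)
    then have "a * b - x * y = k * b + x * l"
      by (simp add: algebra_simps)
    then show "cls (a * b) = cls (x * y)"
      using kl I_left I_right by (simp add: cls_eq fs.subspace_add[OF subspace_I])
  qed
  also have "\<dots> = cls (x * y)"
    using fs.subspace_0[OF subspace_I] by (auto simp: cls_set)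
  finally show ?thesis .
qed

abbreviation A where "A \<equiv> gen GenA :: 'k podles_free"
abbreviation B where "B \<equiv> gen GenB :: 'k podles_free"
abbreviation Bs where "Bs \<equiv> gen GenBs :: 'k podles_free"

lemma rels_cases:
  assumes "r \<in> podles_rels q c d"
  obtains "r = B * A - fscale (q\<^sup>2) (A * B)" | "r = A * Bs - fscale (q\<^sup>2) (Bs * A)"
    | "r = Bs * B - (fscale (c * d) 1 + fscale (c - d) A - A * A)"
    | "r = B * Bs - (fscale (c * d) 1 + fscale (q\<^sup>2 * (c - d)) A - fscale (q ^ 4) (A * A))"
  using assms unfolding podles_rels_def Let_def const_fscale free_mult_simps power2_eq_square[of "gen GenA"]
  by auto

lemma relations:
  "B * A - fscale (q\<^sup>2) (A * B) \<in> I" "A * Bs - fscale (q\<^sup>2) (Bs * A) \<in> I"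
  "Bs * B - (fscale (c * d) 1 + fscale (c - d) A - A * A) \<in> I"
  "B * Bs - (fscale (c * d) 1 + fscale (q\<^sup>2 * (c - d)) A - fscale (q ^ 4) (A * A)) \<in> I"
  using rels_I by (simp_all add: podles_rels_def Let_def const_fscale free_mult_simps power2_eq_square[of "gen GenA"])

text \<open>The index \<open>(i, j)\<close> stands for \<open>A\<^sup>i B\<^sup>j\<close> if \<open>j \<ge> 0\<close> and for \<open>A\<^sup>i (B\<^sup>*)\<^sup>-\<^sup>j\<close> if \<open>j < 0\<close>.\<close>

abbreviation ev :: "nat \<times> int \<Rightarrow> nat \<times> int \<Rightarrow>\<^sub>0 'k" where
  "ev b \<equiv> single b 1"

text \<open>Left multiplication on normal words, as dictated by the rewriting rules. That the
  relations act as zero (\<open>act_rels\<close>) makes this a module over the quotient, which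
  proves normal words independent without a confluence argument.\<close>

fun gact :: "podles_gen \<Rightarrow> nat \<times> int \<Rightarrow> nat \<times> int \<Rightarrow>\<^sub>0 'k" where
  "gact GenA (i, j) = ev (i + 1, j)"
| "gact GenB (i, j) = fscale (q ^ (2 * i)) (if j \<ge> 0 then ev (i, j + 1) else
     fscale (c * d) (ev (i, j + 1)) + fscale (q\<^sup>2 * (c - d)) (ev (i + 1, j + 1)) - fscale (q ^ 4) (ev (i + 2, j + 1)))"
| "gact GenBs (i, j) = fscale (inverse q ^ (2 * i)) (if j \<le> 0 then ev (i, j - 1) else
     fscale (c * d) (ev (i, j - 1)) + fscale (c - d) (ev (i + 1, j - 1)) - ev (i + 2, j - 1))"

definition gop :: "podles_gen \<Rightarrow> (nat \<times> int \<Rightarrow>\<^sub>0 'k) \<Rightarrow> nat \<times> int \<Rightarrow>\<^sub>0 'k" where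
  "gop x = lin_ext (gact x)"

definition act :: "'k podles_free \<Rightarrow> (nat \<times> int \<Rightarrow>\<^sub>0 'k) \<Rightarrow> nat \<times> int \<Rightarrow>\<^sub>0 'k" where
  "act f v = lin_ext (\<lambda>w. foldr gop (letters w) v) f"

lemma lin_gop: "lin (gop x)"
  by (auto simp: gop_def)

lemma lin_foldr_gop: "lin (foldr gop xs)"
proof (induction xs)
  case Nil
  then show ?case by (simp add: lin_def)
next
  case (Cons x xs)
  then show ?case
    using lin_compose[OF lin_gop, of "foldr gop xs" x] by (simp add: comp_def)
qed

lemma lin_act_left: "lin (\<lambda>f. act f v)" and lin_act_right: "lin (\<lambda>v. act f v)"
  unfolding act_def by (rule lin_lin_ext) (rule lin_lin_ext_param[OF lin_foldr_gop])

lemma act_mult: "act (f * g) v = act f (act g v)"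
proof -
  have 1: "act (single x 1 * single w 1) v = act (single x 1) (act (single w 1) v)" for x w
    by (simp add: act_def mult_single plus_podles_word_def)
  have "act (single x 1 * g) v = act (single x 1) (act g v)" for x
    by (rule lin_eqI[OF lin_compose[OF lin_act_left lin_mult_right] lin_compose[OF lin_act_right lin_act_left]]) (rule 1)
  then show ?thesis
    by (rule lin_eqI[OF lin_compose[OF lin_act_left lin_mult_left] lin_act_left])
qed

lemma act_gen: "act (gen x) v = gop x v"
  by (simp add: act_def gen_def)

lemma act_one: "act 1 v = v"
  using lin_ext_single[of "\<lambda>w. foldr gop (letters w) v" 0 1]
  by (simp only: single_one fs.scale_one act_def) (simp add: zero_podles_word_def)

lemmas act_simps = lin_simps[OF lin_act_left] lin_simps[OF lin_act_right] act_mult act_gen act_one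

lemma gop_single: "gop x (single b r) = fscale r (gact x b)"
  by (simp add: gop_def)

lemmas gop_simps = lin_simps[OF lin_gop] gop_single

lemma act_rels:
  assumes "r \<in> podles_rels q c d" shows "act r v = 0"
proof -
  have "act r (ev (i, j)) = 0" for i j
  proof -
    \<comment> \<open>The rules for \<open>B\<close> and \<open>B\<^sup>*\<close> change around
      \<open>j = 0\<close> and a relation applies two letters; on each of these four ranges the
      branches taken are constant.\<close>
    have j: "j \<ge> 1 \<or> j = 0 \<or> j = -1 \<or> j < -1"
      by linarith
    note simps = act_simps gop_simps free_mult_simps lookup_add lookup_minus lookup_single when_def
      power_add power_mult field_simps power2_eq_square power4_eq_xxxx
    from assms show ?thesis
    proof (cases rule: rels_cases)
      case 1
      show ?thesis
        using j q_nonzero unfolding 1 by (elim disjE) (auto intro!: poly_mapping_eqI simp: simps)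
    next
      case 2
      show ?thesis
        using j q_nonzero unfolding 2 by (elim disjE) (auto intro!: poly_mapping_eqI simp: simps)
    next
      case 3
      show ?thesis
        using j q_nonzero unfolding 3 by (elim disjE) (auto intro!: poly_mapping_eqI simp: simps)
    next
      case 4
      show ?thesis
        using j q_nonzero unfolding 4 by (elim disjE) (auto intro!: poly_mapping_eqI simp: simps)
    qed
  qed
  then show ?thesis
    using lin_eqI[OF lin_act_right lin_const_zero, of r v] by auto
qed

lemma act_I: "f \<in> I \<Longrightarrow> act f v = 0"
proof -
  have "I \<subseteq> {f. \<forall>v. act f v = 0}"
    by (rule I_least) (auto intro!: fs.subspaceI simp: act_simps act_rels)
  then show "f \<in> I \<Longrightarrow> act f v = 0"
    by blast
qed

section \<open>Normal forms and the word problem\<close>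

definition nf :: "'k podles_free \<Rightarrow> nat \<times> int \<Rightarrow>\<^sub>0 'k" where
  "nf f = act f (ev (0, 0))"

fun mon :: "nat \<times> int \<Rightarrow> 'k podles_free" where
  "mon (i, j) = A ^ i * (if j \<ge> 0 then B ^ nat j else Bs ^ nat (- j))"

definition emb :: "(nat \<times> int \<Rightarrow>\<^sub>0 'k) \<Rightarrow> 'k podles_free" where
  "emb = lin_ext mon"

lemma lin_nf: "lin nf" and lin_emb: "lin emb"
  unfolding nf_def[abs_def] emb_def by (rule lin_act_left) (rule lin_lin_ext)

lemma emb_single: "emb (single b r) = fscale r (mon b)"
  by (simp add: emb_def)

lemmas emb_simps = lin_simps[OF lin_emb] emb_single

lemma nf_mon: "nf (mon b) = ev b"
proof -
  have a: "act (A ^ i) (ev (k, l)) = ev (k + i, l)" for i k l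
    by (induction i arbitrary: k) (simp_all add: act_simps gop_simps)
  have b: "act (B ^ n) (ev (0, 0)) = ev (0, int n)" for n
    by (induction n) (simp_all add: act_simps gop_simps add.commute)
  have bs: "act (Bs ^ n) (ev (0, 0)) = ev (0, - int n)" for n
    by (induction n) (auto simp: act_simps gop_simps intro!: arg_cong[of _ _ ev])
  show ?thesis
    by (cases b) (simp add: nf_def act_mult a b bs)
qed

lemma nf_emb: "nf (emb v) = v"
  by (rule lin_eqI[OF lin_compose[OF lin_nf lin_emb] lin_id]) (simp add: emb_single nf_mon)

definition cong :: "'k podles_free \<Rightarrow> 'k podles_free \<Rightarrow> bool" (infix "\<doteq>" 50) where
  "x \<doteq> y \<longleftrightarrow> x - y \<in> I"

lemma cong_refl: "x \<doteq> x"
  by (simp add: cong_def fs.subspace_0[OF subspace_I])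

lemma cong_trans [trans]: "x \<doteq> y \<Longrightarrow> y \<doteq> z \<Longrightarrow> x \<doteq> z"
  using fs.subspace_add[OF subspace_I, of "x - y" "y - z"] by (simp add: cong_def)

lemma cong_mult: "x \<doteq> y \<Longrightarrow> u * x * w \<doteq> u * y * w"
  using I_right[OF I_left, of "x - y" u w] by (simp add: cong_def algebra_simps)

lemma cong_scale: "x \<doteq> y \<Longrightarrow> fscale r x \<doteq> fscale r y"
  using fs.subspace_scale[OF subspace_I, of "x - y" r] by (simp add: cong_def fs.scale_right_diff_distrib)

lemma B_A_power: "B * A ^ i \<doteq> fscale (q ^ (2 * i)) (A ^ i * B)"
proof (induction i)
  case 0
  then show ?case by (simp add: cong_refl)
next
  case (Suc i)
  have "B * A ^ Suc i = 1 * (B * A) * A ^ i"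
    by (simp add: mult.assoc)
  also have "\<dots> \<doteq> 1 * fscale (q\<^sup>2) (A * B) * A ^ i"
    by (rule cong_mult) (simp add: cong_def relations)
  also have "\<dots> = fscale (q\<^sup>2) (A * (B * A ^ i) * 1)"
    by (simp add: free_mult_simps mult.assoc)
  also have "\<dots> \<doteq> fscale (q\<^sup>2) (A * fscale (q ^ (2 * i)) (A ^ i * B) * 1)"
    by (intro cong_scale cong_mult Suc)
  also have "\<dots> = fscale (q ^ (2 * Suc i)) (A ^ Suc i * B)"
    by (simp add: free_mult_simps mult.assoc power2_eq_square)
  finally show ?case .
qed

lemma Bs_A_power: "Bs * A ^ i \<doteq> fscale (inverse q ^ (2 * i)) (A ^ i * Bs)"
proof (induction i)
  case 0
  then show ?case by (simp add: cong_refl)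
next
  case (Suc i)
  have "fscale (- inverse (q\<^sup>2)) (A * Bs - fscale (q\<^sup>2) (Bs * A)) \<in> I"
    by (intro fs.subspace_scale[OF subspace_I] relations)
  then have r: "Bs * A \<doteq> fscale (inverse q ^ 2) (A * Bs)"
    using q_nonzero by (simp add: cong_def fs.scale_right_diff_distrib power_inverse)
  have "Bs * A ^ Suc i = 1 * (Bs * A) * A ^ i"
    by (simp add: mult.assoc)
  also have "\<dots> \<doteq> 1 * fscale (inverse q ^ 2) (A * Bs) * A ^ i"
    by (rule cong_mult[OF r])
  also have "\<dots> = fscale (inverse q ^ 2) (A * (Bs * A ^ i) * 1)"
    by (simp add: free_mult_simps mult.assoc)
  also have "\<dots> \<doteq> fscale (inverse q ^ 2) (A * fscale (inverse q ^ (2 * i)) (A ^ i * Bs) * 1)"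
    by (intro cong_scale cong_mult Suc)
  also have "\<dots> = fscale (inverse q ^ (2 * Suc i)) (A ^ Suc i * Bs)"
    by (simp add: free_mult_simps mult.assoc power2_eq_square)
  finally show ?case .
qed

lemma power_mult_quadratic:
  "A ^ i * (fscale r 1 + fscale s A - fscale t (A * A)) * y =
    fscale r (A ^ i * y) + fscale s (A ^ (i + 1) * y) - fscale t (A ^ (i + 2) * y)"
proof -
  have "A ^ (i + 1) = A ^ i * A" "A ^ (i + 2) = A ^ i * (A * A)"
    by (simp_all only: power_add power_one_right power2_eq_square)
  then show ?thesis
    by (simp only: free_mult_simps mult.assoc mult_1_left)
qed

text \<open>The abstract action is realised by rewriting: moving the letter past
  \<open>A ^ i\<close> only scales, and where \<open>B\<close> meets \<open>B\<^sup>*\<close> a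
  quadratic relation is used.\<close>

lemma gen_mon: "gen x * mon b \<doteq> emb (gact x b)"
proof (cases b)
  case (Pair i j)
  show ?thesis
  proof (cases x)
    case GenA
    then show ?thesis
      using Pair by (simp add: emb_simps mult.assoc cong_refl)
  next
    case GenB
    define y where "y = (if j \<ge> 0 then B ^ nat j else Bs ^ nat (- j))"
    have "B * mon b = 1 * (B * A ^ i) * y"
      using Pair by (simp add: y_def mult.assoc)
    also have "\<dots> \<doteq> 1 * fscale (q ^ (2 * i)) (A ^ i * B) * y"
      by (rule cong_mult[OF B_A_power])
    also have "\<dots> = fscale (q ^ (2 * i)) (A ^ i * (B * y))"
      by (simp add: free_mult_simps mult.assoc)
    also have "\<dots> \<doteq> emb (gact GenB b)"
    proof (cases "j \<ge> 0")
      case True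
      then show ?thesis
        using Pair by (simp add: y_def emb_simps nat_add_distrib cong_refl del: fscale_single)
    next
      case False
      then have n: "nat (- j) = Suc (nat (- j - 1))"
        by linarith
      have y: "y = Bs * Bs ^ nat (- j - 1)"
        using False by (simp only: y_def n power_Suc if_False)
      have "fscale (q ^ (2 * i)) (A ^ i * (B * y)) = fscale (q ^ (2 * i)) (A ^ i * (B * Bs) * Bs ^ nat (- j - 1))"
        by (simp add: y mult.assoc)
      also have "\<dots> \<doteq> fscale (q ^ (2 * i)) (A ^ i * (fscale (c * d) 1 + fscale (q\<^sup>2 * (c - d)) A - fscale (q ^ 4) (A * A)) * Bs ^ nat (- j - 1))"
        by (intro cong_scale cong_mult) (simp add: cong_def relations)
      also have "\<dots> = emb (gact GenB b)"
      proof -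
        have "(if 0 \<le> j + 1 then B ^ nat (j + 1) else Bs ^ nat (- (j + 1))) = Bs ^ nat (- j - 1)"
          using False by (cases "j = -1") auto
        then show ?thesis
          unfolding power_mult_quadratic
          by (simp only: Pair gact.simps mon.simps emb_simps False if_False fs.scale_one)
      qed
      finally show ?thesis .
    qed
    finally show ?thesis
      using GenB by simp
  next
    case GenBs
    define y where "y = (if j \<ge> 0 then B ^ nat j else Bs ^ nat (- j))"
    have "Bs * mon b = 1 * (Bs * A ^ i) * y"
      using Pair by (simp add: y_def mult.assoc)
    also have "\<dots> \<doteq> 1 * fscale (inverse q ^ (2 * i)) (A ^ i * Bs) * y"
      by (rule cong_mult[OF Bs_A_power])
    also have "\<dots> = fscale (inverse q ^ (2 * i)) (A ^ i * (Bs * y))"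
      by (simp add: free_mult_simps mult.assoc)
    also have "\<dots> \<doteq> emb (gact GenBs b)"
    proof (cases "j \<le> 0")
      case True
      then have n: "nat (- (j - 1)) = Suc (nat (- j))"
        by linarith
      have "Bs * y = Bs ^ nat (- (j - 1))"
        using True unfolding n by (cases "j = 0") (auto simp: y_def)
      then show ?thesis
        using Pair True by (simp add: emb_simps cong_refl del: fscale_single)
    next
      case False
      then have n: "nat j = Suc (nat (j - 1))"
        by linarith
      have y: "y = B * B ^ nat (j - 1)"
        using False by (simp add: y_def n)
      have "fscale (inverse q ^ (2 * i)) (A ^ i * (Bs * y)) = fscale (inverse q ^ (2 * i)) (A ^ i * (Bs * B) * B ^ nat (j - 1))"
        by (simp add: y mult.assoc)
      also have "\<dots> \<doteq> fscale (inverse q ^ (2 * i)) (A ^ i * (fscale (c * d) 1 + fscale (c - d) A - A * A) * B ^ nat (j - 1))"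
        by (intro cong_scale cong_mult) (simp add: cong_def relations)
      also have "\<dots> = emb (gact GenBs b)"
      proof -
        have "(if 0 \<le> j - 1 then B ^ nat (j - 1) else Bs ^ nat (- (j - 1))) = B ^ nat (j - 1)"
          using False by simp
        then show ?thesis
          using power_mult_quadratic[of i "c * d" "c - d" 1]
          by (simp only: Pair gact.simps mon.simps emb_simps False if_False fs.scale_one)
      qed
      finally show ?thesis .
    qed
    finally show ?thesis
      using GenBs by simp
  qed
qed

lemma gen_emb: "gen x * emb v \<doteq> emb (gop x v)"
  unfolding cong_def
  by (rule lin_in_subspace[OF lin_sub[OF lin_compose[OF lin_mult_right lin_emb] lin_compose[OF lin_emb lin_gop]] subspace_I])
    (use gen_mon in \<open>simp add: emb_single gop_single cong_def\<close>)

text \<open>Normal words span modulo the relations, by induction on a word, multiplying by one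
  letter on the left.\<close>

lemma cong_nf: "f \<doteq> emb (nf f)"
  unfolding cong_def
proof (rule lin_in_subspace[OF lin_sub[OF lin_id lin_compose[OF lin_emb lin_nf]] subspace_I])
  fix w
  have "single (Word xs) 1 \<doteq> emb (nf (single (Word xs) 1))" for xs
  proof (induction xs)
    case Nil
    have "single (Word []) 1 = (1 :: 'k podles_free)"
      by (simp flip: zero_podles_word_def)
    then show ?case
      by (simp add: nf_def act_one emb_single cong_refl)
  next
    case (Cons x xs)
    let ?f = "single (Word xs) (1 :: 'k)"
    have "gen x * ?f * 1 \<doteq> gen x * emb (nf ?f) * 1"
      by (rule cong_mult[OF Cons])
    also have "\<dots> \<doteq> emb (nf (gen x * ?f))"
      using gen_emb[of x "nf ?f"] by (simp add: nf_def act_mult act_gen)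
    finally show ?case
      by (simp add: single_Word_Cons)
  qed
  then show "single w 1 - emb (nf (single w 1)) \<in> I"
    by (cases w) (simp add: cong_def)
qed

text \<open>Independence (\<open>act_I\<close>) gives one direction, spanning
  (\<open>cong_nf\<close>) the other.\<close>

lemma I_iff: "f \<in> I \<longleftrightarrow> nf f = 0"
  using act_I[of f "ev (0, 0)"] cong_nf[of f] by (auto simp: nf_def[symmetric] cong_def lin_zero[OF lin_emb])

section \<open>Coordinates on the sphere and its automorphisms\<close>

definition crd :: "'k podles_free set \<Rightarrow> nat \<times> int \<Rightarrow>\<^sub>0 'k" where
  "crd C = nf (SOME x. x \<in> C)"

lemma crd_cls: "crd (cls x) = nf x"
proof -
  have "x \<in> cls x"
    using fs.subspace_0[OF subspace_I] by (force simp: cls_set)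
  then have "(SOME y. y \<in> cls x) \<in> cls x"
    by (rule someI)
  then show ?thesis
    by (auto simp: cls_set crd_def lin_add[OF lin_nf] I_iff)
qed

definition vmul :: "(nat \<times> int \<Rightarrow>\<^sub>0 'k) \<Rightarrow> (nat \<times> int \<Rightarrow>\<^sub>0 'k) \<Rightarrow> nat \<times> int \<Rightarrow>\<^sub>0 'k" (infixl "\<star>" 70) where
  "v \<star> w = nf (emb v * emb w)"

lemma nf_cong: "x \<doteq> y \<Longrightarrow> nf x = nf y"
  by (simp add: cong_def I_iff lin_diff[OF lin_nf])

lemma nf_mult: "nf (f * g) = nf f \<star> nf g"
proof -
  have "f * g = 1 * f * g" by simp
  also have "\<dots> \<doteq> 1 * emb (nf f) * g"
    by (rule cong_mult[OF cong_nf])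
  also have "\<dots> = emb (nf f) * g * 1" by simp
  also have "\<dots> \<doteq> emb (nf f) * emb (nf g) * 1"
    by (rule cong_mult[OF cong_nf])
  finally show ?thesis
    by (simp add: vmul_def nf_cong)
qed

text \<open>The rescalings of the generators, covering both \<open>\<sigma>\<close> (with \<open>\<epsilon> = 1\<close>) and \<open>\<tau>\<close> (with \<open>\<epsilon> = -1\<close>).\<close>
fun scl :: "'k \<Rightarrow> 'k \<Rightarrow> podles_gen \<Rightarrow> 'k podles_free" where
  "scl \<epsilon> l GenA = fscale \<epsilon> A" | "scl \<epsilon> l GenB = fscale l B" | "scl \<epsilon> l GenBs = fscale (inverse l) Bs"

definition sg :: "'k \<Rightarrow> 'k \<Rightarrow> (nat \<times> int \<Rightarrow>\<^sub>0 'k) \<Rightarrow> nat \<times> int \<Rightarrow>\<^sub>0 'k" where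
  "sg \<epsilon> l v = nf (subst (scl \<epsilon> l) (emb v))"

definition wt :: "'k \<Rightarrow> 'k \<Rightarrow> nat \<times> int \<Rightarrow> 'k" where
  "wt \<epsilon> l b = \<epsilon> ^ fst b * l powi snd b"

lemma subst_power: "subst g (x ^ n) = subst g x ^ n"
  by (induction n) (simp_all add: subst_simps)

lemma fscale_power: "fscale r x ^ n = fscale (r ^ n) (x ^ n)" for x :: "'k podles_free"
  by (induction n) (simp_all add: free_mult_simps)

lemma sg_single: "sg \<epsilon> l (ev b) = single b (wt \<epsilon> l b)"
proof (cases b)
  case (Pair i j)
  have "subst (scl \<epsilon> l) (mon b) = fscale (wt \<epsilon> l b) (mon b)"
    using Pair by (auto simp: subst_mult subst_power subst_gen fscale_power free_mult_simps wt_def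
        power_int_def mult.commute)
  then show ?thesis
    by (simp add: sg_def emb_single lin_scale[OF lin_nf] nf_mon)
qed

text \<open>Each relation is an eigenvector of the rescaling. In the last two relations the
  quadratic term needs \<open>\<epsilon>\<^sup>2 = 1\<close> and the linear one
  \<open>(c - d) * \<epsilon> = c - d\<close>, which for \<open>\<tau>\<close> is where
  \<open>c = d\<close> enters.\<close>

lemma subst_I:
  assumes "l \<noteq> 0" "\<epsilon>\<^sup>2 = 1" "(c - d) * (\<epsilon> - 1) = 0" "f \<in> I"
  shows "subst (scl \<epsilon> l) f \<in> I"
proof -
  let ?s = "subst (scl \<epsilon> l)"
  have e: "\<epsilon> * \<epsilon> = 1" "(c - d) * \<epsilon> = c - d"
    using assms(2,3) by (auto simp: power2_eq_square algebra_simps)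
  then have e2: "q\<^sup>2 * (c - d) * \<epsilon> = q\<^sup>2 * (c - d)" "inverse l * l = 1" "l * inverse l = 1"
    using assms(1) by (simp_all add: mult.assoc)
  note simps = subst_simps scl.simps free_mult_simps fs.scale_scale e e2 fs.scale_one
  have "podles_rels q c d \<subseteq> {f. ?s f \<in> I}"
  proof
    fix r assume "r \<in> podles_rels q c d"
    then have "\<exists>x. ?s r = fscale x r"
    proof (cases rule: rels_cases)
      case 1
      then have "?s r = fscale (l * \<epsilon>) r"
        by (simp add: subst_simps free_mult_simps fs.scale_right_diff_distrib mult_ac)
      then show ?thesis ..
    next
      case 2
      then have "?s r = fscale (inverse l * \<epsilon>) r"
        by (simp add: subst_simps free_mult_simps fs.scale_right_diff_distrib mult_ac)
      then show ?thesis ..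
    next
      case 3
      then have "?s r = fscale 1 r"
        by (simp only: simps)
      then show ?thesis ..
    next
      case 4
      then have "?s r = fscale 1 r"
        by (simp only: simps)
      then show ?thesis ..
    qed
    then show "r \<in> {f. ?s f \<in> I}"
      using \<open>r \<in> podles_rels q c d\<close> rels_I by (auto simp: fs.subspace_scale[OF subspace_I])
  qed
  then have "I \<subseteq> {f. ?s f \<in> I}"
    using subspace_preimage[OF lin_subst subspace_I] I_left I_right
    by (intro I_least) (auto simp: subst_mult)
  then show ?thesis
    using assms(4) by blast
qed

lemma podles_end_cls:
  assumes "l \<noteq> 0" "\<epsilon>\<^sup>2 = 1" "(c - d) * (\<epsilon> - 1) = 0"
  shows "podles_end q c d (scl \<epsilon> l) (cls x) = cls (subst (scl \<epsilon> l) x)"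
  using quot_map_rep[OF rep_free_alg subspace_I _ rep_free_alg subspace_I, of "subst (scl \<epsilon> l)" "subst (scl \<epsilon> l)" x]
    subst_I[OF assms] fs.subspace_0[OF subspace_I] lin_subst[of "scl \<epsilon> l"]
  by (simp add: podles_end_def cls_def)

lemma nf_subst:
  assumes "l \<noteq> 0" "\<epsilon>\<^sup>2 = 1" "(c - d) * (\<epsilon> - 1) = 0"
  shows "nf (subst (scl \<epsilon> l) f) = sg \<epsilon> l (nf f)"
proof -
  have "subst (scl \<epsilon> l) f - subst (scl \<epsilon> l) (emb (nf f)) \<in> I"
    using subst_I[OF assms] cong_nf[of f] by (simp add: cong_def lin_diff[OF lin_subst, symmetric])
  then show ?thesis
    by (simp add: sg_def I_iff lin_diff[OF lin_nf])
qed

lemma based_podles: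
  assumes "l \<noteq> 0" "\<epsilon>\<^sup>2 = 1" "(c - d) * (\<epsilon> - 1) = 0"
  shows "based_algebra (podles q c d) (podles_end q c d (scl \<epsilon> l)) crd (\<star>) (sg \<epsilon> l) (wt \<epsilon> l)"
proof
  note r = repD[OF rep_podles, simplified]
  have [simp]: "nf (emb v * emb w) = v \<star> w" for v w
    by (simp add: nf_mult nf_emb)
  show "bij_betw crd (carrier (podles q c d)) UNIV"
    unfolding bij_betw_def inj_on_def carrier_podles
  proof (intro conjI ballI impI)
    fix x y assume "x \<in> range cls" "y \<in> range cls" "crd x = crd y"
    moreover from this obtain a b where "x = cls a" "y = cls b"
      by blast
    ultimately show "x = y"
      by (simp add: crd_cls cls_eq I_iff lin_diff[OF lin_nf])
  next
    show "crd ` range cls = UNIV"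
      by (auto simp: image_iff crd_cls) (metis nf_emb)
  qed
  show "lin (\<lambda>v. v \<star> w)" "lin (\<lambda>v. w \<star> v)" for w
    unfolding vmul_def
    by (rule lin_compose[OF lin_nf] lin_compose[OF lin_mult_left lin_emb] lin_compose[OF lin_mult_right lin_emb])+
  show "u \<star> v \<star> w = u \<star> (v \<star> w)" for u v w
    using nf_mult[of "emb u * emb v" "emb w"] nf_mult[of "emb u" "emb v * emb w"] by (simp add: nf_emb mult.assoc)
  show "lin (sg \<epsilon> l)"
    unfolding sg_def[abs_def] by (rule lin_compose[OF lin_nf lin_compose[OF lin_subst lin_emb]])
  show "sg \<epsilon> l (v \<star> w) = sg \<epsilon> l v \<star> sg \<epsilon> l w" for v w
    using nf_subst[OF assms, of "emb v * emb w"] by (simp add: nf_mult nf_emb subst_mult) (simp add: sg_def)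
  show "sg \<epsilon> l (ev b) = single b (wt \<epsilon> l b)" for b
    by (rule sg_single)
qed (auto simp: carrier_podles repD[OF rep_podles] cls_mult podles_end_cls[OF assms] crd_cls
    lin_add[OF lin_nf] lin_scale[OF lin_nf] nf_mult nf_subst[OF assms])

end

section \<open>Generators of the second homology\<close>

context podles_sphere
begin

section \<open>Multiplication of normal words by generators\<close>

abbreviation va where "va \<equiv> ev (Suc 0, 0)"
abbreviation vb where "vb \<equiv> ev (0, 1)"
abbreviation vb' where "vb' \<equiv> ev (0, -1)"
abbreviation v1 where "v1 \<equiv> ev (0, 0)"

lemma vmul_act: "v \<star> w = act (emb v) w"
  using nf_emb[of w] by (simp add: vmul_def nf_def act_mult)

lemma vmul_assoc: "u \<star> v \<star> w = u \<star> (v \<star> w)"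
  using nf_mult[of "emb u * emb v" "emb w"] nf_mult[of "emb u" "emb v * emb w"]
  by (simp add: nf_emb mult.assoc vmul_def)

lemma lin_vmul_left: "lin (\<lambda>v. v \<star> w)" and lin_vmul_right: "lin (\<lambda>w. v \<star> w)"
  unfolding vmul_act by (rule lin_compose[OF lin_act_left lin_emb]) (rule lin_act_right)

lemmas vm_simps = lin_simps[OF lin_vmul_left] lin_simps[OF lin_vmul_right]

lemma emb_gens: "emb va = A" "emb vb = B" "emb vb' = Bs" "emb v1 = 1"
  by (simp_all add: emb_single)

lemma va_mult: "va \<star> v = gop GenA v" and vb_mult: "vb \<star> v = gop GenB v" and vb'_mult: "vb' \<star> v = gop GenBs v"
  by (simp_all add: vmul_act emb_gens act_gen)

lemma v1_mult [simp]: "v1 \<star> v = v"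
  by (simp add: vmul_act emb_gens act_one)

lemma mult_v1 [simp]: "v \<star> v1 = v"
  using nf_emb[of v] by (simp add: vmul_act nf_def)

lemma va_single: "va \<star> ev (i, j) = ev (Suc i, j)"
  by (simp add: va_mult gop_simps)

lemma vb_single: "j \<ge> 0 \<Longrightarrow> vb \<star> ev (i, j) = fscale (q ^ (2 * i)) (ev (i, j + 1))"
  by (simp add: vb_mult gop_simps)

lemma vb'_single: "j \<le> 0 \<Longrightarrow> vb' \<star> ev (i, j) = fscale (inverse q ^ (2 * i)) (ev (i, j - 1))"
  by (simp add: vb'_mult gop_simps)

lemma ev_split: "ev (i, j) = ev (i, 0) \<star> ev (0, j)"
proof (induction i)
  case (Suc i)
  then show ?case
    by (metis va_single vmul_assoc)
qed simp

lemma ev_power_a: "ev (0, j) \<star> va = fscale (q powi (2 * j)) (ev (Suc 0, j))"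
proof (cases "j \<ge> 0")
  case True
  have "ev (0, int n) \<star> va = fscale (q ^ (2 * n)) (ev (Suc 0, int n))" for n
  proof (induction n)
    case (Suc n)
    have "ev (0, int (Suc n)) \<star> va = vb \<star> (ev (0, int n) \<star> va)"
      using vb_single[of "int n" 0] by (simp add: vmul_assoc[symmetric] add.commute)
    then show ?case
      using Suc vb_single[of "int n" "Suc 0"] by (simp add: vm_simps power_add power2_eq_square add.commute del: fscale_single)
  qed simp
  from this[of "nat j"] True show ?thesis
    by (simp add: power_int_def nat_mult_distrib)
next
  case False
  have neg: "ev (0, - int n) \<star> va = fscale (inverse q ^ (2 * n)) (ev (Suc 0, - int n))" for n
  proof (induction n)
    case (Suc n)
    have "ev (0, - int (Suc n)) \<star> va = vb' \<star> (ev (0, - int n) \<star> va)"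
      using vb'_single[of "- int n" 0] by (simp add: vmul_assoc[symmetric] minus_diff_commute)
    then show ?case
      using Suc vb'_single[of "- int n" "Suc 0"] by (simp add: minus_diff_commute vm_simps power_add power2_eq_square del: fscale_single)
  qed simp
  have "nat (- (2 * j)) = 2 * nat (- j)"
    using False by linarith
  then show ?thesis
    using False neg[of "nat (- j)"] by (simp add: power_int_def power_inverse)
qed

lemma single_va: "ev (i, j) \<star> va = fscale (q powi (2 * j)) (ev (Suc i, j))"
proof -
  have "ev (i, j) \<star> va = ev (i, 0) \<star> (ev (0, j) \<star> va)"
    by (simp add: ev_split[of i j] vmul_assoc)
  also have "\<dots> = fscale (q powi (2 * j)) (ev (i, 0) \<star> (va \<star> ev (0, j)))"
    using va_single[of 0 j] by (simp add: ev_power_a vm_simps del: fscale_single)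
  also have "ev (i, 0) \<star> (va \<star> ev (0, j)) = ev (Suc i, j)"
    by (induction i) (metis va_single vmul_assoc v1_mult)+
  finally show ?thesis .
qed

lemma single_vb:
  assumes "j \<ge> 0" shows "ev (i, j) \<star> vb = ev (i, j + 1)"
proof -
  have "ev (0, int n) \<star> vb = ev (0, int n + 1)" for n
  proof (induction n)
    case (Suc n)
    have "ev (0, int (Suc n)) \<star> vb = vb \<star> (ev (0, int n) \<star> vb)"
      using vb_single[of "int n" 0] by (simp add: vmul_assoc[symmetric] add.commute)
    then show ?case
      using Suc vb_single[of "int n + 1" 0] by (simp add: add.commute)
  qed simp
  from this[of "nat j"] show ?thesis
    using assms ev_split[of i j] ev_split[of i "j + 1"] by (simp add: vmul_assoc)
qed

lemma single_vb':
  assumes "j \<le> 0" shows "ev (i, j) \<star> vb' = ev (i, j - 1)"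
proof -
  have "ev (0, - int n) \<star> vb' = ev (0, - int n - 1)" for n
  proof (induction n)
    case (Suc n)
    have "ev (0, - int (Suc n)) \<star> vb' = vb' \<star> (ev (0, - int n) \<star> vb')"
      using vb'_single[of "- int n" 0] by (simp add: vmul_assoc[symmetric] minus_diff_commute)
    then show ?case
      using Suc vb'_single[of "- int n - 1" 0] by (simp add: minus_diff_commute)
  qed simp
  from this[of "nat (- j)"] show ?thesis
    using assms ev_split[of i j] ev_split[of i "j - 1"] by (simp add: vmul_assoc)
qed

lemma vb_va: "vb \<star> va = fscale (q\<^sup>2) (va \<star> vb)"
  using ev_power_a[of 1] va_single[of 0 1] by simp

lemma vb'_va: "vb' \<star> va = fscale (inverse (q\<^sup>2)) (va \<star> vb')"
  using ev_power_a[of "-1"] va_single[of 0 "-1"] by (simp add: power_int_def power_inverse)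

lemma vb'_vb: "vb' \<star> vb = fscale (c * d) v1 + fscale (c - d) va - va \<star> va"
  by (simp add: vb'_mult gop_simps va_single numeral_eq_Suc)

lemma vb_vb': "vb \<star> vb' = fscale (c * d) v1 + fscale (q\<^sup>2 * (c - d)) va - fscale (q ^ 4) (va \<star> va)"
  by (simp add: vb_mult gop_simps va_single numeral_eq_Suc)

end

section \<open>The 2-chains attached to the relations, and their syzygies\<close>

locale twisted_sphere = podles_sphere q c d for q c d :: "'k::field_char_0" +
  fixes \<epsilon> l :: 'k
  assumes l_nonzero: "l \<noteq> 0" and eps_square: "\<epsilon>\<^sup>2 = 1" and eps_cd: "(c - d) * (\<epsilon> - 1) = 0"
    and q_not_root: "n > 0 \<Longrightarrow> q ^ n \<noteq> 1" and cd_nonzero: "c + d \<noteq> 0"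
begin

sublocale tw: based_algebra "podles q c d" "podles_end q c d (scl \<epsilon> l)" crd "(\<star>)" "sg \<epsilon> l" "wt \<epsilon> l"
  by (rule based_podles[OF l_nonzero eps_square eps_cd])

text \<open>A name for \<open>tens\<close> that keeps simplification from expanding tensors into
  basis lists.\<close>

definition t2 where "t2 u v = tens [u, v :: nat \<times> int \<Rightarrow>\<^sub>0 'k]"
definition t3 where "t3 u v w = tens [u, v, w :: nat \<times> int \<Rightarrow>\<^sub>0 'k]"

lemma lin_t3: "lin (\<lambda>u. t3 u v w)" "lin (\<lambda>v. t3 u v w)" "lin (\<lambda>w. t3 u v w)"
  unfolding t3_def by (rule tens_lin_slots)+

lemma lin_t2: "lin (\<lambda>u. t2 u v)" "lin (\<lambda>v. t2 u v)"
  unfolding t2_def by (rule tens_lin_slots)+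

lemmas t3_simps = lin_simps[OF lin_t3(1)] lin_simps[OF lin_t3(2)] lin_simps[OF lin_t3(3)]
lemmas t2_simps = lin_simps[OF lin_t2(1)] lin_simps[OF lin_t2(2)]

lemma t3_single: "t3 (ev a) (ev b) (ev x) = tup [a, b, x]"
  using tens_single[of "[a, b, x]"] by (simp add: t3_def del: tens.simps)

lemma lookup_t2: "lookup (t2 u v) [a, b] = lookup u a * lookup v b"
  unfolding t2_def lookup_tens_Cons by (simp add: lookup_single)

definition la where "la = sg \<epsilon> l va"
definition lb where "lb = sg \<epsilon> l vb"
definition lb' where "lb' = sg \<epsilon> l vb'"

lemma la: "la = fscale \<epsilon> va" and lb: "lb = fscale l vb" and lb': "lb' = fscale (inverse l) vb'"
  by (simp_all add: la_def lb_def lb'_def sg_single wt_def power_int_minus)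

lemma sg_gens: "sg \<epsilon> l va = la" "sg \<epsilon> l vb = lb" "sg \<epsilon> l vb' = lb'" "sg \<epsilon> l v1 = v1"
  by (simp_all add: la_def lb_def lb'_def sg_single wt_def)

lemma d2_t3: "tw.d2 u v w y = t3 (u \<star> v) w y - t3 u (v \<star> w) y + t3 u v (w \<star> y) - t3 (sg \<epsilon> l y \<star> u) v w"
  by (simp only: tw.d2_def t3_def)

lemma D1_t3: "tw.D1 (t3 u v w) = t2 (u \<star> v) w - t2 u (v \<star> w) + t2 (sg \<epsilon> l w \<star> u) v"
  by (simp only: t3_def tw.D1_tens tw.d1_def t2_def)

text \<open>Each quadratic monomial of a relation is replaced by the tensor of its two letters. In
  the boundary the products recombine through the relation, so that only tensors ending in a single
  generator survive (\<open>D1_Phi\<close>); the terms with \<open>v1\<close> in \<open>Phi3\<close>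
  and \<open>Phi4\<close> cancel the constant \<open>c * d\<close>.\<close>

definition Phi1 where "Phi1 n = t3 n vb va - fscale (q\<^sup>2) (t3 n va vb)"
definition Phi2 where "Phi2 n = t3 n va vb' - fscale (q\<^sup>2) (t3 n vb' va)"
definition Phi3 where "Phi3 n = t3 n vb' vb + t3 n va va + fscale (c * d) (t3 n v1 v1)"
definition Phi4 where "Phi4 n = t3 n vb vb' + fscale (q ^ 4) (t3 n va va) + fscale (c * d) (t3 n v1 v1)"

lemma lin_Phi: "lin Phi1" "lin Phi2" "lin Phi3" "lin Phi4"
  unfolding Phi1_def[abs_def] Phi2_def[abs_def] Phi3_def[abs_def] Phi4_def[abs_def]
  by (intro lin_plus lin_sub lin_scaled lin_t3)+

lemmas Phi_simps = lin_simps[OF lin_Phi(1)] lin_simps[OF lin_Phi(2)] lin_simps[OF lin_Phi(3)] lin_simps[OF lin_Phi(4)]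
lemmas Phi_defs = Phi1_def Phi2_def Phi3_def Phi4_def

text \<open>The overlaps \<open>B B\<^sup>* B\<close>, \<open>B\<^sup>* B B\<^sup>*\<close>, \<open>B B\<^sup>* A\<close> and \<open>B\<^sup>* B A\<close> of the defining relations give
  the four relations between the classes \<open>Phi1\<close>, \<dots>, \<open>Phi4\<close> modulo boundaries.\<close>

lemmas syz_simps = Phi_defs d2_t3 sg_gens vb_va vb'_va vb'_vb vb_vb' v1_mult mult_v1 t3_simps

lemma syzygy_BBsB: "Phi3 (n \<star> vb) - Phi4 (lb \<star> n) + fscale (c - d) (Phi1 n) - fscale (q\<^sup>2) (Phi1 (n \<star> va)) - Phi1 (la \<star> n) \<in> tw.Bd"
proof -
  \<comment> \<open>The term \<open>tw.d2 n vb vb' vb\<close> is the overlap itself. The others are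
    chosen to cancel the tensors whose second or third factor is a product of generators, and those
    with \<open>v1\<close> take care of the constant \<open>c * d\<close>.\<close>
  have "Phi3 (n \<star> vb) - Phi4 (lb \<star> n) + fscale (c - d) (Phi1 n) - fscale (q\<^sup>2) (Phi1 (n \<star> va)) - Phi1 (la \<star> n) =
    tw.d2 n vb vb' vb + fscale (q ^ 4) (tw.d2 n va va vb) + tw.d2 n vb va va - fscale (q\<^sup>2) (tw.d2 n va vb va)
      + fscale (c * d) (tw.d2 n vb v1 v1) + fscale (c * d) (tw.d2 n v1 v1 vb)"
    unfolding syz_simps using q_nonzero
    by (intro poly_mapping_eqI) (simp add: lookup_add lookup_minus field_simps power2_eq_square power4_eq_xxxx)
  then show ?thesis
    using tw.d2_Bd tw.subspace_Bd by (simp only: fs.subspace_add fs.subspace_diff fs.subspace_scale)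
qed

lemma syzygy_BsBBs: "Phi4 (n \<star> vb') - Phi3 (lb' \<star> n) - fscale (c - d) (Phi2 n) + Phi2 (n \<star> va) + fscale (q\<^sup>2) (Phi2 (la \<star> n)) \<in> tw.Bd"
proof -
  have "Phi4 (n \<star> vb') - Phi3 (lb' \<star> n) - fscale (c - d) (Phi2 n) + Phi2 (n \<star> va) + fscale (q\<^sup>2) (Phi2 (la \<star> n)) =
    tw.d2 n vb' vb vb' + tw.d2 n va va vb' + fscale (q ^ 4) (tw.d2 n vb' va va) - fscale (q\<^sup>2) (tw.d2 n va vb' va)
      + fscale (c * d) (tw.d2 n v1 v1 vb') + fscale (c * d) (tw.d2 n vb' v1 v1)"
    unfolding syz_simps using q_nonzero
    by (intro poly_mapping_eqI) (simp add: lookup_add lookup_minus field_simps power2_eq_square power4_eq_xxxx)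
  then show ?thesis
    using tw.d2_Bd tw.subspace_Bd by (simp only: fs.subspace_add fs.subspace_diff fs.subspace_scale)
qed

lemma syzygy_BBsA: "Phi2 (n \<star> vb) - Phi1 (lb' \<star> n) + fscale (q\<^sup>2) (Phi4 (la \<star> n)) - fscale (q\<^sup>2) (Phi4 (n \<star> va)) \<in> tw.Bd"
proof -
  have "Phi2 (n \<star> vb) - Phi1 (lb' \<star> n) + fscale (q\<^sup>2) (Phi4 (la \<star> n)) - fscale (q\<^sup>2) (Phi4 (n \<star> va)) =
    tw.d2 n vb va vb' - fscale (q\<^sup>2) (tw.d2 n vb vb' va) - fscale (q\<^sup>2) (tw.d2 n va vb vb') - fscale (q ^ 6) (tw.d2 n va va va)
      - fscale (q\<^sup>2 * (c * d)) (tw.d2 n v1 v1 va) - fscale (q\<^sup>2 * (c * d)) (tw.d2 n va v1 v1)"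
    unfolding syz_simps using q_nonzero
    by (intro poly_mapping_eqI) (simp add: lookup_add lookup_minus field_simps eval_nat_numeral)
  then show ?thesis
    using tw.d2_Bd tw.subspace_Bd by (simp only: fs.subspace_add fs.subspace_diff fs.subspace_scale)
qed

lemma syzygy_BsBA: "Phi3 (la \<star> n) - Phi3 (n \<star> va) - Phi1 (n \<star> vb') + Phi2 (lb \<star> n) \<in> tw.Bd"
proof -
  have "Phi3 (la \<star> n) - Phi3 (n \<star> va) - Phi1 (n \<star> vb') + Phi2 (lb \<star> n) =
    fscale (q\<^sup>2) (tw.d2 n vb' va vb) - tw.d2 n vb' vb va - tw.d2 n va vb' vb - tw.d2 n va va va
      - fscale (c * d) (tw.d2 n v1 v1 va) - fscale (c * d) (tw.d2 n va v1 v1)"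
    unfolding syz_simps using q_nonzero
    by (intro poly_mapping_eqI) (simp add: lookup_add lookup_minus field_simps eval_nat_numeral)
  then show ?thesis
    using tw.d2_Bd tw.subspace_Bd by (simp only: fs.subspace_add fs.subspace_diff fs.subspace_scale)
qed

section \<open>Reduction of all 2-chains modulo boundaries\<close>

text \<open>Each index \<open>t\<close> other than \<open>(0, 0)\<close> stands for a normal word; \<open>lst t\<close> is its last letter
  and \<open>par t\<close> is the rest.\<close>

definition par :: "nat \<times> int \<Rightarrow> nat \<times> int" where
  "par t = (if snd t > 0 then (fst t, snd t - 1) else if snd t < 0 then (fst t, snd t + 1) else (fst t - 1, 0))"

definition lst :: "nat \<times> int \<Rightarrow> nat \<times> int" where
  "lst t = (if snd t > 0 then (0, 1) else if snd t < 0 then (0, -1) else (Suc 0, 0))"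

definition wlen :: "nat \<times> int \<Rightarrow> nat" where
  "wlen t = fst t + nat \<bar>snd t\<bar>"

lemma par_lst: "wlen t > 0 \<Longrightarrow> ev (par t) \<star> ev (lst t) = ev t"
  using single_va[of "fst t - 1" 0] single_vb[of "snd t - 1" "fst t"] single_vb'[of "snd t + 1" "fst t"]
  by (cases t) (auto simp: par_def lst_def wlen_def)

lemma wlen_par: "wlen t > 0 \<Longrightarrow> wlen t = Suc (wlen (par t))"
  by (cases t) (auto simp: par_def wlen_def)

lemma par_lst_inj: "wlen t > 0 \<Longrightarrow> wlen t' > 0 \<Longrightarrow> par t = par t' \<Longrightarrow> lst t = lst t' \<Longrightarrow> t = t'"
  by (cases t; cases t') (auto simp: par_def lst_def wlen_def split: if_splits)

lemma wlen_lst: "wlen (lst t) = 1"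
  by (auto simp: lst_def wlen_def)

text \<open>The last two factors multiply to a normal word \<open>t\<close> of length at least 2.
  The boundary therefore contains \<open>- [b, t]\<close>, whereas the boundaries of
  \<open>Phi1\<close>, ..., \<open>Phi4\<close> end in single generators.\<close>

definition NPL :: "(nat \<times> int) list set" where
  "NPL = {[b, par t, lst t] | b t. wlen t \<ge> 2}"

abbreviation NP :: "((nat \<times> int) list \<Rightarrow>\<^sub>0 'k) set" where
  "NP \<equiv> {z. keys z \<subseteq> NPL}"

text \<open>The summand \<open>t3 n0 v1 v1\<close> is present because the complex is not normalised:
  tensors with a unit entry are not divided out.\<close>

definition gens :: "((nat \<times> int) list \<Rightarrow>\<^sub>0 'k) set" where
  "gens = {w. \<exists>n1 n2 n3 n4 n0. \<exists>z\<in>NP. w - (Phi1 n1 + Phi2 n2 + Phi3 n3 + Phi4 n4 + t3 n0 v1 v1 + z) \<in> tw.Bd}"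

lemma gensI: "z \<in> NP \<Longrightarrow> w - (Phi1 n1 + Phi2 n2 + Phi3 n3 + Phi4 n4 + t3 n0 v1 v1 + z) \<in> tw.Bd \<Longrightarrow> w \<in> gens"
  unfolding gens_def by blast

lemma subspace_gens: "fs.subspace gens"
proof (rule fs.subspaceI)
  show "0 \<in> gens"
    by (rule gensI[of 0 _ 0 0 0 0 0]) (simp_all add: Phi_simps t3_simps fs.subspace_0[OF tw.subspace_Bd])
  show "x + y \<in> gens" if "x \<in> gens" "y \<in> gens" for x y
  proof -
    from that obtain n1 n2 n3 n4 n0 z m1 m2 m3 m4 m0 z' where z: "z \<in> NP" "z' \<in> NP"
      and x: "x - (Phi1 n1 + Phi2 n2 + Phi3 n3 + Phi4 n4 + t3 n0 v1 v1 + z) \<in> tw.Bd"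
      and y: "y - (Phi1 m1 + Phi2 m2 + Phi3 m3 + Phi4 m4 + t3 m0 v1 v1 + z') \<in> tw.Bd"
      unfolding gens_def by blast
    have "z + z' \<in> NP"
      by (rule fs.subspace_add[OF subspace_keys z])
    then show ?thesis
      by (rule gensI[of _ _ "n1 + m1" "n2 + m2" "n3 + m3" "n4 + m4" "n0 + m0"])
        (use fs.subspace_add[OF tw.subspace_Bd x y] in \<open>simp add: Phi_simps t3_simps algebra_simps\<close>)
  qed
  show "fscale r x \<in> gens" if "x \<in> gens" for r x
  proof -
    from that obtain n1 n2 n3 n4 n0 z where z: "z \<in> NP"
      and x: "x - (Phi1 n1 + Phi2 n2 + Phi3 n3 + Phi4 n4 + t3 n0 v1 v1 + z) \<in> tw.Bd"
      unfolding gens_def by blast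
    have "fscale r z \<in> NP"
      by (rule fs.subspace_scale[OF subspace_keys z])
    then show ?thesis
      by (rule gensI[of _ _ "fscale r n1" "fscale r n2" "fscale r n3" "fscale r n4" "fscale r n0"])
        (use fs.subspace_scale[OF tw.subspace_Bd x, of r] in
          \<open>simp add: Phi_simps t3_simps fs.scale_right_distrib fs.scale_right_diff_distrib\<close>)
  qed
qed

lemmas g_add = fs.subspace_add[OF subspace_gens]
lemmas g_diff = fs.subspace_diff[OF subspace_gens]
lemmas g_scale = fs.subspace_scale[OF subspace_gens]

lemma gens_Bd: "w \<in> tw.Bd \<Longrightarrow> w \<in> gens"
  by (rule gensI[of 0 _ 0 0 0 0 0]) (simp_all add: Phi_simps t3_simps)

lemma gens_NP: "w \<in> NP \<Longrightarrow> w \<in> gens"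
  by (rule gensI[of w _ 0 0 0 0 0]) (simp_all add: Phi_simps t3_simps fs.subspace_0[OF tw.subspace_Bd])

lemma gens_unit: "t3 n v1 v1 \<in> gens"
  by (rule gensI[of 0 _ 0 0 0 0 n]) (simp_all add: Phi_simps t3_simps fs.subspace_0[OF tw.subspace_Bd])

lemma gens_Phi: "Phi1 n \<in> gens" "Phi2 n \<in> gens" "Phi3 n \<in> gens" "Phi4 n \<in> gens"
  by (rule gensI[of 0 _ n 0 0 0 0], simp, simp add: Phi_simps t3_simps fs.subspace_0[OF tw.subspace_Bd])
    (rule gensI[of 0 _ 0 n 0 0 0], simp, simp add: Phi_simps t3_simps fs.subspace_0[OF tw.subspace_Bd],
      rule gensI[of 0 _ 0 0 n 0 0], simp, simp add: Phi_simps t3_simps fs.subspace_0[OF tw.subspace_Bd],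
      rule gensI[of 0 _ 0 0 0 n 0], simp, simp add: Phi_simps t3_simps fs.subspace_0[OF tw.subspace_Bd])

lemma gens_d2: "tw.d2 u v w y \<in> gens"
  by (intro gens_Bd tw.d2_Bd)

lemma gens_normal: "wlen t \<ge> 2 \<Longrightarrow> t3 n (ev (par t)) (ev (lst t)) \<in> gens"
proof (intro gens_NP, rule lin_in_subspace[OF lin_t3(1) subspace_keys])
  fix b assume "wlen t \<ge> 2"
  then show "t3 (ev b) (ev (par t)) (ev (lst t)) \<in> NP"
    by (simp add: t3_single NPL_def del: split_paired_Ex) blast
qed

lemma gens_one_right: "t3 n v v1 \<in> gens"
proof -
  have "t3 n v v1 = t3 (n \<star> v) v1 v1 - tw.d2 n v v1 v1"
    by (simp add: d2_t3 sg_gens)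
  then show ?thesis
    by (simp only: g_diff gens_unit gens_d2)
qed

lemma gens_one_left: "t3 n v1 v \<in> gens"
proof -
  have "t3 n v1 v = tw.d2 n v1 v1 v + t3 (sg \<epsilon> l v \<star> n) v1 v1"
    by (simp add: d2_t3)
  then show ?thesis
    by (simp only: g_add gens_unit gens_d2)
qed

lemma gens_a0: "t3 n (ev (i, 0)) va \<in> gens"
proof (cases i)
  case 0
  then show ?thesis by (simp add: gens_one_left)
next
  case (Suc k)
  then show ?thesis
    using gens_normal[of "(Suc i, 0)" n] by (simp add: par_def lst_def wlen_def)
qed

lemma gens_b_pos: "j \<ge> 0 \<Longrightarrow> t3 n (ev (i, j)) vb \<in> gens"
proof (cases "i = 0 \<and> j = 0")
  case True
  then show ?thesis by (simp add: gens_one_left)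
next
  case False
  assume "j \<ge> 0"
  then show ?thesis
    using gens_normal[of "(i, j + 1)" n] False by (auto simp: par_def lst_def wlen_def)
qed

lemma gens_b'_neg: "j \<le> 0 \<Longrightarrow> t3 n (ev (i, j)) vb' \<in> gens"
proof (cases "i = 0 \<and> j = 0")
  case True
  then show ?thesis by (simp add: gens_one_left)
next
  case False
  assume "j \<le> 0"
  then show ?thesis
    using gens_normal[of "(i, j - 1)" n] False by (auto simp: par_def lst_def wlen_def)
qed

lemma gens_ba: "t3 n vb va \<in> gens" and gens_b'a: "t3 n vb' va \<in> gens"
proof -
  have "t3 n vb va = Phi1 n + fscale (q\<^sup>2) (t3 n va vb)"
    by (simp add: Phi1_def)
  then show "t3 n vb va \<in> gens"
    by (simp only: g_add g_scale gens_Phi gens_b_pos order_refl)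
  have "t3 n vb' va = fscale (inverse (q\<^sup>2)) (t3 n va vb' - Phi2 n)"
    using q_nonzero by (simp add: Phi2_def)
  then show "t3 n vb' va \<in> gens"
    by (simp only: g_diff g_scale gens_Phi gens_b'_neg order_refl)
qed

text \<open>For \<open>j \<noteq> 0\<close> the letter \<open>A\<close> does not continue the normal
  word, so it is exchanged with the last letter \<open>B\<close> or \<open>B\<^sup>*\<close> by
  means of \<open>Phi1\<close> or \<open>Phi2\<close>. The word before that letter is shorter,
  whence induction on the absolute value of \<open>j\<close>.\<close>

lemma gens_a: "t3 n (ev (i, j)) va \<in> gens"
proof -
  have "t3 n (ev (i, int m)) va \<in> gens" for n i m
  proof (induction m arbitrary: n i)
    case 0
    then show ?case by (simp add: gens_a0)
  next
    case (Suc m)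
    let ?y = "ev (i, int m)"
    have y: "?y \<star> vb = ev (i, int (Suc m))"
      using single_vb[of "int m" i] by (simp add: add.commute)
    have "t3 n ?y (va \<star> vb) = tw.d2 n ?y va vb - t3 (n \<star> ?y) va vb + fscale (q powi (2 * int m)) (t3 n (ev (Suc i, int m)) vb) + t3 (lb \<star> n) ?y va"
      by (simp only: d2_t3 single_va t3_simps sg_gens) simp
    then have "t3 n ?y (va \<star> vb) \<in> gens"
      using gens_b_pos[of 0 _ "Suc 0"]
      by (simp only: g_add g_diff g_scale gens_d2 gens_b_pos Suc.IH of_nat_0_le_iff order_refl)
    moreover have "t3 n (ev (i, int (Suc m))) va = t3 (n \<star> ?y) vb va + fscale (q\<^sup>2) (t3 n ?y (va \<star> vb)) - t3 (la \<star> n) ?y vb - tw.d2 n ?y vb va"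
      by (simp only: d2_t3 y vb_va t3_simps sg_gens) simp
    ultimately show ?case
      by (simp only: g_add g_diff g_scale gens_d2 gens_b_pos gens_ba of_nat_0_le_iff)
  qed
  moreover have "t3 n (ev (i, - int m)) va \<in> gens" for n i m
  proof (induction m arbitrary: n i)
    case 0
    then show ?case by (simp add: gens_a0)
  next
    case (Suc m)
    let ?y = "ev (i, - int m)"
    have y: "?y \<star> vb' = ev (i, - int (Suc m))"
      using single_vb'[of "- int m" i] by (simp add: minus_diff_commute)
    have m: "- int m \<le> 0"
      by simp
    have "t3 n ?y (va \<star> vb') = tw.d2 n ?y va vb' - t3 (n \<star> ?y) va vb' + fscale (q powi (2 * - int m)) (t3 n (ev (Suc i, - int m)) vb') + t3 (lb' \<star> n) ?y va"
      by (simp only: d2_t3 single_va t3_simps sg_gens) simp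
    then have "t3 n ?y (va \<star> vb') \<in> gens"
      by (simp only: g_add g_diff g_scale gens_d2 gens_b'_neg[OF m] gens_b'_neg[OF order_refl] Suc.IH)
    moreover have "t3 n (ev (i, - int (Suc m))) va = t3 (n \<star> ?y) vb' va + fscale (inverse (q\<^sup>2)) (t3 n ?y (va \<star> vb')) - t3 (la \<star> n) ?y vb' - tw.d2 n ?y vb' va"
      by (simp only: d2_t3 y vb'_va t3_simps sg_gens) simp
    ultimately show ?case
      by (simp only: g_add g_diff g_scale gens_d2 gens_b'_neg[OF m] gens_b'a)
  qed
  ultimately show ?thesis
    by (metis int_cases2)
qed

lemma gens_lin: "(\<And>i j. t3 n (ev (i, j)) x \<in> gens) \<Longrightarrow> t3 n v x \<in> gens"
  by (rule lin_in_subspace[OF lin_t3(2) subspace_gens]) auto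

lemma gens_a2: "t3 n v (va \<star> va) \<in> gens"
proof -
  have "t3 n v (va \<star> va) = tw.d2 n v va va - t3 (n \<star> v) va va + t3 n (v \<star> va) va + t3 (la \<star> n) v va"
    by (simp only: d2_t3 sg_gens) simp
  then show ?thesis
    by (simp only: g_add g_diff gens_d2 gens_a gens_lin)
qed

text \<open>For negative \<open>j\<close> the letter \<open>B\<close> meets a final
  \<open>B\<^sup>*\<close>; splitting that letter off lets \<open>Phi3\<close> contract the
  pair.\<close>

lemma gens_b: "t3 n (ev (i, j)) vb \<in> gens"
proof (cases "j \<ge> 0")
  case False
  let ?y = "ev (i, j + 1)"
  have y: "?y \<star> vb' = ev (i, j)"
    using single_vb'[of "j + 1" i] False by simp
  have "t3 n (ev (i, j)) vb = t3 (n \<star> ?y) vb' vb + t3 n ?y (vb' \<star> vb) - t3 (lb \<star> n) ?y vb' - tw.d2 n ?y vb' vb"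
    by (simp only: d2_t3 y sg_gens) simp
  moreover have "t3 (n \<star> ?y) vb' vb = Phi3 (n \<star> ?y) - t3 (n \<star> ?y) va va - fscale (c * d) (t3 (n \<star> ?y) v1 v1)"
    by (simp add: Phi3_def)
  moreover have "t3 n ?y (vb' \<star> vb) = fscale (c * d) (t3 n ?y v1) + fscale (c - d) (t3 n ?y va) - t3 n ?y (va \<star> va)"
    by (simp only: vb'_vb t3_simps)
  moreover have "t3 (lb \<star> n) ?y vb' \<in> gens"
    using False by (intro gens_b'_neg) simp
  ultimately show ?thesis
    by (simp only: g_add g_diff g_scale gens_d2 gens_Phi gens_a gens_a2 gens_one_right)
qed (rule gens_b_pos)

lemma gens_b': "t3 n (ev (i, j)) vb' \<in> gens"
proof (cases "j \<le> 0")
  case False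
  let ?y = "ev (i, j - 1)"
  have y: "?y \<star> vb = ev (i, j)"
    using single_vb[of "j - 1" i] False by simp
  have "t3 n (ev (i, j)) vb' = t3 (n \<star> ?y) vb vb' + t3 n ?y (vb \<star> vb') - t3 (lb' \<star> n) ?y vb - tw.d2 n ?y vb vb'"
    by (simp only: d2_t3 y sg_gens) simp
  moreover have "t3 (n \<star> ?y) vb vb' = Phi4 (n \<star> ?y) - fscale (q ^ 4) (t3 (n \<star> ?y) va va) - fscale (c * d) (t3 (n \<star> ?y) v1 v1)"
    by (simp add: Phi4_def)
  moreover have "t3 n ?y (vb \<star> vb') = fscale (c * d) (t3 n ?y v1) + fscale (q\<^sup>2 * (c - d)) (t3 n ?y va) - fscale (q ^ 4) (t3 n ?y (va \<star> va))"
    by (simp only: vb_vb' t3_simps)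
  ultimately show ?thesis
    by (simp only: g_add g_diff g_scale gens_d2 gens_Phi gens_a gens_a2 gens_one_right gens_b)
qed (rule gens_b'_neg)

text \<open>The boundary of \<open>(n, v, x, y)\<close> trades a product in the last slot for its
  factors; iterated, it reduces the last slot to generators.\<close>

lemma gens_step:
  assumes "\<And>n v. t3 n v x \<in> gens" "\<And>n v. t3 n v y \<in> gens" shows "t3 n v (x \<star> y) \<in> gens"
proof -
  have "t3 n v (x \<star> y) = tw.d2 n v x y - t3 (n \<star> v) x y + t3 n (v \<star> x) y + t3 (sg \<epsilon> l y \<star> n) v x"
    by (simp add: d2_t3)
  then show ?thesis
    by (simp only: g_add g_diff gens_d2 assms)
qed

lemma gens_all: "t3 n v y \<in> gens"
proof -
  have "t3 n v (ev (0, int m)) \<in> gens" for n v m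
  proof (induction m arbitrary: n v)
    case (Suc m)
    have "vb \<star> ev (0, int m) = ev (0, int (Suc m))"
      using vb_single[of "int m" 0] by (simp add: add.commute)
    then show ?case
      using gens_step[of vb "ev (0, int m)" n v] Suc gens_lin[OF gens_b] by simp
  qed (simp add: gens_one_right)
  moreover have "t3 n v (ev (0, - int m)) \<in> gens" for n v m
  proof (induction m arbitrary: n v)
    case (Suc m)
    have "vb' \<star> ev (0, - int m) = ev (0, - int (Suc m))"
      using vb'_single[of "- int m" 0] by (simp add: minus_diff_commute)
    then show ?case
      using gens_step[of vb' "ev (0, - int m)" n v] Suc gens_lin[OF gens_b'] by simp
  qed (simp add: gens_one_right)
  ultimately have 0: "t3 n v (ev (0, j)) \<in> gens" for n v j
    by (metis int_cases2)
  have ev: "t3 n v (ev (i, j)) \<in> gens" for n v i j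
  proof (induction i arbitrary: n v)
    case (Suc i)
    then show ?case
      using gens_step[of va "ev (i, j)" n v] va_single[of i j] gens_lin[OF gens_a] by simp
  qed (rule 0)
  show ?thesis
    by (rule lin_in_subspace[OF lin_t3(3) subspace_gens]) (auto simp: ev)
qed

lemma gens_total: "keys w \<subseteq> {bs. length bs = 3} \<Longrightarrow> w \<in> gens"
proof -
  assume w: "keys w \<subseteq> {bs. length bs = 3}"
  show "w \<in> gens"
  proof (rule lin_in_subspace[OF lin_id subspace_gens])
    fix bs assume "bs \<in> keys w"
    then have "length bs = 3"
      using w by blast
    then obtain a b x where "bs = [a, b, x]"
      using tw.length3 by blast
    then show "tup bs \<in> gens"
      using gens_all[of "ev a" "ev b" "ev x"] by (simp add: t3_single)
  qed
qed

section \<open>The cycle condition as a system of equations\<close>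

lemma D1_Phi:
  "tw.D1 (Phi1 n) = t2 (n \<star> vb - fscale (q\<^sup>2) (lb \<star> n)) va + t2 (la \<star> n - fscale (q\<^sup>2) (n \<star> va)) vb"
  "tw.D1 (Phi2 n) = t2 (lb' \<star> n - fscale (q\<^sup>2) (n \<star> vb')) va + t2 (n \<star> va - fscale (q\<^sup>2) (la \<star> n)) vb'"
  "tw.D1 (Phi3 n) = t2 (n \<star> va + la \<star> n - fscale (c - d) n) va + t2 (n \<star> vb') vb + t2 (lb \<star> n) vb'"
  "tw.D1 (Phi4 n) = t2 (fscale (q ^ 4) (n \<star> va + la \<star> n) - fscale (q\<^sup>2 * (c - d)) n) va + t2 (lb' \<star> n) vb + t2 (n \<star> vb) vb'"
  using q_nonzero
  by (intro poly_mapping_eqI; simp only: Phi_defs lin_simps[OF tw.lin_D1] D1_t3 vb_va vb'_va vb'_vb vb_vb' t2_simps sg_gens v1_mult mult_v1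
      lookup_add lookup_minus lookup_fscale; simp add: field_simps power2_eq_square power4_eq_xxxx)+

text \<open>Among the keys of \<open>z\<close> take one whose middle factor has maximal length, with
  product \<open>t\<close>. The other two terms in the boundary of any key end in a single letter or
  in a middle factor, both too short to equal \<open>t\<close>, so the coefficient of
  \<open>[b, t]\<close> cannot cancel.\<close>

lemma normal_part_zero:
  assumes z: "z \<in> NP" and D: "\<And>b t. wlen t \<ge> 2 \<Longrightarrow> lookup (tw.D1 z) [b, t] = 0"
  shows "z = 0"
proof (rule ccontr)
  assume "z \<noteq> 0"
  define L where "L k = wlen (k ! 1)" for k :: "(nat \<times> int) list"
  have ne: "keys z \<noteq> {}"
    using \<open>z \<noteq> 0\<close> by simp
  have "Max (L ` keys z) \<in> L ` keys z"
    using ne by (intro Max_in) auto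
  then obtain k0 where k0: "k0 \<in> keys z" and "L k0 = Max (L ` keys z)"
    by auto
  then have max: "L k \<le> L k0" if "k \<in> keys z" for k
    using that by simp
  obtain b t where t: "k0 = [b, par t, lst t]" "wlen t \<ge> 2"
    using k0 z by (auto simp: NPL_def)
  have D1k: "lookup (tw.D1 (tup k)) [b, t] = (if k = k0 then -1 else 0)" if k: "k \<in> keys z" for k
  proof -
    obtain b' t' where t': "k = [b', par t', lst t']" "wlen t' \<ge> 2"
      using k z by (auto simp: NPL_def)
    have "lst t' \<noteq> t"
      using wlen_lst[of t'] t(2) by auto
    moreover have "par t' \<noteq> t"
      using max[OF k] t t' wlen_par[of t'] wlen_par[of t] by (auto simp: L_def)
    moreover have "k = k0 \<longleftrightarrow> b' = b \<and> t' = t"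
      using t t' par_lst_inj[of t' t] by auto
    moreover have "tup k = t3 (ev b') (ev (par t')) (ev (lst t'))"
      by (simp add: t3_single t')
    moreover have "ev (par t') \<star> ev (lst t') = ev t'"
      using t'(2) by (intro par_lst) simp
    ultimately show ?thesis
      by (auto simp: D1_t3 lookup_add lookup_minus lookup_t2 lookup_single when_def)
  qed
  have "tw.D1 z = (\<Sum>k\<in>keys z. fscale (lookup z k) (tw.D1 (tup k)))"
    by (subst poly_mapping_expand[of z], simp only: lin_simps[OF tw.lin_D1])
  then have "lookup (tw.D1 z) [b, t] = (\<Sum>k\<in>keys z. if k = k0 then - lookup z k else 0)"
    by (simp add: lookup_sum D1k if_distrib cong: if_cong)
  then have "lookup z k0 = 0"
    using D[OF t(2), of b] k0 by simp
  then show False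
    using k0 by (simp add: in_keys_iff)
qed

text \<open>The second slot of the boundary separates the summands: words of length at least 2 come
  only from \<open>z\<close>; once \<open>z\<close> is gone, \<open>v1\<close> comes only from
  \<open>n0\<close>, and each of the three generators gives one equation.\<close>

lemma cycle_equations:
  assumes "z \<in> NP" and D: "tw.D1 (Phi1 n1 + Phi2 n2 + Phi3 n3 + Phi4 n4 + t3 n0 v1 v1 + z) = 0"
  shows "z = 0" "n0 = 0"
    and "la \<star> n1 - fscale (q\<^sup>2) (n1 \<star> va) + n3 \<star> vb' + lb' \<star> n4 = 0"
    and "n2 \<star> va - fscale (q\<^sup>2) (la \<star> n2) + lb \<star> n3 + n4 \<star> vb = 0"
    and "n1 \<star> vb - fscale (q\<^sup>2) (lb \<star> n1) + lb' \<star> n2 - fscale (q\<^sup>2) (n2 \<star> vb') + (n3 \<star> va + la \<star> n3 - fscale (c - d) n3)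
      + fscale (q ^ 4) (n4 \<star> va + la \<star> n4) - fscale (q\<^sup>2 * (c - d)) n4 = 0"
proof -
  have eq: "t2 (n1 \<star> vb - fscale (q\<^sup>2) (lb \<star> n1) + lb' \<star> n2 - fscale (q\<^sup>2) (n2 \<star> vb') + (n3 \<star> va + la \<star> n3 - fscale (c - d) n3)
      + fscale (q ^ 4) (n4 \<star> va + la \<star> n4) - fscale (q\<^sup>2 * (c - d)) n4) va
    + t2 (la \<star> n1 - fscale (q\<^sup>2) (n1 \<star> va) + n3 \<star> vb' + lb' \<star> n4) vb
    + t2 (n2 \<star> va - fscale (q\<^sup>2) (la \<star> n2) + lb \<star> n3 + n4 \<star> vb) vb'
    + t2 n0 v1 + tw.D1 z = 0" (is "t2 ?EA va + t2 ?EB vb + t2 ?EBs vb' + _ + _ = 0")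
  proof -
    have "tw.D1 (t3 n0 v1 v1) = t2 n0 v1"
      by (simp add: D1_t3 sg_gens)
    then show ?thesis
      using D by (simp only: lin_simps[OF tw.lin_D1] D1_Phi t2_simps) (simp add: algebra_simps)
  qed
  have l: "lookup ?EA b * lookup va t + lookup ?EB b * lookup vb t
      + lookup ?EBs b * lookup vb' t + lookup n0 b * lookup v1 t
      + lookup (tw.D1 z) [b, t] = 0" for b t
    using arg_cong[OF eq, of "\<lambda>w. lookup w [b, t]"]
    unfolding lookup_add[of "_ + _"] lookup_add[of "t2 _ _" "t2 _ _"] lookup_t2 lookup_zero .
  show z: "z = 0"
  proof (rule normal_part_zero[OF assms(1)])
    fix b t assume "wlen t \<ge> 2"
    then have "t \<noteq> (Suc 0, 0)" "t \<noteq> (0, 1)" "t \<noteq> (0, -1)" "t \<noteq> (0, 0)"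
      by (auto simp: wlen_def)
    then show "lookup (tw.D1 z) [b, t] = 0"
      using l[of b t] by (simp add: lookup_single when_def)
  qed
  then have D1z: "tw.D1 z = 0"
    by (simp add: lin_zero[OF tw.lin_D1])
  show "n0 = 0"
    using l[of _ "(0, 0)"] by (intro poly_mapping_eqI) (simp add: lookup_single when_def D1z)
  show "?EB = 0"
    using l[of _ "(0, 1)"] by (intro poly_mapping_eqI) (simp add: lookup_single when_def D1z)
  show "?EBs = 0"
    using l[of _ "(0, -1)"] by (intro poly_mapping_eqI) (simp add: lookup_single when_def D1z)
  show "?EA = 0"
    using l[of _ "(Suc 0, 0)"] by (intro poly_mapping_eqI) (simp add: lookup_single when_def D1z)
qed

lemma cycle_normal:
  assumes "keys w \<subseteq> {bs. length bs = 3}" "tw.D1 w = 0"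
  obtains n1 n2 n3 n4 where "w - (Phi1 n1 + Phi2 n2 + Phi3 n3 + Phi4 n4) \<in> tw.Bd"
proof -
  from gens_total[OF assms(1)] obtain n1 n2 n3 n4 n0 z where z: "z \<in> NP"
    and w: "w - (Phi1 n1 + Phi2 n2 + Phi3 n3 + Phi4 n4 + t3 n0 v1 v1 + z) \<in> tw.Bd"
    unfolding gens_def by blast
  have "tw.D1 (Phi1 n1 + Phi2 n2 + Phi3 n3 + Phi4 n4 + t3 n0 v1 v1 + z) = 0"
    using tw.D1_Bd[OF w] assms(2) by (simp add: lin_diff[OF tw.lin_D1])
  from cycle_equations(1,2)[OF z this] w show ?thesis
    by (intro that[of n1 n2 n3 n4]) (simp add: t3_simps)
qed

end

section \<open>Solving the cycle equations\<close>

context podles_sphere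
begin

section \<open>The grading by powers of \<open>B\<close>\<close>

lemma lookup_lin:
  assumes "lin L"
  shows "lookup (L v) x = (\<Sum>b\<in>keys v. lookup v b * lookup (L (ev b)) x)"
proof -
  have "L v = (\<Sum>b\<in>keys v. fscale (lookup v b) (L (ev b)))"
    by (subst poly_mapping_expand[of v], simp only: lin_simps[OF assms])
  then show ?thesis
    by (simp add: lookup_sum)
qed

lemma lookup_lin_delta:
  assumes "lin L" "\<And>b. lookup (L (ev b)) x = (if b = b0 then s else 0)"
  shows "lookup (L v) x = s * lookup v b0"
  by (subst lookup_lin[OF assms(1)], simp add: assms(2) if_distrib in_keys_iff mult.commute cong: if_cong)

lemma lookup_mult_va: "lookup (v \<star> va) (Suc i, j) = q powi (2 * j) * lookup v (i, j)"
proof (rule lookup_lin_delta[OF lin_vmul_left])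
  show "lookup (ev b \<star> va) (Suc i, j) = (if b = (i, j) then q powi (2 * j) else 0)" for b
    by (cases b) (simp add: single_va lookup_single when_def)
qed

lemma lookup_va_mult: "lookup (va \<star> v) (Suc i, j) = lookup v (i, j)"
proof -
  have "lookup (va \<star> v) (Suc i, j) = 1 * lookup v (i, j)"
  proof (rule lookup_lin_delta[OF lin_vmul_right])
    show "lookup (va \<star> ev b) (Suc i, j) = (if b = (i, j) then 1 else 0)" for b
      by (cases b) (simp add: va_single lookup_single when_def)
  qed
  then show ?thesis by simp
qed

text \<open>Sums of homogeneous elements of degree in \<open>S\<close>, where \<open>A\<close>,
  \<open>B\<close>, \<open>B\<^sup>*\<close> have degrees 0, 1, -1.\<close>

abbreviation VV :: "int set \<Rightarrow> (nat \<times> int \<Rightarrow>\<^sub>0 'k) set" where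
  "VV S \<equiv> {v. keys v \<subseteq> {b. snd b \<in> S}}"

lemma VV_lookup: "v \<in> VV S \<Longrightarrow> j \<notin> S \<Longrightarrow> lookup v (i, j) = 0"
  by (auto simp: in_keys_iff subset_iff)

lemma VV_mono: "v \<in> VV S \<Longrightarrow> S \<subseteq> S' \<Longrightarrow> v \<in> VV S'"
  by auto

lemma single_VV: "j \<in> S \<Longrightarrow> single (i, j) r \<in> VV S"
  by simp

lemmas VV_add = fs.subspace_add[OF subspace_keys[of "{b. snd b \<in> S}" for S]]
lemmas VV_diff = fs.subspace_diff[OF subspace_keys[of "{b. snd b \<in> S}" for S]]
lemmas VV_scale = fs.subspace_scale[OF subspace_keys[of "{b. snd b \<in> S}" for S]]

lemma lin_VV:
  assumes "lin L" "v \<in> VV S" "\<And>i j. j \<in> S \<Longrightarrow> L (ev (i, j)) \<in> VV S'" shows "L v \<in> VV S'"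
proof (rule lin_in_subspace[OF assms(1) subspace_keys])
  fix b assume "b \<in> keys v"
  then have "snd b \<in> S"
    using assms(2) by blast
  then show "L (ev b) \<in> VV S'"
    using assms(3)[of "snd b" "fst b"] by simp
qed

lemma VV_va: "v \<in> VV S \<Longrightarrow> v \<star> va \<in> VV S" "v \<in> VV S \<Longrightarrow> va \<star> v \<in> VV S"
  by (erule lin_VV[OF lin_vmul_left], simp add: single_va)
    (erule lin_VV[OF lin_vmul_right], simp add: va_single)

lemma single_neg_vb: "j < 0 \<Longrightarrow> ev (i, j) \<star> vb \<in> VV {j + 1}"
proof -
  assume j: "j < 0"
  have "ev (i, j) = ev (i, j + 1) \<star> vb'"
    using single_vb'[of "j + 1" i] j by simp
  then have "ev (i, j) \<star> vb = fscale (c * d) (ev (i, j + 1)) + fscale (c - d) (ev (i, j + 1) \<star> va) - ev (i, j + 1) \<star> va \<star> va"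
    by (simp only: vmul_assoc vb'_vb vm_simps mult_v1)
  then show ?thesis
    by (simp only:) (intro VV_add VV_diff VV_scale VV_va single_VV; simp)
qed

lemma VV_vb: "m \<in> VV {..-1} \<Longrightarrow> m \<star> vb \<in> VV {..0}"
  by (erule lin_VV[OF lin_vmul_left]) (rule VV_mono[OF single_neg_vb], auto)

lemma vb'_single_VV: "vb' \<star> ev (i, j) \<in> VV {j - 1}"
  unfolding vb'_mult gop_single gact.simps fs.scale_one
  by (cases "j \<le> 0") (simp_all only: if_True if_False, (intro VV_add VV_diff VV_scale single_VV; simp)+)

lemma VV_vb': "m \<in> VV {0..} \<Longrightarrow> vb' \<star> m \<in> VV {-1..}"
  by (erule lin_VV[OF lin_vmul_right]) (rule VV_mono[OF vb'_single_VV], auto)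

lemma lookup_mult_vb: "j \<ge> 0 \<Longrightarrow> lookup (v \<star> vb) (i, j + 1) = lookup v (i, j)"
proof -
  assume j: "j \<ge> 0"
  have "lookup (v \<star> vb) (i, j + 1) = 1 * lookup v (i, j)"
  proof (rule lookup_lin_delta[OF lin_vmul_left])
    fix b :: "nat \<times> int"
    obtain i' j' where b: "b = (i', j')" by force
    show "lookup (ev b \<star> vb) (i, j + 1) = (if b = (i, j) then 1 else 0)"
      using j VV_lookup[OF single_neg_vb[of j' i'], of "j + 1" i] unfolding b
      by (cases "j' \<ge> 0") (simp_all add: single_vb lookup_single when_def)
  qed
  then show ?thesis by simp
qed

lemma lookup_vb'_mult: "j \<le> 0 \<Longrightarrow> lookup (vb' \<star> v) (i, j - 1) = inverse q ^ (2 * i) * lookup v (i, j)"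
proof (rule lookup_lin_delta[OF lin_vmul_right])
  fix b :: "nat \<times> int" assume j: "j \<le> 0"
  obtain i' j' where b: "b = (i', j')" by force
  show "lookup (vb' \<star> ev b) (i, j - 1) = (if b = (i, j) then inverse q ^ (2 * i) else 0)"
    using j VV_lookup[OF vb'_single_VV[of i' j'], of "j - 1" i] unfolding b
    by (cases "j' = j") (simp_all add: vb'_single lookup_single when_def)
qed

text \<open>The shape \<open>m \<star> vb\<close> is the one occurring in the syzygies, so
  components of positive degree can be traded away.\<close>

lemma VV_pos_factor:
  assumes "v \<in> VV {1..}" obtains m where "m \<in> VV {0..}" "v = m \<star> vb"
proof
  let ?m = "lin_ext (\<lambda>b. ev (fst b, snd b - 1)) v"
  show "?m \<in> VV {0..}"
    using assms by (intro lin_VV[OF lin_lin_ext assms]) auto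
  show "v = ?m \<star> vb"
    by (rule lin_eq_on_keys[OF lin_id lin_compose[OF lin_vmul_left lin_lin_ext]])
      (use assms single_vb in force)
qed

definition part :: "int set \<Rightarrow> (nat \<times> int \<Rightarrow>\<^sub>0 'k) \<Rightarrow> nat \<times> int \<Rightarrow>\<^sub>0 'k" where
  "part S = lin_ext (\<lambda>b. if snd b \<in> S then ev b else 0)"

lemma lookup_part: "lookup (part S v) b = (if snd b \<in> S then lookup v b else 0)"
proof -
  have "lookup (part S v) b = (if snd b \<in> S then 1 else 0) * lookup v b"
    unfolding part_def by (rule lookup_lin_delta[OF lin_lin_ext]) (auto simp: lookup_single when_def)
  then show ?thesis by simp
qed

lemma part_VV: "part S v \<in> VV S"
  by (auto simp: in_keys_iff lookup_part split: if_splits)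

section \<open>Polynomials in \<open>A\<close> and their commutation with \<open>B\<close> and
  \<open>B\<^sup>*\<close>\<close>

text \<open>In terms of \<open>pA\<close>, the defining relations read \<open>B\<^sup>* B = pA(A)\<close> and
  \<open>B B\<^sup>* = pA(q\<^sup>2 A)\<close>.\<close>

definition pol :: "'k poly \<Rightarrow> nat \<times> int \<Rightarrow>\<^sub>0 'k" where
  "pol f = (\<Sum>i\<le>degree f. single (i, 0) (coeff f i))"

definition pA :: "'k poly" where
  "pA = [:c * d, c - d, -1:]"

text \<open>The twist that a polynomial in \<open>A\<close> picks up when \<open>B\<close> moves
  past it (\<open>vb_pol\<close>).\<close>

definition theta :: "'k poly \<Rightarrow> 'k poly" where
  "theta f = pcompose f [:0, q\<^sup>2:]"

lemma lookup_pol: "lookup (pol f) (i, j) = (if j = 0 then coeff f i else 0)"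
  by (auto simp: pol_def lookup_sum lookup_single when_def if_distrib coeff_eq_0 cong: if_cong)

lemma pol_eqI: "(\<And>i. lookup v (i, 0) = coeff f i) \<Longrightarrow> (\<And>i j. j \<noteq> 0 \<Longrightarrow> lookup v (i, j) = 0) \<Longrightarrow> pol f = v"
  by (intro poly_mapping_eqI) (auto simp: lookup_pol)

lemma pol_simps: "pol (f + g) = pol f + pol g" "pol (f - g) = pol f - pol g" "pol (smult r f) = fscale r (pol f)" "pol 0 = 0" "pol (- f) = - pol f"
  by (auto intro!: pol_eqI simp: lookup_pol lookup_add lookup_minus)

lemma pol_inject: "pol f = pol g \<longleftrightarrow> f = g"
proof
  assume "pol f = pol g"
  then show "f = g"
    by (metis lookup_pol poly_eqI)
qed simp

lemma pol_monom: "pol (monom r i) = single (i, 0) r"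
  by (auto intro!: pol_eqI simp: lookup_single when_def)

lemma pol_VV: "pol f \<in> VV {0}"
  by (auto simp: in_keys_iff lookup_pol split: if_splits)

lemma subspace_range_pol:
  assumes "lin L" shows "fs.subspace (range (\<lambda>f. L (pol f)))"
proof (rule fs.subspaceI)
  show "0 \<in> range (\<lambda>f. L (pol f))"
    by (rule range_eqI[of _ _ 0]) (simp add: pol_simps lin_zero[OF assms])
  show "x + y \<in> range (\<lambda>f. L (pol f))" if xy: "x \<in> range (\<lambda>f. L (pol f))" "y \<in> range (\<lambda>f. L (pol f))" for x y
  proof -
    obtain f g where "x = L (pol f)" "y = L (pol g)"
      using xy by blast
    then show ?thesis
      by (intro range_eqI[of _ _ "f + g"]) (simp add: pol_simps lin_add[OF assms])
  qed
  show "fscale r x \<in> range (\<lambda>f. L (pol f))" if x: "x \<in> range (\<lambda>f. L (pol f))" for r x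
  proof -
    obtain f where "x = L (pol f)"
      using x by blast
    then show ?thesis
      by (intro range_eqI[of _ _ "smult r f"]) (simp add: pol_simps lin_scale[OF assms])
  qed
qed

lemma VV_0_pol:
  assumes "v \<in> VV {0}" obtains f where "v = pol f"
proof -
  have "v \<in> range pol"
  proof (rule lin_in_subspace[OF lin_id subspace_range_pol[OF lin_id]])
    fix b assume "b \<in> keys v"
    then have "b = (fst b, 0)"
      using assms by (cases b) auto
    then show "ev b \<in> range pol"
      using pol_monom[of 1 "fst b"] by (metis rangeI)
  qed
  then show ?thesis
    using that by blast
qed

lemma pol_pCons: "pol (pCons r f) = fscale r v1 + va \<star> pol f"
proof (rule pol_eqI)
  have va0: "lookup (va \<star> v) (0, j) = 0" for v j
    using lookup_lin_delta[OF lin_vmul_right, of va "(0, j)" "(0, 0)" 0 v]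
    by (auto simp: va_single lookup_single when_def)
  show "lookup (fscale r v1 + va \<star> pol f) (i, 0) = coeff (pCons r f) i" for i
    by (cases i) (simp_all add: lookup_add lookup_va_mult lookup_pol va0 lookup_single when_def)
  show "lookup (fscale r v1 + va \<star> pol f) (i, j) = 0" if "j \<noteq> 0" for i j
    using that by (cases i) (simp_all add: lookup_add lookup_va_mult lookup_pol va0 lookup_single when_def)
qed

lemma pol_mult: "pol (f * g) = pol f \<star> pol g"
proof (induction f)
  case (pCons r f)
  show ?case
    unfolding mult_pCons_left pol_simps pol_pCons pCons.IH vm_simps v1_mult vmul_assoc by simp
qed (simp add: pol_simps vm_simps)

lemma theta_simps: "theta (f + g) = theta f + theta g" "theta (f - g) = theta f - theta g"
    "theta (f * g) = theta f * theta g" "theta (smult r f) = smult r (theta f)" "theta 0 = 0"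
    "theta (pCons r f) = pCons r (smult (q\<^sup>2) (theta f))"
  by (simp_all add: theta_def pcompose_add pcompose_diff pcompose_mult pcompose_smult pcompose_pCons)

lemma coeff_theta: "coeff (theta f) i = q ^ (2 * i) * coeff f i"
  by (simp add: theta_def coeff_pcompose_linear power_mult)

lemma vb_pol: "vb \<star> pol f = pol (theta f) \<star> vb"
proof (induction f)
  case (pCons r f)
  have "vb \<star> pol (pCons r f) = fscale r vb + vb \<star> va \<star> pol f"
    by (simp only: pol_pCons vm_simps mult_v1 vmul_assoc)
  also have "\<dots> = fscale r vb + fscale (q\<^sup>2) (va \<star> (vb \<star> pol f))"
    by (simp only: vb_va vm_simps vmul_assoc)
  also have "\<dots> = pol (theta (pCons r f)) \<star> vb"
    unfolding pCons.IH theta_simps pol_pCons pol_simps vm_simps v1_mult vmul_assoc ..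
  finally show ?case .
qed (simp add: pol_simps vm_simps theta_simps)

lemma pol_va: "va = pol [:0, 1:]"
  by (simp add: pol_pCons pol_simps vm_simps)

lemma vb'_vb_pol: "vb' \<star> vb = pol pA" and vb_vb'_pol: "vb \<star> vb' = pol (theta pA)"
proof -
  show "vb' \<star> vb = pol pA"
    unfolding vb'_vb pA_def pol_pCons pol_simps vm_simps mult_v1 by (simp add: fs.scale_minus_left fs.scale_minus_right lin_minus[OF lin_vmul_right] lin_simps[OF lin_vmul_right])
  show "vb \<star> vb' = pol (theta pA)"
    unfolding vb_vb' pA_def theta_simps smult_pCons smult_0_right pol_pCons pol_simps vm_simps mult_v1
    by (simp add: fs.scale_minus_left lin_simps[OF lin_vmul_right] mult.commute power4_eq_xxxx power2_eq_square mult.assoc del: fscale_single)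
qed

lemma vb'_pol: "vb' \<star> pol (theta f) = pol f \<star> vb'"
proof (induction f)
  case (pCons r f)
  have "vb' \<star> pol (theta (pCons r f)) = fscale r vb' + fscale (q\<^sup>2) (vb' \<star> va \<star> pol (theta f))"
    by (simp only: theta_simps pol_simps pol_pCons vm_simps mult_v1 vmul_assoc)
  also have "\<dots> = fscale r vb' + va \<star> (vb' \<star> pol (theta f))"
    using q_nonzero by (simp add: vb'_va vm_simps vmul_assoc del: fscale_single)
  also have "\<dots> = pol (pCons r f) \<star> vb'"
    unfolding pCons.IH pol_pCons vm_simps v1_mult vmul_assoc ..
  finally show ?case .
qed (simp add: pol_simps vm_simps theta_simps)

lemma pol_vb'_va: "pol f \<star> vb' \<star> va = fscale (inverse (q\<^sup>2)) (va \<star> pol f \<star> vb')"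
proof -
  have "pol f \<star> va = va \<star> pol f"
    unfolding pol_va by (simp only: pol_mult[symmetric] mult.commute)
  then show ?thesis
    by (simp only: vmul_assoc vb'_va vm_simps) (simp only: vmul_assoc[symmetric])
qed

lemma scaled_pol_vb'_va: "fscale (q\<^sup>2) (pol f \<star> vb' \<star> va) = va \<star> (pol f \<star> vb')"
  using q_nonzero by (simp add: pol_vb'_va) (simp only: vmul_assoc)

lemma VV_m1_pol:
  assumes "v \<in> VV {-1}" obtains f where "v = pol f \<star> vb'"
proof -
  have "v \<in> range (\<lambda>f. pol f \<star> vb')"
  proof (rule lin_in_subspace[OF lin_id subspace_range_pol[OF lin_vmul_left]])
    fix b assume "b \<in> keys v"
    then have "b = (fst b, -1)"
      using assms by (cases b) auto
    moreover have "ev (fst b, -1) = pol (monom 1 (fst b)) \<star> vb'"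
      using single_vb'[of 0 "fst b"] by (simp add: pol_monom)
    ultimately show "ev b \<in> range (\<lambda>f. pol f \<star> vb')"
      by (metis rangeI)
  qed
  then show ?thesis
    using that by blast
qed

lemma pol_vb'_VV: "pol f \<star> vb' \<in> VV {-1}"
  by (rule lin_VV[OF lin_vmul_left pol_VV]) (simp add: single_vb')

end

context twisted_sphere
begin

section \<open>Reduction of cycles degree by degree\<close>

lemma l_mult: "la \<star> v = fscale \<epsilon> (va \<star> v)" "lb \<star> v = fscale l (vb \<star> v)" "lb' \<star> v = fscale (inverse l) (vb' \<star> v)"
  by (simp_all only: la lb lb' vm_simps)

lemma VV_neg_factor:
  assumes "v \<in> VV {..s}" "s \<le> -1" obtains m where "m \<in> VV {..s + 1}" "v = lb' \<star> m"
proof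
  \<comment> \<open>The factor \<open>l * q ^ (2 * fst b)\<close> undoes the scalar in
    \<open>lb' \<star> ev (i, j + 1)\<close>.\<close>
  let ?m = "lin_ext (\<lambda>b. single (fst b, snd b + 1) (l * q ^ (2 * fst b))) v"
  show "?m \<in> VV {..s + 1}"
    by (rule lin_VV[OF lin_lin_ext assms(1)]) auto
  show "v = lb' \<star> ?m"
  proof (rule lin_eq_on_keys[OF lin_id lin_compose[OF lin_vmul_right lin_lin_ext]])
    fix b assume "b \<in> keys v"
    then obtain i j where b: "b = (i, j)" "j \<le> -1"
      using assms by (cases b) auto
    have "lb' \<star> fscale (l * q ^ (2 * i)) (ev (i, j + 1)) = ev (i, j)"
      using b(2) vb'_single[of "j + 1" i] l_nonzero q_nonzero
      by (simp add: lb' vm_simps power_inverse del: fscale_single) (simp add: field_simps)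
    then show "ev b = lb' \<star> lin_ext (\<lambda>b. single (fst b, snd b + 1) (l * q ^ (2 * fst b))) (ev b)"
      by (simp add: b)
  qed
qed

lemma powi_ne_1: "k \<noteq> 0 \<Longrightarrow> q powi k \<noteq> 1"
  using q_not_root[of "nat k"] q_not_root[of "nat (- k)"]
  by (cases "k > 0") (auto simp: power_int_def power_inverse inverse_eq_1_iff)

text \<open>Squaring removes the sign \<open>\<epsilon>\<close> and leaves
  \<open>q powi (4 * k) = 1\<close>.\<close>

lemma eps_powi: "q powi (2 * k) = \<epsilon> \<Longrightarrow> k = 0 \<and> \<epsilon> = 1"
proof -
  assume k: "q powi (2 * k) = \<epsilon>"
  then have "q powi (4 * k) = 1"
    using eps_square power_int_mult[of q "2 * k" 2] by (simp add: mult.commute)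
  then have "k = 0"
    using powi_ne_1[of "4 * k"] by auto
  then show "k = 0 \<and> \<epsilon> = 1"
    using k by simp
qed

text \<open>The degree bound on \<open>n2\<close> makes \<open>EBs\<close> determine
  \<open>n4\<close> in degrees at least 0, the one on \<open>n1\<close> makes \<open>EB\<close>
  determine it in negative degrees. With this \<open>n4\<close> the terms in \<open>f\<close>
  cancel, and what remains multiplies each coefficient of \<open>n2\<close> or \<open>n1\<close> by
  a scalar depending on its degree. That scalar can vanish only in degree 1 for \<open>n2\<close>,
  which is excluded, and only in degree -1 with \<open>\<epsilon> = 1\<close> for
  \<open>n1\<close>.\<close>

lemma solve_equations:
  assumes n1: "n1 \<in> VV {-1..}" and n2: "n2 \<in> VV {..0}"
    and EB: "la \<star> n1 - fscale (q\<^sup>2) (n1 \<star> va) + pol f \<star> vb' + lb' \<star> n4 = 0"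
    and EBs: "n2 \<star> va - fscale (q\<^sup>2) (la \<star> n2) + lb \<star> pol f + n4 \<star> vb = 0"
  shows "n4 = - fscale l (pol (theta f))" "n2 = 0" "\<epsilon> = 1 \<Longrightarrow> n1 \<in> VV {-1}" "\<epsilon> \<noteq> 1 \<Longrightarrow> n1 = 0"
proof -
  let ?lk = lookup
  have lbf: "lb \<star> pol f = fscale l (pol (theta f)) \<star> vb"
    by (simp only: lb vm_simps vb_pol)
  have pos: "?lk (n4 + fscale l (pol (theta f))) (i, j) = 0" if "j \<ge> 0" for i j
  proof -
    let ?y = "n2 \<star> va - fscale (q\<^sup>2) (la \<star> n2)"
    have "?y \<in> VV {..0}"
      unfolding la vm_simps using n2 by (intro VV_diff VV_scale VV_va)
    then have y: "?lk ?y (i, j + 1) = 0"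
      by (rule VV_lookup) (use that in simp)
    have "(n4 + fscale l (pol (theta f))) \<star> vb = - ?y"
      using EBs unfolding lbf by (simp add: vm_simps algebra_simps eq_neg_iff_add_eq_0)
    then have "?lk (n4 + fscale l (pol (theta f))) (i, j) = ?lk (- ?y) (i, j + 1)"
      using lookup_mult_vb[OF that, of "n4 + fscale l (pol (theta f))" i] by simp
    then show ?thesis
      by (simp only: y lookup_uminus minus_zero)
  qed
  have neg: "?lk n4 (i, j) = 0" if "j \<le> -1" for i j
  proof -
    let ?y = "la \<star> n1 - fscale (q\<^sup>2) (n1 \<star> va) + pol f \<star> vb'"
    have "?y \<in> VV {-1..}"
      unfolding la vm_simps using n1 VV_mono[OF pol_vb'_VV, of "{-1..}" f]
      by (intro VV_add VV_diff VV_scale VV_va) auto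
    then have y: "?lk ?y (i, j - 1) = 0"
      by (rule VV_lookup) (use that in simp)
    have "lb' \<star> n4 = - ?y"
      by (rule add_eq_0_iff[THEN iffD1, OF EB])
    then have "?lk (lb' \<star> n4) (i, j - 1) = 0"
      by (simp only: y lookup_uminus minus_zero)
    then show ?thesis
      using that l_nonzero q_nonzero by (simp add: l_mult lookup_vb'_mult)
  qed
  show n4: "n4 = - fscale l (pol (theta f))"
  proof (rule poly_mapping_eqI)
    fix b :: "nat \<times> int"
    obtain i j where b: "b = (i, j)" by force
    show "?lk n4 b = ?lk (- fscale l (pol (theta f))) b"
      using pos[of j i] neg[of j i] unfolding b
      by (cases "j \<ge> 0") (simp_all add: lookup_add lookup_pol add_eq_0_iff split: if_splits)
  qed
  have E2: "n2 \<star> va - fscale (q\<^sup>2) (la \<star> n2) = 0"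
    using EBs unfolding n4 lbf by (simp add: vm_simps)
  show "n2 = 0"
  proof (rule poly_mapping_eqI)
    fix b :: "nat \<times> int"
    obtain i j where b: "b = (i, j)" by force
    show "?lk n2 b = ?lk 0 b"
    proof (cases "j \<le> 0")
      case True
      have "q powi (2 * j) * ?lk n2 (i, j) - q\<^sup>2 * (\<epsilon> * ?lk n2 (i, j)) = 0"
        using arg_cong[OF E2, of "\<lambda>v. ?lk v (Suc i, j)"]
        by (simp add: lookup_minus l_mult lookup_mult_va lookup_va_mult)
      then have "(q powi (2 * j) - q\<^sup>2 * \<epsilon>) * ?lk n2 (i, j) = 0"
        by (simp add: algebra_simps)
      moreover have "q powi (2 * j) \<noteq> q\<^sup>2 * \<epsilon>"
      proof
        assume "q powi (2 * j) = q\<^sup>2 * \<epsilon>"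
        then have "q powi (2 * (j - 1)) = \<epsilon>"
          using q_nonzero by (simp add: right_diff_distrib power_int_diff)
        then show False
          using eps_powi[of "j - 1"] True by simp
      qed
      ultimately show ?thesis
        by (simp add: b)
    qed (use VV_lookup[OF n2, of j i] b in simp)
  qed
  have "pol f \<star> vb' + lb' \<star> n4 = 0"
    unfolding n4 using l_nonzero by (simp add: l_mult vm_simps vb'_pol)
  then have E1: "la \<star> n1 - fscale (q\<^sup>2) (n1 \<star> va) = 0"
    using EB by (simp add: add.assoc)
  have n1z: "\<epsilon> = 1 \<and> j = -1" if "?lk n1 (i, j) \<noteq> 0" for i j
  proof -
    have "\<epsilon> * ?lk n1 (i, j) - q\<^sup>2 * (q powi (2 * j) * ?lk n1 (i, j)) = 0"
      using arg_cong[OF E1, of "\<lambda>v. ?lk v (Suc i, j)"]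
      by (simp add: lookup_minus l_mult lookup_mult_va lookup_va_mult)
    then have "(\<epsilon> - q\<^sup>2 * q powi (2 * j)) * ?lk n1 (i, j) = 0"
      by (simp add: algebra_simps)
    then have "q powi (2 * (j + 1)) = \<epsilon>"
      using that q_nonzero by (simp add: distrib_left power_int_add mult.commute)
    then show ?thesis
      using eps_powi[of "j + 1"] by simp
  qed
  then show "\<epsilon> = 1 \<Longrightarrow> n1 \<in> VV {-1}"
    by (auto simp: in_keys_iff)
  show "\<epsilon> \<noteq> 1 \<Longrightarrow> n1 = 0"
    using n1z by (intro poly_mapping_eqI) (metis lookup_zero surj_pair)
qed

text \<open>The syzygies serve as moves. \<open>syzygy_BBsB\<close> and \<open>syzygy_BsBBs\<close>
  clear the degrees of \<open>n3\<close> other than 0; then \<open>syzygy_BBsA\<close> clears the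
  positive degrees of the second coefficient and the degrees below -1 of the first.\<close>

lemma cycle_reduced:
  assumes "keys w \<subseteq> {bs. length bs = 3}" "tw.D1 w = 0"
  obtains n1 n2 f n4 where "n1 \<in> VV {-1..}" "n2 \<in> VV {..0}"
    "w - (Phi1 n1 + Phi2 n2 + Phi3 (pol f) + Phi4 n4) \<in> tw.Bd"
proof -
  obtain n1 n2 n3 n4 where w: "w - (Phi1 n1 + Phi2 n2 + Phi3 n3 + Phi4 n4) \<in> tw.Bd"
    using cycle_normal[OF assms] .
  note B_add = fs.subspace_add[OF tw.subspace_Bd] and B_diff = fs.subspace_diff[OF tw.subspace_Bd]
  obtain m where m: "part {1..} n3 = m \<star> vb"
    using VV_pos_factor[OF part_VV] by blast
  obtain m' where m': "part {..-1} n3 = lb' \<star> m'"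
    by (rule VV_neg_factor[OF part_VV[of "{..-1}" n3] order_refl])
  obtain f where f: "part {0} n3 = pol f"
    using VV_0_pol[OF part_VV] by blast
  have n3: "n3 = m \<star> vb + pol f + lb' \<star> m'"
    unfolding m[symmetric] m'[symmetric] f[symmetric]
    by (intro poly_mapping_eqI) (auto simp: lookup_add lookup_part)
  \<comment> \<open>The new coefficients after adding the first syzygy at \<open>m\<close> and
    subtracting the second at \<open>m'\<close>.\<close>
  define k1 where "k1 = n1 - fscale (c - d) m + fscale (q\<^sup>2) (m \<star> va) + la \<star> m"
  define k2 where "k2 = n2 - fscale (c - d) m' + m' \<star> va + fscale (q\<^sup>2) (la \<star> m')"
  define k4 where "k4 = n4 + lb \<star> m + m' \<star> vb'"
  have "w - (Phi1 k1 + Phi2 k2 + Phi3 (pol f) + Phi4 k4) \<in> tw.Bd"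
    using B_diff[OF B_add[OF w syzygy_BBsB[of m]] syzygy_BsBBs[of m']]
    unfolding n3 k1_def k2_def k4_def Phi_simps by (simp add: algebra_simps)
  moreover obtain p where p: "p \<in> VV {0..}" "part {1..} k2 = p \<star> vb"
    using VV_pos_factor[OF part_VV] by blast
  moreover have "\<exists>p'\<in>VV {..-2 + 1}. part {..-2} k1 = lb' \<star> p'"
    by (rule VV_neg_factor[OF part_VV[of "{..-2}" k1]]) auto
  then obtain p' where p': "p' \<in> VV {..-1}" "part {..-2} k1 = lb' \<star> p'"
    by auto
  \<comment> \<open>One move at \<open>p - p'\<close> serves both purposes: its side effect
    \<open>lb' \<star> p\<close> on the first coefficient has degrees at least -1, and
    \<open>p' \<star> vb\<close> on the second has degrees at most 0.\<close>
  ultimately have *: "w - (Phi1 (k1 + lb' \<star> (p - p')) + Phi2 (k2 - (p - p') \<star> vb) + Phi3 (pol f)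
      + Phi4 (k4 - fscale (q\<^sup>2) (la \<star> (p - p')) + fscale (q\<^sup>2) ((p - p') \<star> va))) \<in> tw.Bd"
    using B_add[OF _ syzygy_BBsA[of "p - p'"], of "w - (Phi1 k1 + Phi2 k2 + Phi3 (pol f) + Phi4 k4)"]
    unfolding Phi_simps by (simp add: algebra_simps)
  have "k1 + lb' \<star> (p - p') = part {-1..} k1 + fscale (inverse l) (vb' \<star> p)"
  proof -
    have "k1 = part {-1..} k1 + part {..-2} k1"
      by (intro poly_mapping_eqI) (auto simp: lookup_add lookup_part)
    then have "k1 - lb' \<star> p' = part {-1..} k1"
      unfolding p'(2) by (metis add_diff_cancel_right')
    moreover have "k1 + lb' \<star> (p - p') = (k1 - lb' \<star> p') + lb' \<star> p"
      by (simp add: vm_simps)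
    ultimately show ?thesis
      by (simp only: lb' vm_simps)
  qed
  moreover have "k2 - (p - p') \<star> vb = part {..0} k2 + p' \<star> vb"
  proof -
    have "k2 = part {..0} k2 + part {1..} k2"
      by (intro poly_mapping_eqI) (auto simp: lookup_add lookup_part)
    then have "k2 - p \<star> vb = part {..0} k2"
      unfolding p(2) by (metis add_diff_cancel_right')
    moreover have "k2 - (p - p') \<star> vb = (k2 - p \<star> vb) + p' \<star> vb"
      by (simp add: vm_simps)
    ultimately show ?thesis
      by simp
  qed
  ultimately show ?thesis
    using that[OF _ _ *] VV_vb[OF p'(1)] VV_vb'[OF p(1)] part_VV VV_add VV_scale by metis
qed

lemma equations_of_cycle:
  assumes "tw.D1 w = 0" "w - (Phi1 n1 + Phi2 n2 + Phi3 n3 + Phi4 n4) \<in> tw.Bd"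
  shows "la \<star> n1 - fscale (q\<^sup>2) (n1 \<star> va) + n3 \<star> vb' + lb' \<star> n4 = 0"
    and "n2 \<star> va - fscale (q\<^sup>2) (la \<star> n2) + lb \<star> n3 + n4 \<star> vb = 0"
    and "n1 \<star> vb - fscale (q\<^sup>2) (lb \<star> n1) + lb' \<star> n2 - fscale (q\<^sup>2) (n2 \<star> vb') + (n3 \<star> va + la \<star> n3 - fscale (c - d) n3)
      + fscale (q ^ 4) (n4 \<star> va + la \<star> n4) - fscale (q\<^sup>2 * (c - d)) n4 = 0"
proof -
  have "tw.D1 (Phi1 n1 + Phi2 n2 + Phi3 n3 + Phi4 n4 + t3 0 v1 v1 + 0) = 0"
    using tw.D1_Bd[OF assms(2)] assms(1) by (simp add: lin_diff[OF tw.lin_D1] t3_simps)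
  from cycle_equations(3-5)[OF _ this]
  show "la \<star> n1 - fscale (q\<^sup>2) (n1 \<star> va) + n3 \<star> vb' + lb' \<star> n4 = 0"
    and "n2 \<star> va - fscale (q\<^sup>2) (la \<star> n2) + lb \<star> n3 + n4 \<star> vb = 0"
    and "n1 \<star> vb - fscale (q\<^sup>2) (lb \<star> n1) + lb' \<star> n2 - fscale (q\<^sup>2) (n2 \<star> vb') + (n3 \<star> va + la \<star> n3 - fscale (c - d) n3)
      + fscale (q ^ 4) (n4 \<star> va + la \<star> n4) - fscale (q\<^sup>2 * (c - d)) n4 = 0"
    by simp_all
qed

section \<open>Cycles for \<open>\<sigma>\<close>, that is, \<open>\<epsilon> = 1\<close>\<close>

definition pA' :: "'k poly" where
  "pA' = [:c - d, -2:]"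

text \<open>The constant is the discriminant of \<open>pA\<close>, whose roots are \<open>c\<close>
  and \<open>- d\<close>.\<close>

lemma bezout_pA: "pA' * pA' + smult 4 pA = [:(c + d)\<^sup>2:]"
  by (simp add: pA_def pA'_def power2_eq_square algebra_simps)

text \<open>The shape that \<open>solve_equations\<close> leaves when \<open>\<epsilon> = 1\<close>:
  \<open>f1\<close> and \<open>f\<close> are still free, while \<open>f\<close> dictates the
  coefficient of \<open>Phi4\<close>.\<close>

definition Phi :: "'k poly \<Rightarrow> 'k poly \<Rightarrow> (nat \<times> int) list \<Rightarrow>\<^sub>0 'k" where
  "Phi f1 f = Phi1 (pol f1 \<star> vb') + Phi3 (pol f) - Phi4 (fscale l (pol (theta f)))"

lemma coeff_double: "coeff (2 * h) i = 2 * coeff h i" "coeff (h * 2) i = 2 * coeff h i" for h :: "'k poly"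
  by (metis coeff_add mult_2) (metis coeff_add mult_2 mult_2_right)

text \<open>The components ending in \<open>B\<close> and \<open>B\<^sup>*\<close> cancel by the
  choice of coefficients. The \<open>A\<close> component groups into one polynomial and its twist by
  \<open>theta\<close>.\<close>

lemma D1_Phi_sigma:
  assumes "\<epsilon> = 1"
  shows "tw.D1 (Phi f1 f) =
    t2 (pol (f1 * pA - pA' * f - smult (q\<^sup>2 * l) (theta (f1 * pA - pA' * f)))) va"
proof -
  have x: "pol h \<star> va = pol ([:0, 1:] * h)" "va \<star> pol h = pol ([:0, 1:] * h)" for h
    unfolding pol_va pol_mult[symmetric] by (simp_all only: mult.commute)
  have la': "la = va"
    by (subst la, subst assms) simp
  have "pol f1 \<star> vb' \<star> vb = pol (f1 * pA)"
    by (simp only: vmul_assoc vb'_vb_pol pol_mult)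
  moreover have "lb \<star> (pol f1 \<star> vb') = fscale l (pol (theta (f1 * pA)))"
    by (simp only: lb vm_simps vmul_assoc[symmetric] vb_pol theta_simps pol_mult) (simp only: vmul_assoc vb_vb'_pol)
  moreover have "la \<star> (pol f1 \<star> vb') - fscale (q\<^sup>2) (pol f1 \<star> vb' \<star> va) = 0"
    by (simp only: la' scaled_pol_vb'_va diff_self)
  moreover have "lb' \<star> fscale l (pol (theta f)) = pol f \<star> vb'"
    using l_nonzero by (simp add: l_mult vm_simps vb'_pol)
  moreover have "fscale l (pol (theta f)) \<star> vb = lb \<star> pol f"
    by (simp only: lb vm_simps vb_pol)
  ultimately have "tw.D1 (Phi f1 f) = t2 (pol (f1 * pA) - fscale (q\<^sup>2) (fscale l (pol (theta (f1 * pA)))) +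
      (pol f \<star> va + va \<star> pol f - fscale (c - d) (pol f)) - (fscale (q ^ 4) (fscale l (pol (theta f)) \<star> va + va \<star> fscale l (pol (theta f))) -
        fscale (q\<^sup>2 * (c - d)) (fscale l (pol (theta f))))) va"
    by (simp only: Phi_def lin_simps[OF tw.lin_D1] D1_Phi la' t2_simps) (simp add: algebra_simps)
  also have "pol (f1 * pA) - fscale (q\<^sup>2) (fscale l (pol (theta (f1 * pA)))) +
      (pol f \<star> va + va \<star> pol f - fscale (c - d) (pol f)) - (fscale (q ^ 4) (fscale l (pol (theta f)) \<star> va + va \<star> fscale l (pol (theta f))) -
        fscale (q\<^sup>2 * (c - d)) (fscale l (pol (theta f)))) =
    pol (f1 * pA - smult (q\<^sup>2) (smult l (theta (f1 * pA))) + ([:0, 1:] * f + [:0, 1:] * f - smult (c - d) f)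
      - (smult (q ^ 4) (smult l ([:0, 1:] * theta f) + smult l ([:0, 1:] * theta f)) - smult (q\<^sup>2 * (c - d)) (smult l (theta f))))"
    by (simp only: pol_simps vm_simps x)
  also have "f1 * pA - smult (q\<^sup>2) (smult l (theta (f1 * pA))) + ([:0, 1:] * f + [:0, 1:] * f - smult (c - d) f)
      - (smult (q ^ 4) (smult l ([:0, 1:] * theta f) + smult l ([:0, 1:] * theta f)) - smult (q\<^sup>2 * (c - d)) (smult l (theta f)))
    = f1 * pA - pA' * f - smult (q\<^sup>2 * l) (theta (f1 * pA - pA' * f))"
    by (rule poly_eqI)
      (simp add: coeff_double theta_simps pA'_def coeff_pCons coeff_theta algebra_simps power4_eq_xxxx power2_eq_square split: nat.split)
  finally show ?thesis .
qed

text \<open>Coprimality turns the assumption into \<open>f = pA * h\<close> and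
  \<open>f1 = pA' * h\<close>, and the chain is then exactly \<open>syzygy_BBsB\<close> at
  \<open>pol h \<star> vb'\<close>.\<close>

lemma Phi_boundary:
  assumes "\<epsilon> = 1" "f1 * pA = pA' * f" shows "Phi f1 f \<in> tw.Bd"
proof -
  \<comment> \<open>The Bezout identity times \<open>f\<close>, with \<open>pA' * f\<close> replaced
    by \<open>f1 * pA\<close>, exhibits \<open>pA\<close> as a factor; \<open>h\<close> is the
    cofactor.\<close>
  define h where "h = smult (inverse ((c + d)\<^sup>2)) (pA' * f1 + smult 4 f)"
  have "smult ((c + d)\<^sup>2) f = [:(c + d)\<^sup>2:] * f"
    by simp
  also have "\<dots> = pA' * (pA' * f) + smult 4 (pA * f)"
    unfolding bezout_pA[symmetric] by (simp add: algebra_simps)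
  also have "\<dots> = pA * (pA' * f1 + smult 4 f)"
    unfolding assms(2)[symmetric] by (simp add: algebra_simps)
  also have "\<dots> = smult ((c + d)\<^sup>2) (pA * h)"
    using cd_nonzero by (simp add: h_def)
  finally have f: "f = pA * h"
    using cd_nonzero by (metis power_eq_0_iff smult_eq_iff zero_power2)
  have "pA \<noteq> 0"
    by (simp add: pA_def)
  then have f1: "f1 = pA' * h"
    using assms(2) unfolding f by (metis mult.commute mult.left_commute mult_cancel_left)
  let ?n = "pol h \<star> vb'"
  have "?n \<star> vb = pol f"
    by (simp only: f vmul_assoc vb'_vb_pol pol_mult[symmetric] mult.commute)
  moreover have "lb \<star> ?n = fscale l (pol (theta f))"
    by (simp only: f lb vm_simps vmul_assoc[symmetric] vb_pol theta_simps)
      (simp only: vmul_assoc vb_vb'_pol pol_mult[symmetric] mult.commute)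
  moreover have "fscale (c - d) (Phi1 ?n) - fscale (q\<^sup>2) (Phi1 (?n \<star> va)) - Phi1 (la \<star> ?n) = Phi1 (pol f1 \<star> vb')"
  proof -
    have la': "la = va"
      by (subst la, subst assms(1)) simp
    have "fscale (c - d) ?n - fscale (q\<^sup>2) (?n \<star> va) - la \<star> ?n = (fscale (c - d) (pol h) - va \<star> pol h - va \<star> pol h) \<star> vb'"
      unfolding la' scaled_pol_vb'_va by (simp only: vm_simps vmul_assoc)
    also have "fscale (c - d) (pol h) - va \<star> pol h - va \<star> pol h = pol f1"
      unfolding pol_va f1 pol_mult[symmetric] pol_simps[symmetric]
      unfolding pol_inject by (simp add: pA'_def poly_eq_iff coeff_pCons coeff_double split: nat.split)
    finally show ?thesis
      by (simp only: Phi_simps[symmetric])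
  qed
  ultimately show ?thesis
    using syzygy_BBsB[of ?n] by (simp add: Phi_def algebra_simps)
qed

text \<open>With \<open>G = f1 * pA - pA' * f\<close>, coefficient \<open>i\<close> of the remaining
  equation is \<open>(1 - l * q ^ (2 * i + 2)) * coeff G i = 0\<close>.\<close>

lemma sigma_cycle:
  assumes "\<epsilon> = 1" "keys w \<subseteq> {bs. length bs = 3}" "tw.D1 w = 0"
  obtains f1 f where "w - Phi f1 f \<in> tw.Bd"
    "\<And>i. l \<noteq> q powi (- (2 * int i + 2)) \<Longrightarrow> coeff (f1 * pA - pA' * f) i = 0"
proof -
  obtain n1 n2 f n4 where n: "n1 \<in> VV {-1..}" "n2 \<in> VV {..0}"
    and w: "w - (Phi1 n1 + Phi2 n2 + Phi3 (pol f) + Phi4 n4) \<in> tw.Bd"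
    using cycle_reduced[OF assms(2,3)] .
  note s = solve_equations[OF n equations_of_cycle(1,2)[OF assms(3) w]]
  obtain f1 where f1: "n1 = pol f1 \<star> vb'"
    using VV_m1_pol[OF s(3)[OF assms(1)]] by blast
  have w': "w - Phi f1 f \<in> tw.Bd"
    using w by (simp add: s(1,2) f1 Phi_def Phi_simps)
  moreover have "coeff (f1 * pA - pA' * f) i = 0" if i: "l \<noteq> q powi (- (2 * int i + 2))" for i
  proof -
    let ?G = "f1 * pA - pA' * f"
    have "tw.D1 (Phi f1 f) = 0"
      using tw.D1_Bd[OF w'] assms(3) by (simp add: lin_diff[OF tw.lin_D1])
    then have "t2 (pol (?G - smult (q\<^sup>2 * l) (theta ?G))) va = 0"
      by (simp only: D1_Phi_sigma[OF assms(1)])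
    then have "lookup (t2 (pol (?G - smult (q\<^sup>2 * l) (theta ?G))) va) [(i, 0), (Suc 0, 0)] = 0"
      by (simp only: lookup_zero)
    then have "coeff ?G i * (1 - q\<^sup>2 * l * q ^ (2 * i)) = 0"
      unfolding lookup_t2 lookup_pol by (simp add: coeff_theta algebra_simps)
    moreover have "q\<^sup>2 * l * q ^ (2 * i) \<noteq> 1"
    proof
      assume "q\<^sup>2 * l * q ^ (2 * i) = 1"
      then have "l * q powi (2 * int i + 2) = 1"
        using q_nonzero by (simp add: power_int_add power_int_mult mult_ac power_mult)
      then have "inverse (q powi (2 * int i + 2)) = l"
        by (intro inverse_unique) (simp only: mult.commute)
      then show False
        using i unfolding power_int_minus by blast
    qed
    ultimately show ?thesis
      by simp
  qed
  ultimately show ?thesis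
    using that by blast
qed

lemma sigma_trivial:
  assumes "\<epsilon> = 1" "\<And>i::nat. l \<noteq> q powi (- (2 * int i + 2))"
    and "keys w \<subseteq> {bs. length bs = 3}" "tw.D1 w = 0"
  shows "w \<in> tw.Bd"
proof -
  obtain f1 f where w: "w - Phi f1 f \<in> tw.Bd" and "\<And>i. coeff (f1 * pA - pA' * f) i = 0"
    using sigma_cycle[OF assms(1,3,4)] assms(2) by metis
  then have "f1 * pA = pA' * f"
    by (simp add: poly_eq_iff)
  from fs.subspace_add[OF tw.subspace_Bd w Phi_boundary[OF assms(1) this]] show ?thesis
    by simp
qed

text \<open>Here \<open>pA\<close> is \<open>c\<^sup>2 - A\<^sup>2\<close>, and the sign of
  \<open>\<epsilon>\<close> makes \<open>syzygy_BsBA\<close> change the third coefficient by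
  multiples of \<open>2 * A\<close>. As \<open>pA\<close> and \<open>A\<close> are coprime, this and
  \<open>syzygy_BBsB\<close> remove \<open>f\<close>.\<close>

lemma tau_trivial:
  assumes "\<epsilon> = -1" and w3: "keys w \<subseteq> {bs. length bs = 3}" and w0: "tw.D1 w = 0"
  shows "w \<in> tw.Bd"
proof -
  have [simp]: "\<epsilon> \<noteq> 1"
    using assms(1) by simp
  have cd: "c = d"
    using eps_cd by simp
  then have c0: "c \<noteq> 0"
    using cd_nonzero by auto
  obtain n1 n2 f n4 where n: "n1 \<in> VV {-1..}" "n2 \<in> VV {..0}"
    and w: "w - (Phi1 n1 + Phi2 n2 + Phi3 (pol f) + Phi4 n4) \<in> tw.Bd"
    using cycle_reduced[OF w3 w0] .
  note s = solve_equations[OF n equations_of_cycle(1,2)[OF w0 w]]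
  \<comment> \<open>\<open>g\<close> and \<open>u\<close> solve
    \<open>f = pA * g - 2 * A * u\<close>, by \<open>c\<^sup>2 = pA + A\<^sup>2\<close>.\<close>
  define g where "g = smult (inverse (c\<^sup>2)) f"
  define u where "u = smult (- 1 / 2) ([:0, 1:] * g)"
  define k where "k = pol g \<star> vb'"
  \<comment> \<open>Chosen so that \<open>m \<star> vb = lb \<star> pol u\<close>:
    \<open>syzygy_BBsA\<close> at \<open>m\<close> then cancels the \<open>Phi2\<close> term that
    \<open>syzygy_BsBA\<close> introduces.\<close>
  define m where "m = fscale l (pol (theta u))"
  have "f = pA * g - smult 2 ([:0, 1:] * u)"
    unfolding g_def u_def pA_def using c0
    by (intro poly_eqI) (simp add: cd coeff_pCons power2_eq_square field_simps split: nat.split)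
  then have "pol f = k \<star> vb - fscale 2 (va \<star> pol u)"
    unfolding pol_va k_def vmul_assoc vb'_vb_pol by (simp only: pol_simps pol_mult[symmetric] mult.commute[of g])
  moreover have "la \<star> pol u - pol u \<star> va = - fscale 2 (va \<star> pol u)"
  proof -
    have "pol u \<star> va = va \<star> pol u"
      unfolding pol_va by (simp only: pol_mult[symmetric] mult.commute)
    moreover have "la = - va"
      by (subst la, subst assms(1)) (simp add: single_uminus)
    ultimately show ?thesis
      by (simp add: vm_simps fs.scale_left_distrib[of 1 1, simplified])
  qed
  ultimately have f: "pol f = k \<star> vb + la \<star> pol u - pol u \<star> va"
    by simp
  have m: "lb \<star> pol u = m \<star> vb"
    by (simp only: m_def lb vm_simps vb_pol)
  let ?n1 = "fscale (q\<^sup>2) (k \<star> va) + la \<star> k + pol u \<star> vb' - lb' \<star> m"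
  let ?n4 = "n4 + lb \<star> k + fscale (q\<^sup>2) (la \<star> m) - fscale (q\<^sup>2) (m \<star> va)"
  have eq: "w - (Phi1 ?n1 + Phi2 0 + Phi3 (pol 0) + Phi4 ?n4) =
      (w - (Phi1 n1 + Phi2 n2 + Phi3 (pol f) + Phi4 n4))
      + (Phi3 (k \<star> vb) - Phi4 (lb \<star> k) + fscale (c - d) (Phi1 k) - fscale (q\<^sup>2) (Phi1 (k \<star> va)) - Phi1 (la \<star> k))
      + (Phi3 (la \<star> pol u) - Phi3 (pol u \<star> va) - Phi1 (pol u \<star> vb') + Phi2 (lb \<star> pol u))
      - (Phi2 (m \<star> vb) - Phi1 (lb' \<star> m) + fscale (q\<^sup>2) (Phi4 (la \<star> m)) - fscale (q\<^sup>2) (Phi4 (m \<star> va)))"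
    unfolding f m s(2) s(4)[OF \<open>\<epsilon> \<noteq> 1\<close>] Phi_simps pol_simps by (simp add: cd)
  have w': "w - (Phi1 ?n1 + Phi2 0 + Phi3 (pol 0) + Phi4 ?n4) \<in> tw.Bd"
    unfolding eq by (rule fs.subspace_diff[OF tw.subspace_Bd fs.subspace_add[OF tw.subspace_Bd fs.subspace_add[OF tw.subspace_Bd w syzygy_BBsB] syzygy_BsBA] syzygy_BBsA])
  have n1': "?n1 \<in> VV {-1..}"
  proof -
    have "k \<in> VV {-1..}" "pol u \<star> vb' \<in> VV {-1..}" "m \<in> VV {0..}"
      unfolding k_def m_def
      by (rule VV_mono[OF pol_vb'_VV], simp, rule VV_mono[OF pol_vb'_VV], simp, intro VV_scale, rule VV_mono[OF pol_VV], simp)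
    then show ?thesis
      unfolding l_mult by (intro VV_add VV_diff VV_scale VV_va VV_vb')
  qed
  have z: "0 \<in> VV {..0}"
    by simp
  \<comment> \<open>In the second application the third coefficient is 0, so the fourth, determined
    by it, and the first vanish as well.\<close>
  note s' = solve_equations[OF n1' z equations_of_cycle(1,2)[OF w0 w']]
  have "w - (Phi1 0 + Phi2 0 + Phi3 (pol 0) + Phi4 (- fscale l (pol (theta 0)))) \<in> tw.Bd"
    using w' unfolding s'(1) s'(4)[OF \<open>\<epsilon> \<noteq> 1\<close>] .
  then show ?thesis
    by (simp add: theta_simps pol_simps Phi_simps)
qed

end

section \<open>A twisted cocycle detecting the second homology\<close>

context podles_sphere
begin

text \<open>The quantum half-plane: \<open>(i, j)\<close> stands for \<open>x\<^sup>i y\<^sup>j\<close>, where \<open>y\<close> is invertible and \<open>y x = q\<^sup>2 x y\<close>.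
  The Podles sphere is mapped to it by \<open>A \<mapsto> x\<close>, \<open>B \<mapsto> y\<close>, \<open>B\<^sup>* \<mapsto> pA(x) y\<^sup>-\<^sup>1\<close>.\<close>

definition lmul :: "(nat \<times> int \<Rightarrow>\<^sub>0 'k) \<Rightarrow> (nat \<times> int \<Rightarrow>\<^sub>0 'k) \<Rightarrow> nat \<times> int \<Rightarrow>\<^sub>0 'k" (infixl "\<diamondop>" 70) where
  "v \<diamondop> w = lin_ext (\<lambda>a. lin_ext (\<lambda>b.
     single (fst a + fst b, snd a + snd b) (q powi (2 * snd a * int (fst b)))) w) v"

lemma lmul_single: "single (i, j) r \<diamondop> single (i', j') s =
    single (i + i', j + j') (r * (s * q powi (2 * j * int i')))"
  by (simp add: lmul_def)

lemma lin_lmul_left: "lin (\<lambda>v. v \<diamondop> w)" and lin_lmul_right: "lin (\<lambda>w. v \<diamondop> w)"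
  unfolding lmul_def by (rule lin_lin_ext) (rule lin_lin_ext_param[OF lin_lin_ext])

lemmas lm_simps = lin_simps[OF lin_lmul_left] lin_simps[OF lin_lmul_right]

lemma lmul_assoc: "u \<diamondop> v \<diamondop> w = u \<diamondop> (v \<diamondop> w)"
proof -
  have "ev a \<diamondop> ev b \<diamondop> ev x = ev a \<diamondop> (ev b \<diamondop> ev x)" for a b x
    using q_nonzero by (cases a; cases b; cases x) (simp add: lmul_single algebra_simps power_int_add)
  then have "ev a \<diamondop> ev b \<diamondop> w = ev a \<diamondop> (ev b \<diamondop> w)" for a b w
    by (rule lin_eqI[OF lin_lmul_right lin_compose[OF lin_lmul_right lin_lmul_right]])
  then have "ev a \<diamondop> v \<diamondop> w = ev a \<diamondop> (v \<diamondop> w)" for a v w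
    by (rule lin_eqI[OF lin_compose[OF lin_lmul_left lin_lmul_right] lin_compose[OF lin_lmul_right lin_lmul_left]])
  then show ?thesis
    by (rule lin_eqI[OF lin_compose[OF lin_lmul_left lin_lmul_left] lin_lmul_left])
qed

lemma v1_lmul [simp]: "v1 \<diamondop> v = v"
  by (rule lin_eqI[OF lin_lmul_right lin_id]) (auto simp: lmul_single)

fun gimg :: "podles_gen \<Rightarrow> nat \<times> int \<Rightarrow>\<^sub>0 'k" where
  "gimg GenA = va" | "gimg GenB = vb"
| "gimg GenBs = fscale (c * d) (ev (0, -1)) + fscale (c - d) (ev (Suc 0, -1)) - ev (2, -1)"

definition wimg :: "podles_gen list \<Rightarrow> nat \<times> int \<Rightarrow>\<^sub>0 'k" where
  "wimg xs = foldr (\<lambda>x. (\<diamondop>) (gimg x)) xs v1"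

definition img :: "'k podles_free \<Rightarrow> nat \<times> int \<Rightarrow>\<^sub>0 'k" where
  "img = lin_ext (\<lambda>w. wimg (letters w))"

lemma lin_img: "lin img"
  by (auto simp: img_def)

lemmas img_simps = lin_simps[OF lin_img]

lemma lmul_v1 [simp]: "v \<diamondop> v1 = v"
  by (rule lin_eqI[OF lin_lmul_left lin_id]) (auto simp: lmul_single)

lemma wimg_append: "wimg (xs @ ys) = wimg xs \<diamondop> wimg ys"
  by (induction xs) (simp_all add: wimg_def lmul_assoc)

lemma img_mult: "img (f * g) = img f \<diamondop> img g"
proof -
  have 1: "img (single v 1 * single w 1) = img (single v 1) \<diamondop> img (single w 1)" for v w
    by (simp add: img_def mult_single plus_podles_word_def wimg_append)
  have "img (single v 1 * g) = img (single v 1) \<diamondop> img g" for v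
    by (rule lin_eqI[OF lin_compose[OF lin_img lin_mult_right] lin_compose[OF lin_lmul_right lin_img]]) (rule 1)
  then show ?thesis
    by (rule lin_eqI[OF lin_compose[OF lin_img lin_mult_left] lin_compose[OF lin_lmul_left lin_img]])
qed

lemma img_gen: "img (gen x) = gimg x"
  by (simp add: img_def gen_def wimg_def)

lemma img_one: "img 1 = v1"
  using lin_ext_single[of "\<lambda>w. wimg (letters w)" 0 1]
  by (simp only: single_one fs.scale_one img_def) (simp add: zero_podles_word_def wimg_def)

lemma img_rels:
  assumes "r \<in> podles_rels q c d" shows "img r = 0"
proof -
  note simps = img_simps img_mult img_gen img_one gimg.simps lm_simps lmul_single
    lookup_add lookup_minus lookup_single when_def power_int_def eval_nat_numeral field_simps
  from assms show ?thesis
  proof (cases rule: rels_cases)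
    case 1
    show ?thesis
      unfolding 1 using q_nonzero by (auto intro!: poly_mapping_eqI simp: simps)
  next
    case 2
    show ?thesis
      unfolding 2 using q_nonzero by (auto intro!: poly_mapping_eqI simp: simps)
  next
    case 3
    show ?thesis
      unfolding 3 using q_nonzero by (auto intro!: poly_mapping_eqI simp: simps)
  next
    case 4
    show ?thesis
      unfolding 4 using q_nonzero by (auto intro!: poly_mapping_eqI simp: simps)
  qed
qed

lemma img_I: "f \<in> I \<Longrightarrow> img f = 0"
proof -
  have "I \<subseteq> {f. img f = 0}"
    by (rule I_least) (auto intro!: fs.subspaceI simp: img_simps img_mult lm_simps img_rels)
  then show "f \<in> I \<Longrightarrow> img f = 0"
    by blast
qed

definition iota :: "(nat \<times> int \<Rightarrow>\<^sub>0 'k) \<Rightarrow> nat \<times> int \<Rightarrow>\<^sub>0 'k" where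
  "iota v = img (emb v)"

lemma lin_iota: "lin iota"
  unfolding iota_def[abs_def] by (rule lin_compose[OF lin_img lin_emb])

lemmas iota_simps = lin_simps[OF lin_iota]

lemma iota_nf: "iota (nf f) = img f"
  using img_I[of "f - emb (nf f)"] cong_nf[of f] by (simp add: cong_def iota_def img_simps)

lemma iota_mult: "iota (v \<star> w) = iota v \<diamondop> iota w"
  by (simp add: vmul_def iota_nf img_mult) (simp add: iota_def)

lemma iota_gens: "iota va = va" "iota vb = vb" "iota vb' = gimg GenBs" "iota v1 = v1"
  by (simp_all only: iota_def emb_gens img_gen gimg.simps img_one)

lemma iota_pol: "iota (pol f) = pol f"
proof (rule lin_eq_on_keys[OF lin_iota lin_id])
  fix b assume "b \<in> keys (pol f)"
  then obtain i where b: "b = (i, 0)"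
    using pol_VV[of f] by (cases b) auto
  have "iota (ev (i, 0)) = ev (i, 0)"
  proof (induction i)
    case (Suc i)
    have "iota (ev (Suc i, 0)) = va \<diamondop> iota (ev (i, 0))"
      using va_single[of i 0] iota_mult[of va "ev (i, 0)"] by (simp only: iota_gens)
    then show ?case
      by (simp add: Suc lmul_single)
  qed (simp only: iota_gens)
  then show "iota (ev b) = ev b"
    by (simp add: b)
qed

section \<open>The derivations \<open>x d/dx\<close> and \<open>y d/dy\<close>, and the twisted
  trace\<close>

definition Ed :: "(nat \<times> int \<Rightarrow>\<^sub>0 'k) \<Rightarrow> nat \<times> int \<Rightarrow>\<^sub>0 'k" where
  "Ed = lin_ext (\<lambda>b. single b (of_nat (fst b)))"

definition Dd :: "(nat \<times> int \<Rightarrow>\<^sub>0 'k) \<Rightarrow> nat \<times> int \<Rightarrow>\<^sub>0 'k" where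
  "Dd = lin_ext (\<lambda>b. single b (of_int (snd b)))"

definition sl :: "'k \<Rightarrow> (nat \<times> int \<Rightarrow>\<^sub>0 'k) \<Rightarrow> nat \<times> int \<Rightarrow>\<^sub>0 'k" where
  "sl l = lin_ext (\<lambda>b. single b (l powi snd b))"

lemma lin_Ed: "lin Ed" and lin_Dd: "lin Dd" and lin_sl: "lin (sl l)"
  by (auto simp: Ed_def Dd_def sl_def)

lemma lmul_lin_eqI:
  assumes "lin F" "lin G" "lin H" "lin G'" "lin H'"
    and "\<And>a b. F (ev a \<diamondop> ev b) = G (ev a) \<diamondop> H (ev b) + G' (ev a) \<diamondop> H' (ev b)"
  shows "F (v \<diamondop> w) = G v \<diamondop> H w + G' v \<diamondop> H' w"
proof -
  have "F (ev a \<diamondop> w) = G (ev a) \<diamondop> H w + G' (ev a) \<diamondop> H' w" for a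
    by (rule lin_eqI[OF lin_compose[OF assms(1) lin_lmul_right]
          lin_plus[OF lin_compose[OF lin_lmul_right assms(3)] lin_compose[OF lin_lmul_right assms(5)]]]) (rule assms(6))
  then show ?thesis
    by (rule lin_eqI[OF lin_compose[OF assms(1) lin_lmul_left]
          lin_plus[OF lin_compose[OF lin_lmul_left assms(2)] lin_compose[OF lin_lmul_left assms(4)]]])
qed

lemma Ed_lmul: "Ed (v \<diamondop> w) = Ed v \<diamondop> w + v \<diamondop> Ed w"
proof (rule lmul_lin_eqI[OF lin_Ed lin_Ed lin_id lin_id lin_Ed])
  show "Ed (ev a \<diamondop> ev b) = Ed (ev a) \<diamondop> ev b + ev a \<diamondop> Ed (ev b)" for a b
    by (cases a; cases b) (simp add: Ed_def lmul_single algebra_simps flip: single_add)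
qed

lemma Dd_lmul: "Dd (v \<diamondop> w) = Dd v \<diamondop> w + v \<diamondop> Dd w"
proof (rule lmul_lin_eqI[OF lin_Dd lin_Dd lin_id lin_id lin_Dd])
  show "Dd (ev a \<diamondop> ev b) = Dd (ev a) \<diamondop> ev b + ev a \<diamondop> Dd (ev b)" for a b
    by (cases a; cases b) (simp add: Dd_def lmul_single algebra_simps flip: single_add)
qed

lemma sl_lmul: "l \<noteq> 0 \<Longrightarrow> sl l (v \<diamondop> w) = sl l v \<diamondop> sl l w"
proof -
  assume "l \<noteq> 0"
  then have "sl l (ev a \<diamondop> ev b) = sl l (ev a) \<diamondop> sl l (ev b) + 0 \<diamondop> 0" for a b
    by (cases a; cases b) (simp add: sl_def lmul_single lm_simps power_int_add mult_ac)
  from lmul_lin_eqI[OF lin_sl lin_sl lin_sl lin_const_zero lin_const_zero this] show ?thesis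
    by (simp add: lm_simps)
qed

lemma sl_Ed: "sl l (Ed v) = Ed (sl l v)"
  by (rule lin_eqI[OF lin_compose[OF lin_sl lin_Ed] lin_compose[OF lin_Ed lin_sl]]) (simp add: Ed_def sl_def mult.commute)

lemma sl_Dd: "sl l (Dd v) = Dd (sl l v)"
  by (rule lin_eqI[OF lin_compose[OF lin_sl lin_Dd] lin_compose[OF lin_Dd lin_sl]]) (simp add: Dd_def sl_def mult.commute)

lemma img_subst:
  assumes "l \<noteq> 0" shows "img (subst (scl 1 l) f) = sl l (img f)"
proof (rule lin_eqI[OF lin_compose[OF lin_img lin_subst] lin_compose[OF lin_sl lin_img]])
  fix w
  have gen: "img (scl 1 l x) = sl l (gimg x)" for x
    by (cases x) (simp_all add: img_simps img_gen sl_def lin_ext_simps fs.scale_right_distrib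
        fs.scale_right_diff_distrib mult.commute power_int_minus)
  have "img (subst (scl 1 l) (single (Word xs) 1)) = sl l (img (single (Word xs) 1))" for xs
  proof (induction xs)
    case Nil
    have "single (Word []) 1 = (1 :: 'k podles_free)"
      by (simp flip: zero_podles_word_def)
    then show ?case
      by (simp add: subst_one img_one sl_def)
  next
    case (Cons x xs)
    then show ?case
      using assms by (simp add: single_Word_Cons subst_mult subst_gen img_mult img_gen gen sl_lmul)
  qed
  then show "img (subst (scl 1 l) (single w 1)) = sl l (img (single w 1))"
    by (cases w) simp
qed

lemma iota_sg: "l \<noteq> 0 \<Longrightarrow> iota (sg 1 l v) = sl l (iota v)"
  by (simp add: sg_def iota_nf img_subst) (simp add: iota_def)

text \<open>The index is \<open>Suc n\<close> because \<open>Ed\<close> contributes one further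
  factor \<open>x\<close>; see \<open>trc_TL_Phi\<close>.\<close>

definition trc :: "nat \<Rightarrow> (nat \<times> int \<Rightarrow>\<^sub>0 'k) \<Rightarrow> 'k" where
  "trc n v = lookup v (Suc n, 0)"

text \<open>Only pairs of monomials with \<open>i + i' = Suc n\<close> and \<open>j + j' = 0\<close>
  contribute. Exchanging them costs \<open>q powi (2 * j * (n + 1))\<close>, which this value of
  \<open>l\<close> compensates.\<close>

lemma trc_twisted:
  assumes "l = q powi (- (2 * int n + 2))" shows "trc n (sl l y \<diamondop> v) = trc n (v \<diamondop> y)"
proof -
  \<comment> \<open>The scalar-valued \<open>trc n\<close> is wrapped as a map into the free space,
    so that the extension lemmas for \<open>lin\<close> apply.\<close>
  define P where "P = (\<lambda>v :: nat \<times> int \<Rightarrow>\<^sub>0 'k. single (Suc n, 0 :: int) (trc n v))"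
  have P: "lin P"
    by (rule linI) (auto simp: P_def trc_def lookup_add single_add)
  have "P (sl l (ev a) \<diamondop> ev b) = P (ev b \<diamondop> ev a)" for a b
  proof -
    obtain i j i' j' where ab: "a = (i, j)" "b = (i', j')"
      by (cases a; cases b)
    have "l powi j * q powi (2 * j * int i') = q powi (2 * j' * int i)" if "i + i' = Suc n" "j + j' = 0"
    proof -
      have "l powi j * q powi (2 * j * int i') = q powi (- (2 * int n + 2) * j + 2 * j * int i')"
        unfolding assms power_int_mult[symmetric] by (rule power_int_add[symmetric]) (simp add: q_nonzero)
      also have "- (2 * int n + 2) * j + 2 * j * int i' = 2 * j' * int i"
      proof -
        have "int n = int i + int i' - 1" "j' = - j"
          using that by auto
        then show ?thesis
          by (simp only:) (simp add: algebra_simps)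
      qed
      finally show ?thesis .
    qed
    then show ?thesis
      by (auto simp: ab P_def trc_def sl_def lmul_single lookup_single when_def add.commute)
  qed
  then have "P (sl l (ev a) \<diamondop> v) = P (v \<diamondop> ev a)" for a
    by (rule lin_eqI[OF lin_compose[OF P lin_lmul_right] lin_compose[OF P lin_lmul_left]])
  then have "P (sl l y \<diamondop> v) = P (v \<diamondop> y)"
    by (rule lin_eqI[OF lin_compose[OF P lin_compose[OF lin_lmul_left lin_sl]] lin_compose[OF P lin_lmul_right]])
  then show ?thesis
    by (simp add: P_def) (metis lookup_single_eq)
qed

end

context twisted_sphere
begin

section \<open>The cocycle and its value on cycles\<close>

definition TL :: "((nat \<times> int) list \<Rightarrow>\<^sub>0 'k) \<Rightarrow> nat \<times> int \<Rightarrow>\<^sub>0 'k" where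
  "TL = lin_ext (\<lambda>bs. iota (ev (bs ! 0)) \<diamondop> Ed (iota (ev (bs ! 1))) \<diamondop> Dd (iota (ev (bs ! 2))))"

lemma lin_TL: "lin TL"
  by (auto simp: TL_def)

lemma TL_t3: "TL (t3 u v w) = iota u \<diamondop> Ed (iota v) \<diamondop> Dd (iota w)"
proof -
  note l = lin_compose[OF lin_lmul_left lin_compose[OF lin_lmul_left lin_iota]]
    lin_compose[OF lin_lmul_left lin_compose[OF lin_lmul_right lin_compose[OF lin_Ed lin_iota]]]
    lin_compose[OF lin_lmul_right lin_compose[OF lin_Dd lin_iota]]
  have 1: "TL (t3 (ev a) (ev b) (ev x)) = iota (ev a) \<diamondop> Ed (iota (ev b)) \<diamondop> Dd (iota (ev x))" for a b x
    by (simp add: t3_single TL_def)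
  have "TL (t3 (ev a) (ev b) w) = iota (ev a) \<diamondop> Ed (iota (ev b)) \<diamondop> Dd (iota w)" for a b
    by (rule lin_eqI[OF lin_compose[OF lin_TL lin_t3(3)] l(3)]) (rule 1)
  then have "TL (t3 (ev a) v w) = iota (ev a) \<diamondop> Ed (iota v) \<diamondop> Dd (iota w)" for a
    by (rule lin_eqI[OF lin_compose[OF lin_TL lin_t3(2)] l(2)])
  then show ?thesis
    by (rule lin_eqI[OF lin_compose[OF lin_TL lin_t3(1)] l(1)])
qed

text \<open>On the image of \<open>iota\<close>, the functional \<open>trc n \<circ> TL\<close> is the cup product of the derivations \<open>Ed\<close> and
  \<open>Dd\<close> with the twisted trace \<open>trc n\<close>.\<close>

lemma trc_TL_d2:
  assumes "\<epsilon> = 1" "l = q powi (- (2 * int n + 2))" shows "trc n (TL (tw.d2 u v w y)) = 0"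
proof -
  have "TL (tw.d2 u v w y) = iota u \<diamondop> Ed (iota v) \<diamondop> Dd (iota w) \<diamondop> iota y
      - sl l (iota y) \<diamondop> (iota u \<diamondop> Ed (iota v) \<diamondop> Dd (iota w))"
    using iota_sg[OF l_nonzero] unfolding d2_t3
    by (simp add: lin_simps[OF lin_TL] TL_t3 assms(1) iota_mult Ed_lmul Dd_lmul lm_simps lmul_assoc)
  then show ?thesis
    using trc_twisted[OF assms(2), of "iota y" "iota u \<diamondop> Ed (iota v) \<diamondop> Dd (iota w)"]
    by (simp add: trc_def lookup_minus)
qed

lemma trc_TL_sg:
  assumes "\<epsilon> = 1" shows "trc n (TL (t3 (sg \<epsilon> l u) (sg \<epsilon> l v) (sg \<epsilon> l w))) = trc n (TL (t3 u v w))"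
proof -
  have "TL (t3 (sg \<epsilon> l u) (sg \<epsilon> l v) (sg \<epsilon> l w)) = sl l (TL (t3 u v w))"
    unfolding TL_t3 unfolding assms
    by (simp only: iota_sg[OF l_nonzero] sl_Ed[symmetric] sl_Dd[symmetric] sl_lmul[OF l_nonzero])
  moreover have "trc n (sl l v) = trc n v" for v
  proof -
    have "lookup (sl l v) (Suc n, 0) = 1 * lookup v (Suc n, 0)"
      unfolding sl_def by (rule lookup_lin_delta[OF lin_lin_ext]) (auto simp: lookup_single when_def)
    then show ?thesis
      by (simp add: trc_def)
  qed
  ultimately show ?thesis
    by simp
qed

text \<open>\<open>Ed\<close> kills \<open>y\<close> and \<open>Dd\<close> kills \<open>x\<close>,
  so only tensors ending in \<open>A\<close>, \<open>B\<close> or in \<open>B\<^sup>*\<close>,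
  \<open>B\<close> contribute. The first kind yields \<open>- x * f1 * pA\<close>, the second
  \<open>x * pA' * f\<close>, since \<open>Ed\<close> differentiates \<open>pA\<close> in the image
  of \<open>B\<^sup>*\<close>.\<close>

lemma trc_TL_Phi: "trc n (TL (Phi f1 f)) = - coeff (f1 * pA - pA' * f) n"
proof -
  have z: "Ed vb = 0" "Ed v1 = 0" "Dd va = 0" "Dd v1 = 0" and E: "Ed va = va" "Dd vb = vb"
    by (simp_all add: Ed_def Dd_def)
  have Phi1: "TL (Phi1 m) = - fscale (q\<^sup>2) (iota m \<diamondop> va \<diamondop> vb)" for m
    by (simp add: Phi1_def lin_simps[OF lin_TL] TL_t3 iota_gens z E lm_simps)
  have fac: "fscale (q\<^sup>2) (iota m \<diamondop> va \<diamondop> vb) = iota (fscale (q\<^sup>2) (m \<star> va) \<star> vb)" for m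
    by (simp only: iota_simps iota_mult iota_gens vm_simps)
  have "TL (Phi1 (pol f1 \<star> vb')) = - iota (va \<star> (pol f1 \<star> vb') \<star> vb)"
    by (simp only: Phi1 fac scaled_pol_vb'_va)
  also have "va \<star> (pol f1 \<star> vb') \<star> vb = va \<star> pol (f1 * pA)"
    by (simp only: vmul_assoc vb'_vb_pol pol_mult)
  also have "\<dots> = pol (pCons 0 (f1 * pA))"
    by (simp add: pol_pCons)
  finally have 1: "TL (Phi1 (pol f1 \<star> vb')) = - pol (pCons 0 (f1 * pA))"
    by (simp only: iota_pol)
  have "Ed (gimg GenBs) \<diamondop> vb = pol (pCons 0 pA')"
    by (rule sym, rule pol_eqI)
      (auto simp: Ed_def lin_ext_simps lm_simps lmul_single lookup_add lookup_minus lookup_single when_def pA'_def coeff_pCons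
        split: nat.split)
  then have 3: "TL (Phi3 (pol f)) = pol (pCons 0 (pA' * f))"
    using iota_mult[of "pol f" "pol (pCons 0 pA')"]
    by (simp add: Phi3_def lin_simps[OF lin_TL] TL_t3 iota_gens z E lm_simps iota_pol lmul_assoc pol_mult[symmetric]
        mult.commute del: gimg.simps)
  have 4: "TL (Phi4 v) = 0" for v
    by (simp add: Phi4_def lin_simps[OF lin_TL] TL_t3 iota_gens z lm_simps del: gimg.simps)
  show ?thesis
    by (simp add: Phi_def lin_simps[OF lin_TL] 1 3 4 trc_def lookup_add lookup_minus lookup_pol)
qed

lemma keys_Phi: "keys (Phi f1 f) \<subseteq> {bs. length bs = 3}"
proof -
  let ?S = "{w :: (nat \<times> int) list \<Rightarrow>\<^sub>0 'k. keys w \<subseteq> {bs. length bs = 3}}"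
  have t: "t3 u v w \<in> ?S" for u v w
    using keys_tens[of "[u, v, w]"] by (simp add: t3_def numeral_3_eq_3 del: tens.simps)
  then have "Phi1 n \<in> ?S" "Phi3 n \<in> ?S" "Phi4 n \<in> ?S" for n
    unfolding Phi_defs
    by (intro fs.subspace_add[OF subspace_keys] fs.subspace_diff[OF subspace_keys] fs.subspace_scale[OF subspace_keys] t)+
  then have "Phi f1 f \<in> ?S"
    unfolding Phi_def by (intro fs.subspace_add[OF subspace_keys] fs.subspace_diff[OF subspace_keys])
  then show ?thesis
    by simp
qed

text \<open>The cocycle reads off, up to sign, the only coefficient that \<open>sigma_cycle\<close>
  leaves open; if it vanishes, \<open>Phi_boundary\<close> applies.\<close>

lemma HH2_sigma_special:
  assumes e: "\<epsilon> = 1" and l: "l = q powi (- (2 * int n + 2))"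
  shows "linear_iso (twisted_HH (podles q c d) (podles_end q c d (scl \<epsilon> l)) 2) (ground_space :: ('k, 'k) module)"
proof -
  define T where "T w = trc n (TL w)" for w
  have lT: "T (x + y) = T x + T y" "T (fscale r x) = r * T x" for x y r
    by (simp_all add: T_def trc_def lin_simps[OF lin_TL] lookup_add)
  have T_Bd: "T w = 0" if "w \<in> tw.Bd" for w
  proof -
    have "tw.Bd \<subseteq> {w. T w = 0}"
      unfolding tw.Bd_def using lT(2)[of 0 0]
      by (intro fs.span_minimal) (auto simp: T_def trc_TL_d2[OF e l] lT[unfolded T_def] intro!: fs.subspaceI)
    then show ?thesis
      using that by blast
  qed
  have powi_inj: "l \<noteq> q powi (- (2 * int i + 2))" if "i \<noteq> n" for i
  proof
    have *: "q powi (x - y) = 1" if "q powi x = q powi y" for x y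
      using that q_nonzero by (simp add: power_int_diff)
    assume "l = q powi (- (2 * int i + 2))"
    then show False
      using powi_ne_1[of "- (2 * int i + 2) - - (2 * int n + 2)"] *[of "- (2 * int i + 2)" "- (2 * int n + 2)"] l that
      by simp
  qed
  \<comment> \<open>By the Bezout identity these choices make \<open>f1 * pA - pA' * f\<close> equal
    to \<open>- monom 1 n\<close>; its sign offsets the one in \<open>trc_TL_Phi\<close>, so that
    \<open>T\<close> takes the value 1.\<close>
  define r where "r = inverse ((c + d)\<^sup>2)"
  define f1 where "f1 = smult (- 4 * r) (monom 1 n)"
  define f where "f = smult r (pA' * monom 1 n)"
  have "f1 * pA - pA' * f = smult (- r) ((pA' * pA' + smult 4 pA) * monom 1 n)"
    by (simp add: f1_def f_def algebra_simps smult_add_right)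
  also have "\<dots> = - monom 1 n"
    unfolding bezout_pA using cd_nonzero by (simp add: r_def smult_monom minus_monom)
  finally have G: "f1 * pA - pA' * f = - monom 1 n" .
  have "linear_iso (twisted_HH (podles q c d) (podles_end q c d (scl \<epsilon> l)) 2) (ground_space :: ('k, 'k) module)"
  proof (rule tw.HH2_ground[where T = T and ?w0.0 = "Phi f1 f"])
    show "T (tens [sg \<epsilon> l u, sg \<epsilon> l v, sg \<epsilon> l w]) = T (tens [u, v, w])" for u v w
      using trc_TL_sg[OF e, of n u v w] by (simp only: T_def t3_def)
    show "T (tw.d2 u v w y) = 0" for u v w y
      by (simp add: T_def trc_TL_d2[OF e l])
    show "keys (Phi f1 f) \<subseteq> {bs. length bs = 3}"
      by (rule keys_Phi)
    show "T (Phi f1 f) = 1"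
      unfolding T_def trc_TL_Phi G by simp
    have "q\<^sup>2 * l * q ^ (2 * n) = 1"
    proof -
      have "q\<^sup>2 * l * q ^ (2 * n) = q powi (2 * int n + 2) * l"
        using q_nonzero by (simp add: power_int_add power_int_mult power_mult)
      also have "\<dots> = 1"
        unfolding l power_int_minus using q_nonzero by simp
      finally show ?thesis .
    qed
    then have "- monom 1 n - smult (q\<^sup>2 * l) (theta (- monom 1 n)) = 0"
      by (intro poly_eqI) (auto simp: coeff_theta mult.assoc)
    then show "tw.D1 (Phi f1 f) = 0"
      unfolding D1_Phi_sigma[OF e] G by (simp add: pol_simps t2_simps)
    show "w \<in> tw.Bd" if w: "keys w \<subseteq> {bs. length bs = 3}" "tw.D1 w = 0" "T w = 0" for w
    proof -
      obtain f1 f where wf: "w - Phi f1 f \<in> tw.Bd"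
        and z: "\<And>i. l \<noteq> q powi (- (2 * int i + 2)) \<Longrightarrow> coeff (f1 * pA - pA' * f) i = 0"
        by (rule sigma_cycle[OF e w(1,2)]) (rule that, blast+)
      have "T w = T (w - Phi f1 f) + T (Phi f1 f)"
        using lT(1)[of "w - Phi f1 f" "Phi f1 f"] by simp
      then have "coeff (f1 * pA - pA' * f) n = 0"
        using T_Bd[OF wf] w(3) trc_TL_Phi[of n f1 f] by (simp add: T_def)
      then have "coeff (f1 * pA - pA' * f) i = 0" for i
        using z[OF powi_inj, of i] by (cases "i = n") auto
      then have "f1 * pA = pA' * f"
        by (simp add: poly_eq_iff)
      from fs.subspace_add[OF tw.subspace_Bd wf Phi_boundary[OF e this]] show ?thesis
        by simp
    qed
  qed (rule lT)+
  then show ?thesis .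
qed

end

context podles_sphere
begin

section \<open>The automorphisms as rescalings, and powers of the modular one\<close>

lemma sigma_aut_scl: "sigma_aut q c d l = podles_end q c d (scl 1 l)"
proof -
  have "(\<lambda>x. case x of GenA \<Rightarrow> gen GenA | GenB \<Rightarrow> const l * gen GenB | GenBs \<Rightarrow> const (inverse l) * gen GenBs) = scl 1 l"
    by (rule ext) (simp add: const_mult split: podles_gen.split)
  then show ?thesis
    by (simp only: sigma_aut_def)
qed

lemma tau_aut_scl: "tau_aut q c d l = podles_end q c d (scl (- 1) l)"
proof -
  have "(\<lambda>x. case x of GenA \<Rightarrow> - gen GenA | GenB \<Rightarrow> const l * gen GenB | GenBs \<Rightarrow> const (inverse l) * gen GenBs) = scl (- 1) l"
    by (rule ext) (simp add: const_mult split: podles_gen.split)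
  then show ?thesis
    by (simp only: tau_aut_def)
qed

lemma sigma_mod_aut: "sigma_mod q c d = sigma_aut q c d (q powi (- 2))"
proof -
  have "(\<lambda>x. case x of GenA \<Rightarrow> gen GenA | GenB \<Rightarrow> const (q powi (- 2)) * gen GenB | GenBs \<Rightarrow> const (q\<^sup>2) * gen GenBs) = scl 1 (q powi (- 2))"
    by (rule ext) (simp add: const_mult power_int_minus split: podles_gen.split)
  then show ?thesis
    by (simp only: sigma_mod_def sigma_aut_scl)
qed

text \<open>In coordinates the automorphisms are diagonal with eigenvalues multiplicative in
  \<open>l\<close>, and coordinates are injective on the carrier.\<close>

lemma sigma_aut_funpow:
  assumes "l \<noteq> 0" "C \<in> carrier (podles q c d)"
  shows "(sigma_aut q c d l ^^ n) C = sigma_aut q c d (l ^ n) C"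
proof -
  have b: "based_algebra (podles q c d) (sigma_aut q c d m) crd (\<star>) (sg 1 m) (wt 1 m)" if "m \<noteq> 0" for m
    unfolding sigma_aut_scl using that by (intro based_podles) auto
  have sgr: "sg 1 l (single b r) = single b (r * wt 1 l b)" for b r
    using lin_scale[OF based_algebra.lin_sg[OF b[OF assms(1)]], of r "ev b"] by (simp add: sg_single)
  have sg: "sg 1 l (sg 1 (l ^ n) v) = sg 1 (l ^ Suc n) v" for n v
    by (rule lin_eqI[OF lin_compose[OF based_algebra.lin_sg[OF b[OF assms(1)]] based_algebra.lin_sg[OF b]] based_algebra.lin_sg[OF b]])
      (use assms(1) sgr in \<open>simp_all add: sg_single wt_def power_int_mult_distrib mult.commute\<close>)
  have "(sigma_aut q c d l ^^ n) C \<in> carrier (podles q c d) \<and> crd ((sigma_aut q c d l ^^ n) C) = sg 1 (l ^ n) (crd C)"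
  proof (induction n)
    case 0
    have "sg 1 1 v = v" for v
      by (rule lin_eqI[OF based_algebra.lin_sg[OF b] lin_id]) (simp_all add: sg_single wt_def)
    then show ?case
      using assms(2) by simp
  next
    case (Suc n)
    then show ?case
      using based_algebra.aut_closed[OF b[OF assms(1)]] based_algebra.crd_aut[OF b[OF assms(1)]] sg by simp
  qed
  moreover have "l ^ n \<noteq> 0"
    using assms(1) by simp
  ultimately show ?thesis
    using based_algebra.crd_inj[OF b] based_algebra.aut_closed[OF b] based_algebra.crd_aut[OF b] assms(2) by metis
qed

end

theorem theorem4p6:
  fixes q c d :: "'k::field_char_0"
  assumes q_nonzero: "q \<noteq> 0"
    and q_not_root_of_unity: "\<And>n::nat. n > 0 \<Longrightarrow> q ^ n \<noteq> 1"
    and cd: "c + d \<noteq> 0"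
  shows "(\<forall>b::nat. linear_iso
            (twisted_HH (podles q c d) (sigma_aut q c d (q powi (- (2 * int b + 2)))) 2)
            (ground_space :: ('k, 'k) module))
       \<and> {restrict (sigma_aut q c d (q powi (- (2 * int b + 2)))) (carrier (podles q c d)) | b::nat. True}
           = {restrict (sigma_mod q c d ^^ n) (carrier (podles q c d)) | n::nat. n > 0}
       \<and> (\<forall>l. l \<noteq> 0 \<and> (\<forall>b::nat. l \<noteq> q powi (- (2 * int b + 2))) \<longrightarrow>
            carrier (twisted_HH (podles q c d) (sigma_aut q c d l) 2)
              = {\<zero>\<^bsub>twisted_HH (podles q c d) (sigma_aut q c d l) 2\<^esub>})
       \<and> (c = d \<longrightarrow> (\<forall>l. l \<noteq> 0 \<longrightarrow>
            carrier (twisted_HH (podles q c d) (tau_aut q c d l) 2)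
              = {\<zero>\<^bsub>twisted_HH (podles q c d) (tau_aut q c d l) 2\<^esub>}))"
proof (intro conjI allI impI)
  interpret P: podles_sphere q c d
    by unfold_locales (rule q_nonzero)
  have tw: "twisted_sphere q c d \<epsilon> l" if "l \<noteq> 0" "\<epsilon>\<^sup>2 = 1" "(c - d) * (\<epsilon> - 1) = 0" for \<epsilon> l
    using that q_not_root_of_unity cd by unfold_locales auto
  show "linear_iso (twisted_HH (podles q c d) (sigma_aut q c d (q powi (- (2 * int b + 2)))) 2)
      (ground_space :: ('k, 'k) module)" for b
    unfolding P.sigma_aut_scl
    by (rule twisted_sphere.HH2_sigma_special[OF tw refl refl]) (use q_nonzero in auto)
  show "carrier (twisted_HH (podles q c d) (sigma_aut q c d l) 2)
      = {\<zero>\<^bsub>twisted_HH (podles q c d) (sigma_aut q c d l) 2\<^esub>}"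
    if "l \<noteq> 0 \<and> (\<forall>b::nat. l \<noteq> q powi (- (2 * int b + 2)))" for l
  proof -
    interpret twisted_sphere q c d 1 l
      by (rule tw) (use that in auto)
    show ?thesis
      unfolding P.sigma_aut_scl using sigma_trivial that by (intro tw.HH2_trivial) auto
  qed
  show "carrier (twisted_HH (podles q c d) (tau_aut q c d l) 2)
      = {\<zero>\<^bsub>twisted_HH (podles q c d) (tau_aut q c d l) 2\<^esub>}" if "c = d" "l \<noteq> 0" for l
  proof -
    interpret twisted_sphere q c d "-1" l
      by (rule tw) (use that in auto)
    show ?thesis
      unfolding P.tau_aut_scl using tau_trivial by (intro tw.HH2_trivial) auto
  qed
  \<comment> \<open>The exponents are shifted by one: \<open>b\<close> corresponds to the power
    \<open>Suc b\<close>, so all \<open>b \<ge> 0\<close> give exactly the positive powers.\<close>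
  have eq: "restrict (sigma_mod q c d ^^ Suc b) (carrier (podles q c d)) =
      restrict (sigma_aut q c d (q powi (- (2 * int b + 2)))) (carrier (podles q c d))" for b
  proof (rule restrict_ext)
    fix C assume C: "C \<in> carrier (podles q c d)"
    have "(q powi (- 2)) ^ Suc b = q powi (- 2 * int (Suc b))"
      by (simp only: power_int_mult power_int_of_nat)
    also have "- 2 * int (Suc b) = - (2 * int b + 2)"
      by simp
    finally show "(sigma_mod q c d ^^ Suc b) C = sigma_aut q c d (q powi (- (2 * int b + 2))) C"
      using P.sigma_aut_funpow[OF _ C, of "q powi (- 2)" "Suc b"] q_nonzero
      unfolding P.sigma_mod_aut by simp
  qed
  show "{restrict (sigma_aut q c d (q powi (- (2 * int b + 2)))) (carrier (podles q c d)) | b::nat. True}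
      = {restrict (sigma_mod q c d ^^ n) (carrier (podles q c d)) | n::nat. n > 0}"
    unfolding eq[symmetric] by (auto simp del: funpow.simps) (metis gr0_implies_Suc)
qed

end
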